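(* Let $f:\mathbb R\to\mathbb R$ be an even (measurable) function for which there exist fixed $\epsilon>0$ and $A>0$ with $|f(x)|<A(1+|x|)^{-(1+\epsilon)}$ for all $x\in\mathbb R$. Then the variance of $Z_f$ tends to $\sigma^2$ as $N\to\infty$, where $$\sigma^2=\int_{-\infty}^\infty\min(|u|,1)\,\widehat f(u)^2\,du;$$ that is, $\lim_{N\to\infty}\mathbb E\{(Z_f-\mathbb E\{Z_f\})^2\}=\sigma^2$.
   Context: The Fourier transform is $\widehat f(u)=\int_{-\infty}^\infty f(x)e^{-2\pi i xu}\,dx$. For a positive integer $N$ define the $2\pi$-periodic function $$F_N(\theta)=\sum_{j=-\infty}^\infty f\left(\tfrac N{2\pi}(\theta+2\pi j)\right),$$ and for an $N\times N$ unitary matrix $U$ with eigenvalues $e^{i\theta_1},\dots,e^{i\theta_N}$ (with multiplicity) define $Z_f(U)=\sum_{j=1}^N F_N(\theta_j)$. $\mathbb E$ denotes expectation over $U$ in the unitary group $U(N)$ with respect to Haar probability measure. *)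

theory Defs
  imports "HOL-Probability.Probability" "Jordan_Normal_Form.Schur_Decomposition"
begin

definition fourier :: "(real \<Rightarrow> real) \<Rightarrow> real \<Rightarrow> complex" where
  "fourier f u = (LINT x|lborel. complex_of_real (f x) * exp (- (2 * pi * \<i> * x * u)))"

definition periodization :: "(real \<Rightarrow> real) \<Rightarrow> nat \<Rightarrow> real \<Rightarrow> real" where
  "periodization f N \<theta> =
     (\<Sum>\<^sub>\<infinity>j\<in>(UNIV :: int set). f (real N / (2 * pi) * (\<theta> + 2 * pi * real_of_int j)))"

definition unitary_group :: "nat \<Rightarrow> complex mat set" where
  "unitary_group N = {U \<in> carrier_mat N N. mat_adjoint U * U = 1\<^sub>m N}"

text \<open>The eigenvalues with algebraic multiplicity are the roots of the characteristic
  polynomial. Each is written as \<open>exp (\<i> * Arg z)\<close>; since \<^const>\<open>periodization\<close> is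
  \<open>2 * pi\<close>-periodic in its angle, the choice of the branch of the argument is immaterial.\<close>

definition linear_stat :: "(real \<Rightarrow> real) \<Rightarrow> nat \<Rightarrow> complex mat \<Rightarrow> real" where
  "linear_stat f N U = (\<Sum>z\<in>#proots (char_poly U). periodization f N (Arg z))"

text \<open>The Borel \<open>\<sigma>\<close>-algebra of the unitary group, in its topology as a subset of
  \<open>\<complex>\<close>$^{N \times N}$: it is pulled back along the map sending a matrix to its family of
  entries. Only the space and the measurable sets of this object matter.\<close>

definition unitary_borel :: "nat \<Rightarrow> complex mat measure" where
  "unitary_borel N =
     vimage_algebra (unitary_group N)
       (\<lambda>U. \<lambda>(i, j)\<in>{..<N} \<times> {..<N}. U $$ (i, j))
       (\<Pi>\<^sub>M p\<in>{..<N} \<times> {..<N}. borel)"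

text \<open>This determines the measure uniquely. On a compact group the left Haar measure
  is also right invariant.\<close>

definition haar_prob :: "nat \<Rightarrow> complex mat measure \<Rightarrow> bool" where
  "haar_prob N M \<longleftrightarrow>
     prob_space M \<and> sets M = sets (unitary_borel N) \<and>
     (\<forall>V\<in>unitary_group N. \<forall>A\<in>sets M. emeasure M ((\<lambda>U. V * U) ` A) = emeasure M A)"

end

theory Submission
  imports Defs
begin

text \<open>Since the Haar measure is invariant, derivatives along the unitary group have expectation zero. Write
  \<open>p\<^sub>k = tr U\<^sup>k\<close>, and \<open>h\<^sub>a\<close>, \<open>e\<^sub>b\<close> for the complete homogeneous and elementary symmetric functions of the
  eigenvalues. Applied to the matrix fields \<open>U\<^sup>m h\<^sub>a e\<^sub>b cnj p\<^sub>k\<close>, this gives a recursion for the moments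
  \<open>\<bbbE> (h\<^sub>a e\<^sub>b cnj p\<^sub>a\<^sub>+\<^sub>b)\<close> with an explicit solution, and \<open>p\<^sub>k = \<Sum>\<^sub>j (-1)\<^sup>j\<^sup>-\<^sup>1 j e\<^sub>j h\<^sub>k\<^sub>-\<^sub>j\<close> then yields
  \<open>\<bbbE> \<bar>p\<^sub>k\<bar>\<^sup>2 = min k N\<close>. Consequently the variance of a linear statistic with symbol \<open>g\<close> on the unit circle is
  \<open>N \<integral> g\<^sup>2 - \<Sum>\<^sub>m (N - \<bar>m\<bar>) \<bar>c\<^sub>m\<bar>\<^sup>2\<close>, summed over \<open>\<bar>m\<bar> < N\<close>, where \<open>c\<^sub>m\<close> are the Fourier coefficients of \<open>g\<close>. This
  involves only finitely many of them, so it extends from trigonometric polynomials to all bounded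
  Borel functions. For \<open>g = F\<^sub>N\<close> the first term tends to \<open>\<integral> f\<^sup>2\<close>, which is the squared norm of the Fourier
  transform by Plancherel, and the second is a Riemann sum of its square against \<open>max 0 (1 - \<bar>u\<bar>)\<close>.\<close>

text \<open>A Schwinger--Dyson equation for the second moment of p_k alone does not close:
  differentiating a power of U produces the products p_l p_(m-l). Weighted sums over m remove them,
  because h_a and e_b are eigenfunctions of the Laplacian. Why just the products h_a e_b: each is
  the sum of the Schur functions of the hooks (a+1, 1^(b-1)) and (a, 1^b), and by the
  Murnaghan--Nakayama rule hooks are the only shapes that pair with p_k, with sign (-1)^(rows - 1).
  The two signs cancel unless a hook is missing or has more than N rows; this predicts the explicit
  solution that the recursion then confirms. The natural form of the variance is the sum of min |m|
  N times |c_m|^2. Since F_N need not even be continuous, its coefficients come without a rate of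
  decay. Writing min |m| N as N minus the positive part of N - |m| and using Parseval moves the
  infinite tail into the integral of g^2, and what remains is stable under bounded pointwise
  limits.\<close>

section \<open>Newton recursions\<close>

text \<open>With the power sums of a multiset of variables as \<open>p\<close>, the sign \<open>c = 1\<close> gives the complete
  homogeneous and \<open>c = -1\<close> the elementary symmetric functions. The value of \<open>p\<close> at \<open>0\<close> is
  irrelevant.\<close>

fun newton :: "complex \<Rightarrow> (nat \<Rightarrow> complex) \<Rightarrow> nat \<Rightarrow> complex" where
  "newton c p 0 = 1"
| "newton c p (Suc n) = (\<Sum>i\<le>n. c ^ i * p (Suc i) * newton c p (n - i)) / of_nat (Suc n)"

declare newton.simps(2) [simp del]

lemma newton_rec: "of_nat n * newton c p n = (\<Sum>i=1..n. c ^ (i - 1) * p i * newton c p (n - i))"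
proof (cases n)
  case (Suc m)
  have "of_nat n * newton c p n = (\<Sum>i\<le>m. c ^ i * p (Suc i) * newton c p (m - i))"
    unfolding Suc newton.simps by (simp del: of_nat_Suc)
  also have "\<dots> = (\<Sum>i=1..n. c ^ (i - 1) * p i * newton c p (n - i))"
    by (rule sum.reindex_bij_witness[of _ "\<lambda>i. i - 1" Suc]) (auto simp: Suc)
  finally show ?thesis .
qed simp

text \<open>The recursion has only one solution because n can be divided out. This identifies the
  coefficients of an explicit generating polynomial with \<open>newton\<close>.\<close>

lemma newton_unique:
  assumes "x 0 = 1" "\<And>n. of_nat n * x n = (\<Sum>i=1..n. c ^ (i - 1) * p i * x (n - i))"
  shows "x n = newton c p n"
proof (induction n rule: less_induct)
  case (less n)
  show ?case
  proof (cases "n = 0")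
    case False
    have "of_nat n * x n = of_nat n * newton c p n"
      unfolding assms(2) newton_rec by (intro sum.cong refl) (use less in auto)
    thus ?thesis using False by simp
  qed (use assms in auto)
qed

text \<open>A total s <= n arises as m + i with i >= 1 exactly once for each m < s.\<close>

lemma sum_pairs_by_total:
  fixes g :: "nat \<Rightarrow> complex"
  shows "(\<Sum>m\<le>n. \<Sum>i=1..n - m. g (m + i)) = (\<Sum>s\<le>n. of_nat s * g s)"
proof -
  have "(\<Sum>m\<le>n. \<Sum>i=1..n - m. g (m + i)) = (\<Sum>m\<le>n. \<Sum>s\<in>{m<..n}. g s)"
    by (intro sum.cong refl sum.reindex_bij_witness[of _ "\<lambda>s. s - m" "\<lambda>i. m + i" for m]) auto
  also have "\<dots> = (\<Sum>s\<le>n. \<Sum>m | m \<in> {..n} \<and> s \<in> {m<..n}. g s)"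
    by (subst sum.swap_restrict[symmetric]) (auto intro!: sum.cong)
  also have "\<dots> = (\<Sum>s\<le>n. of_nat s * g s)"
  proof (intro sum.cong refl)
    fix s assume "s \<in> {..n}"
    hence "{m. m \<in> {..n} \<and> s \<in> {m<..n}} = {..<s}" by auto
    thus "(\<Sum>m | m \<in> {..n} \<and> s \<in> {m<..n}. g s) = of_nat s * g s" by simp
  qed
  finally show ?thesis .
qed

text \<open>The left-hand side is the divergence of the matrix field \<open>\<Sum>\<^sub>m c\<^sup>m x\<^sub>n\<^sub>-\<^sub>m U\<^sup>m\<close>; that it is
  a multiple of \<open>x\<^sub>n\<close> says that \<open>x\<^sub>n\<close> is an eigenfunction of the Laplacian.\<close>

lemma newton_divergence:
  assumes c: "c * c = 1"
  shows "(\<Sum>m\<le>n. c ^ m * (newton c p (n - m) * (\<Sum>j<m. p j * p (m - j))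
           + (\<Sum>i=1..n - m. c ^ (i - 1) * p (m + i) * newton c p (n - m - i))))
       = (of_nat n ^ 2 + c * p 0 * of_nat n) * newton c p n"
proof -
  let ?x = "newton c p"
  have rec: "(\<Sum>i=1..n. c ^ i * p i * ?x (n - i)) = c * (of_nat n * ?x n)" for n
    unfolding newton_rec sum_distrib_left
    by (intro sum.cong refl) (auto simp: power_eq_if)
  have rec0: "(\<Sum>i\<le>n. h i) = (h 0 + (\<Sum>i=1..n. h i))" for h :: "nat \<Rightarrow> complex" and n
    by (simp add: atLeast0AtMost[symmetric] sum.atLeast_Suc_atMost)
  \<comment> \<open>The term j = 0 is set apart because \<open>p 0\<close> does not occur in the
    recursion; for traces it is the dimension N.\<close>
  have split: "(\<Sum>j<m. p j * p (m - j)) = (if m = 0 then 0 else p 0 * p m) + (\<Sum>j\<in>{1..<m}. p j * p (m - j))" for m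
    by (cases m) (auto simp: lessThan_atLeast0 sum.atLeast_Suc_lessThan)
  have "(\<Sum>m\<le>n. c ^ m * ?x (n - m) * (if m = 0 then 0 else p 0 * p m)) = p 0 * (\<Sum>m=1..n. c ^ m * p m * ?x (n - m))"
    unfolding rec0 sum_distrib_left by (auto intro!: sum.cong)
  hence 1: "(\<Sum>m\<le>n. c ^ m * ?x (n - m) * (if m = 0 then 0 else p 0 * p m)) = p 0 * c * (of_nat n * ?x n)"
    unfolding rec by simp
  have "(\<Sum>m\<le>n. c ^ m * ?x (n - m) * (\<Sum>j\<in>{1..<m}. p j * p (m - j)))
      = (\<Sum>m\<le>n. \<Sum>j\<in>{1..<m}. c ^ m * ?x (n - m) * (p j * p (m - j)))"
    by (simp add: sum_distrib_left)
  also have "\<dots> = (\<Sum>j=1..n. \<Sum>m | m \<in> {..n} \<and> j \<in> {1..<m}. c ^ m * ?x (n - m) * (p j * p (m - j)))"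
  proof -
    have "(\<Sum>m\<le>n. \<Sum>j\<in>{1..<m}. c ^ m * ?x (n - m) * (p j * p (m - j)))
      = (\<Sum>m\<le>n. \<Sum>j | j \<in> {1..n} \<and> j \<in> {1..<m}. c ^ m * ?x (n - m) * (p j * p (m - j)))"
      by (intro sum.cong refl) auto
    also have "\<dots> = (\<Sum>j=1..n. \<Sum>m | m \<in> {..n} \<and> j \<in> {1..<m}. c ^ m * ?x (n - m) * (p j * p (m - j)))"
      by (rule sum.swap_restrict) auto
    finally show ?thesis .
  qed
  \<comment> \<open>For fixed j the sum over i = m - j is again Newton's recursion, now at n -
    j.\<close>
  also have "\<dots> = (\<Sum>j=1..n. c ^ j * p j * (c * (of_nat (n - j) * ?x (n - j))))"
  proof (intro sum.cong refl)
    fix j assume j: "j \<in> {1..n}"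
    have "(\<Sum>m | m \<in> {..n} \<and> j \<in> {1..<m}. c ^ m * ?x (n - m) * (p j * p (m - j)))
        = (\<Sum>i=1..n - j. c ^ (j + i) * ?x (n - j - i) * (p j * p i))"
      by (rule sum.reindex_bij_witness[of _ "\<lambda>i. j + i" "\<lambda>m. m - j"]) (use j in auto)
    also have "\<dots> = c ^ j * p j * (\<Sum>i=1..n - j. c ^ i * p i * ?x (n - j - i))"
      by (simp add: sum_distrib_left power_add mult_ac)
    finally show "(\<Sum>m | m \<in> {..n} \<and> j \<in> {1..<m}. c ^ m * ?x (n - m) * (p j * p (m - j)))
        = c ^ j * p j * (c * (of_nat (n - j) * ?x (n - j)))"
      unfolding rec .
  qed
  finally have 2: "(\<Sum>m\<le>n. c ^ m * ?x (n - m) * (\<Sum>j\<in>{1..<m}. p j * p (m - j)))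
      = c * (\<Sum>j=1..n. c ^ j * p j * (of_nat (n - j) * ?x (n - j)))"
    by (simp add: sum_distrib_left mult_ac)
  have "(\<Sum>m\<le>n. c ^ m * (\<Sum>i=1..n - m. c ^ (i - 1) * p (m + i) * ?x (n - m - i)))
      = (\<Sum>m\<le>n. \<Sum>i=1..n - m. c * (c ^ (m + i) * p (m + i) * ?x (n - (m + i))))"
    unfolding sum_distrib_left
  proof (intro sum.cong refl, goal_cases)
    case (1 m i)
    then obtain k where k: "i = Suc k" by (cases i) auto
    \<comment> \<open>Lowering the exponent by one costs a factor c, since c is its own
      inverse.\<close>
    show ?case using c by (simp add: k power_add mult_ac)
  qed
  also have "\<dots> = c * (\<Sum>s\<le>n. of_nat s * (c ^ s * p s * ?x (n - s)))"
    by (subst sum_pairs_by_total) (simp add: sum_distrib_left mult_ac)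
  also have "(\<Sum>s\<le>n. of_nat s * (c ^ s * p s * ?x (n - s))) = (\<Sum>j=1..n. of_nat j * (c ^ j * p j * ?x (n - j)))"
    unfolding rec0 by simp
  finally have 3: "(\<Sum>m\<le>n. c ^ m * (\<Sum>i=1..n - m. c ^ (i - 1) * p (m + i) * ?x (n - m - i)))
      = c * (\<Sum>j=1..n. of_nat j * (c ^ j * p j * ?x (n - j)))" .
  \<comment> \<open>The weights n - j and j add up to n; this produces the quadratic part of the
    eigenvalue.\<close>
  have "c * (\<Sum>j=1..n. c ^ j * p j * (of_nat (n - j) * ?x (n - j))) + c * (\<Sum>j=1..n. of_nat j * (c ^ j * p j * ?x (n - j)))
      = c * (\<Sum>j=1..n. of_nat n * (c ^ j * p j * ?x (n - j)))"
    unfolding distrib_left[symmetric] sum.distrib[symmetric]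
    by (intro arg_cong[of _ _ "\<lambda>x. c * x"] sum.cong refl) (auto simp: of_nat_diff algebra_simps)
  also have "\<dots> = (c * c) * of_nat n * (of_nat n * ?x n)"
    unfolding sum_distrib_left[symmetric] rec by simp
  finally have 23: "c * (\<Sum>j=1..n. c ^ j * p j * (of_nat (n - j) * ?x (n - j))) + c * (\<Sum>j=1..n. of_nat j * (c ^ j * p j * ?x (n - j)))
      = of_nat n ^ 2 * ?x n" using c by (simp add: power2_eq_square)
  have "(\<Sum>m\<le>n. c ^ m * (?x (n - m) * (\<Sum>j<m. p j * p (m - j))
           + (\<Sum>i=1..n - m. c ^ (i - 1) * p (m + i) * ?x (n - m - i))))
      = (\<Sum>m\<le>n. c ^ m * ?x (n - m) * (if m = 0 then 0 else p 0 * p m))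
      + (\<Sum>m\<le>n. c ^ m * ?x (n - m) * (\<Sum>j\<in>{1..<m}. p j * p (m - j)))
      + (\<Sum>m\<le>n. c ^ m * (\<Sum>i=1..n - m. c ^ (i - 1) * p (m + i) * ?x (n - m - i)))"
    unfolding split by (simp add: algebra_simps sum.distrib)
  also have "\<dots> = p 0 * c * (of_nat n * ?x n) + of_nat n ^ 2 * ?x n"
    unfolding 1 2 3 using 23 by simp
  finally show ?thesis by (simp add: algebra_simps)
qed

text \<open>The left-hand side is what differentiating e_b along the field built from the h_(a-m)
  contributes to the divergence. For b > 0 the alternating sum on the right is the hook Schur
  function of (a+1, 1^(b-1)). The induction passes from (a+1, b) to (a, b+1): replacing (m, j) by
  (m-1, j+1) matches the terms with opposite sign, up to boundary terms.\<close>

lemma newton_cross: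
  fixes p :: "nat \<Rightarrow> complex"
  defines "h \<equiv> newton 1 p" and "e \<equiv> newton (-1) p"
  shows "(\<Sum>m\<le>a. \<Sum>j=1..b. (-1) ^ (j - 1) * p (m + j) * h (a - m) * e (b - j))
       = of_nat (a + b) * (\<Sum>i\<le>a. (-1) ^ i * h (a - i) * e (b + i))"
proof (induction a arbitrary: b)
  case 0
  show ?case using newton_rec[of b "-1" p] by (simp add: e_def h_def)
next
  case (Suc a)
  have hrec: "of_nat n * h n = (\<Sum>m=1..n. p m * h (n - m))" for n
    using newton_rec[of n 1 p] by (simp add: h_def)
  have erec: "of_nat n * e n = (\<Sum>j=1..n. (-1) ^ (j - 1) * p j * e (n - j))" for n
    using newton_rec[of n "-1" p] by (simp add: e_def)
  let ?t = "\<lambda>m j. (-1) ^ (j - 1) * p (m + j) * h (Suc a - m) * e (b - j)"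
  have "of_nat (a + Suc b) * (\<Sum>i\<le>a. (-1) ^ i * h (a - i) * e (Suc b + i))
      = (\<Sum>m\<le>a. \<Sum>j=1..Suc b. (-1) ^ (j - 1) * p (m + j) * h (a - m) * e (Suc b - j))"
    using Suc.IH[of "Suc b"] by simp
  also have "\<dots> = (\<Sum>m=1..Suc a. \<Sum>j\<le>b. (-1) ^ j * p (m + j) * h (Suc a - m) * e (b - j))"
    by (intro sum.reindex_bij_witness[of _ "\<lambda>m. m - 1" Suc] sum.reindex_bij_witness[of _ Suc "\<lambda>m. m - 1"]) auto
  \<comment> \<open>The boundary terms j = 0 are split off; by the recursion they sum to (a+1)
    h_(a+1) e_b.\<close>
  also have "\<dots> = (\<Sum>m=1..Suc a. p m * h (Suc a - m) * e b - (\<Sum>j=1..b. ?t m j))"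
  proof (intro sum.cong refl)
    fix m
    have "(\<Sum>j=1..b. (-1) ^ j * p (m + j) * h (Suc a - m) * e (b - j)) = - (\<Sum>j=1..b. ?t m j)"
      unfolding sum_negf[symmetric] by (intro sum.cong refl) (auto simp: power_eq_if)
    thus "(\<Sum>j\<le>b. (-1) ^ j * p (m + j) * h (Suc a - m) * e (b - j)) = p m * h (Suc a - m) * e b - (\<Sum>j=1..b. ?t m j)"
      by (simp add: atLeast0AtMost[symmetric] sum.atLeast_Suc_atMost)
  qed
  also have "\<dots> = of_nat (Suc a) * h (Suc a) * e b - (\<Sum>m=1..Suc a. \<Sum>j=1..b. ?t m j)"
    unfolding sum_subtractf hrec sum_distrib_right by simp
  finally have 1: "(\<Sum>m=1..Suc a. \<Sum>j=1..b. ?t m j) = of_nat (Suc a) * h (Suc a) * e b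
      - of_nat (a + Suc b) * (\<Sum>i\<le>a. (-1) ^ i * h (a - i) * e (Suc b + i))" by simp
  have "(\<Sum>m\<le>Suc a. \<Sum>j=1..b. ?t m j) = (\<Sum>j=1..b. ?t 0 j) + (\<Sum>m=1..Suc a. \<Sum>j=1..b. ?t m j)"
    by (simp add: atLeast0AtMost[symmetric] sum.atLeast_Suc_atMost del: sum.cl_ivl_Suc)
  also have "(\<Sum>j=1..b. ?t 0 j) = h (Suc a) * (of_nat b * e b)"
    unfolding erec sum_distrib_left by (simp add: mult_ac)
  also have "h (Suc a) * (of_nat b * e b) + (\<Sum>m=1..Suc a. \<Sum>j=1..b. ?t m j)
     = of_nat (Suc a + b) * (h (Suc a) * e b - (\<Sum>i\<le>a. (-1) ^ i * h (a - i) * e (Suc b + i)))"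
    unfolding 1 by (simp add: algebra_simps)
  also have "h (Suc a) * e b - (\<Sum>i\<le>a. (-1) ^ i * h (a - i) * e (Suc b + i))
     = (\<Sum>i\<le>Suc a. (-1) ^ i * h (Suc a - i) * e (b + i))"
    unfolding sum.atMost_Suc_shift by (simp add: sum_negf)
  finally show ?case .
qed

text \<open>Logarithmic derivatives of generating functions: the recursions say XH' = PH and XE' =
  -PE, hence (EH)' = 0, EH = 1 and P = -XE'H. The signs put into E make it the inverse of H.\<close>

lemma newton_power_sum:
  assumes "k > 0"
  shows "p k = (\<Sum>j=1..k. (-1) ^ (j - 1) * of_nat j * newton (-1) p j * newton 1 p (k - j))"
proof -
  define H where "H = Abs_fps (newton 1 p)"
  define E where "E = Abs_fps (\<lambda>n. (-1) ^ n * newton (-1) p n)"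
  define P where "P = Abs_fps (\<lambda>n. if n = 0 then 0 else p n)"
  have D: "fps_X * fps_deriv F = Abs_fps (\<lambda>n. of_nat n * fps_nth F n)" for F :: "complex fps"
    by (rule fps_ext) (auto simp: fps_X_mult_nth of_nat_diff)
  have PF: "fps_nth (P * F) n = (\<Sum>i=1..n. p i * fps_nth F (n - i))" for F n
    by (simp add: fps_mult_nth P_def sum.atLeast_Suc_atMost)
  have H: "fps_X * fps_deriv H = P * H"
    by (rule fps_ext) (use newton_rec[of _ 1 p] in \<open>simp add: D PF H_def\<close>)
  have E: "fps_X * fps_deriv E = - (P * E)"
  proof (rule fps_ext)
    fix n
    have "of_nat n * ((-1) ^ n * newton (-1) p n) = (-1) ^ n * (\<Sum>i=1..n. (-1) ^ (i - 1) * p i * newton (-1) p (n - i))"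
      using newton_rec[of n "-1" p] by (simp add: mult_ac)
    also have "\<dots> = - (\<Sum>i=1..n. p i * ((-1) ^ (n - i) * newton (-1) p (n - i)))"
      unfolding sum_distrib_left sum_negf[symmetric]
    proof (intro sum.cong refl)
      fix i assume i: "i \<in> {1..n}"
      obtain k where k: "i = Suc k" using i by (cases i) auto
      have "Suc k \<le> n" using i k by simp
      then obtain d where d: "n = Suc k + d" using le_Suc_ex by blast
      show "(-1) ^ n * ((-1) ^ (i - 1) * p i * newton (-1) p (n - i)) = - (p i * ((-1) ^ (n - i) * newton (-1) p (n - i)))"
        by (simp add: k d power_add mult_ac)
    qed
    finally show "fps_nth (fps_X * fps_deriv E) n = fps_nth (- (P * E)) n"
      by (simp add: D PF E_def)
  qed
  have "fps_X * fps_deriv (E * H) = 0"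
  proof -
    have "fps_X * fps_deriv (E * H) = E * (fps_X * fps_deriv H) + (fps_X * fps_deriv E) * H"
      by (simp add: algebra_simps)
    thus ?thesis unfolding H E by (simp add: algebra_simps)
  qed
  hence "fps_deriv (E * H) = 0" by simp
  moreover have "fps_nth (E * H) 0 = 1" by (simp add: E_def H_def)
  ultimately have EH: "E * H = 1" by (metis fps_const_1_eq_1 fps_deriv_eq_0_iff)
  have "- (fps_X * fps_deriv E) * H = P" using EH by (simp add: E mult.assoc)
  hence "p k = fps_nth (- (fps_X * fps_deriv E) * H) k" using assms by (simp add: P_def)
  also have "\<dots> = (\<Sum>j=0..k. - (of_nat j * ((-1) ^ j * newton (-1) p j)) * newton 1 p (k - j))"
    by (simp add: fps_mult_nth D E_def H_def sum_negf)
  also have "\<dots> = (\<Sum>j=1..k. - (of_nat j * ((-1) ^ j * newton (-1) p j)) * newton 1 p (k - j))"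
    by (subst sum.atLeast_Suc_atMost) auto
  also have "\<dots> = (\<Sum>j=1..k. (-1) ^ (j - 1) * of_nat j * newton (-1) p j * newton 1 p (k - j))"
    by (intro sum.cong refl) (auto simp: power_eq_if)
  finally show ?thesis .
qed

text \<open>The product of all 1 + zX has degree at most the number of factors, and its logarithmic
  derivative shows that its coefficients obey Newton's recursion with c = -1.\<close>

lemma elementary_eq_0:
  fixes Z :: "complex multiset"
  assumes "n > size Z"
  shows "newton (-1) (\<lambda>i. \<Sum>z\<in>#Z. z ^ i) n = 0"
proof -
  define F where "F Z = (\<Prod>z\<in>#Z. [:1, z:])" for Z :: "complex multiset"
  define P where "P Z = Abs_fps (\<lambda>n. if n = 0 then 0 else (-1) ^ (n - 1) * (\<Sum>z\<in>#Z. z ^ n))" for Z :: "complex multiset"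
  have P_add: "P (add_mset z Z) = P {#z#} + P Z" for z Z
    by (rule fps_ext) (simp add: P_def algebra_simps)
  have fps1: "fps_of_poly [:1, z:] = 1 + fps_const z * fps_X" for z :: complex
    by (rule fps_ext) (auto simp: coeff_pCons split: nat.splits)
  \<comment> \<open>\<open>P {#z#}\<close> is the geometric series zX/(1 + zX), that is, X times the
    logarithmic derivative of one factor.\<close>
  have P1: "(1 + fps_const z * fps_X) * P {#z#} = fps_const z * fps_X" for z
  proof (rule fps_ext)
    fix n show "fps_nth ((1 + fps_const z * fps_X) * P {#z#}) n = fps_nth (fps_const z * fps_X) n"
    proof (cases n)
      case (Suc m)
      thus ?thesis by (cases m) (simp_all add: P_def distrib_right mult.assoc fps_X_mult_nth)
    qed (simp add: P_def)
  qed
  have D: "fps_X * fps_deriv (fps_of_poly (F Z)) = P Z * fps_of_poly (F Z)" for Z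
  proof (induction Z)
    case empty
    show ?case by (simp add: F_def P_def fps_eq_iff)
  next
    case (add z Z)
    have F: "fps_of_poly (F (add_mset z Z)) = (1 + fps_const z * fps_X) * fps_of_poly (F Z)"
      by (simp add: F_def fps_of_poly_mult fps1)
    have "fps_X * fps_deriv (fps_of_poly (F (add_mset z Z)))
        = fps_const z * fps_X * fps_of_poly (F Z) + (1 + fps_const z * fps_X) * (fps_X * fps_deriv (fps_of_poly (F Z)))"
      unfolding F by (simp add: distrib_left distrib_right mult_ac)
    also have "\<dots> = ((1 + fps_const z * fps_X) * P {#z#}) * fps_of_poly (F Z) + (1 + fps_const z * fps_X) * (P Z * fps_of_poly (F Z))"
      unfolding add.IH P1 ..
    also have "\<dots> = (P {#z#} + P Z) * ((1 + fps_const z * fps_X) * fps_of_poly (F Z))"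
      by (simp only: distrib_left distrib_right mult_ac add_ac)
    finally show ?case unfolding F P_add[of z Z] .
  qed
  have "coeff (F Z) n = newton (-1) (\<lambda>i. \<Sum>z\<in>#Z. z ^ i) n" for n
  proof (rule newton_unique)
    have "poly (F Z) 0 = 1" by (simp add: F_def poly_prod_mset)
    thus "coeff (F Z) 0 = 1" by (simp add: poly_0_coeff_0)
    fix n
    have "of_nat n * coeff (F Z) n = fps_nth (fps_X * fps_deriv (fps_of_poly (F Z))) n"
      by (cases n) (auto simp: fps_X_mult_nth)
    also have "\<dots> = (\<Sum>i=1..n. (- 1) ^ (i - 1) * (\<Sum>z\<in>#Z. z ^ i) * coeff (F Z) (n - i))"
      unfolding D by (simp add: fps_mult_nth P_def sum.atLeast_Suc_atMost)
    finally show "of_nat n * coeff (F Z) n = (\<Sum>i=1..n. (- 1) ^ (i - 1) * (\<Sum>z\<in>#Z. z ^ i) * coeff (F Z) (n - i))" .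
  qed
  moreover have "degree (F Z) \<le> size Z"
  proof (induction Z)
    case (add z Z)
    have "degree (F (add_mset z Z)) \<le> degree [:1, z:] + degree (F Z)"
      unfolding F_def image_mset_add_mset prod_mset.add_mset by (rule degree_mult_le)
    also have "degree [:1, z:] \<le> 1" by simp
    finally show ?case using add by simp
  qed (simp add: F_def)
  ultimately show ?thesis using assms by (metis coeff_eq_0 le_less_trans)
qed

section \<open>Haar measure and invariant derivatives\<close>

lemma mat_adjoint_dims [simp]: "dim_row (mat_adjoint A) = dim_col A" "dim_col (mat_adjoint A) = dim_row A"
  by (auto simp: mat_adjoint_def)

lemma mat_adjoint_index [simp]:
  fixes A :: "complex mat"
  shows "i < dim_col A \<Longrightarrow> j < dim_row A \<Longrightarrow> mat_adjoint A $$ (i, j) = cnj (A $$ (j, i))"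
  by (simp add: mat_adjoint_def mat_of_rows_def)

lemma mat_adjoint_mult:
  fixes A B :: "complex mat"
  assumes "A \<in> carrier_mat n n" "B \<in> carrier_mat n n"
  shows "mat_adjoint (A * B) = mat_adjoint B * mat_adjoint A"
  using assms by (intro eq_matI) (auto simp: scalar_prod_def mult.commute)

lemma unitary_groupD:
  assumes "U \<in> unitary_group N"
  shows "U \<in> carrier_mat N N" "dim_row U = N" "dim_col U = N" "mat_adjoint U * U = 1\<^sub>m N" "U * mat_adjoint U = 1\<^sub>m N"
proof -
  show *: "U \<in> carrier_mat N N" "dim_row U = N" "dim_col U = N" "mat_adjoint U * U = 1\<^sub>m N"
    using assms by (auto simp: unitary_group_def)
  show "U * mat_adjoint U = 1\<^sub>m N"
    by (rule mat_mult_left_right_inverse[OF _ *(1) *(4)]) (use *(1) in auto)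
qed

lemma unitary_group_mult:
  assumes U: "U \<in> unitary_group N" and V: "V \<in> unitary_group N"
  shows "U * V \<in> unitary_group N"
proof -
  note u = unitary_groupD[OF U] note v = unitary_groupD[OF V]
  have ca: "mat_adjoint U \<in> carrier_mat N N" "mat_adjoint V \<in> carrier_mat N N"
    using u v by auto
  have "mat_adjoint (U * V) * (U * V) = mat_adjoint V * (mat_adjoint U * (U * V))"
    using u v ca by (simp add: mat_adjoint_mult[OF u(1) v(1)] assoc_mult_mat[of _ N N _ N _ N])
  also have "mat_adjoint U * (U * V) = V"
    using u v by (rule_tac assoc_mult_mat[OF ca(1) u(1) v(1), symmetric, THEN trans]) simp
  finally show ?thesis using u v by (simp add: unitary_group_def)
qed

lemma unitary_group_adjoint:
  assumes U: "U \<in> unitary_group N"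
  shows "mat_adjoint U \<in> unitary_group N"
proof -
  note u = unitary_groupD[OF U]
  have "mat_adjoint (mat_adjoint U) = U"
    using u by (intro eq_matI) auto
  moreover have "mat_adjoint U \<in> carrier_mat N N" using u by auto
  ultimately show ?thesis using u(5) by (simp add: unitary_group_def)
qed

text \<open>A column of a unitary matrix has norm one. This bound makes every polynomial in the
  entries and their conjugates integrable.\<close>

lemma unitary_group_entry_le:
  assumes U: "U \<in> unitary_group N" and ij: "i < N" "j < N"
  shows "norm (U $$ (i, j)) \<le> 1"
proof -
  note u = unitary_groupD[OF U]
  have "(\<Sum>k<N. cnj (U $$ (k, j)) * U $$ (k, j)) = (mat_adjoint U * U) $$ (j, j)"
    using u(1-3) ij by (simp add: scalar_prod_def atLeast0LessThan)
  also have "\<dots> = 1" unfolding u(4) using ij by simp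
  also have "(\<Sum>k<N. cnj (U $$ (k, j)) * U $$ (k, j)) = of_real (\<Sum>k<N. (norm (U $$ (k, j)))\<^sup>2)"
    by (simp add: complex_norm_square[symmetric] of_real_power[symmetric] mult.commute del: of_real_power)
  finally have "(\<Sum>k<N. (norm (U $$ (k, j)))\<^sup>2) = 1" using of_real_eq_1_iff by blast
  moreover have "(norm (U $$ (i, j)))\<^sup>2 \<le> (\<Sum>k<N. (norm (U $$ (k, j)))\<^sup>2)"
    by (rule member_le_sum) (use ij in auto)
  ultimately show ?thesis by (simp add: power_le_one_iff abs_square_le_1)
qed

section \<open>Borel structure and invariance of the Haar measure\<close>

lemma space_unitary_borel [simp]: "space (unitary_borel N) = unitary_group N"
  by (simp add: unitary_borel_def)

lemma measurable_entry [measurable]: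
  assumes "i < N" "j < N"
  shows "(\<lambda>U. U $$ (i, j)) \<in> borel_measurable (unitary_borel N)"
proof -
  let ?g = "\<lambda>U::complex mat. \<lambda>(i, j)\<in>{..<N} \<times> {..<N}. U $$ (i, j)"
  have "?g \<in> measurable (unitary_borel N) (\<Pi>\<^sub>M p\<in>{..<N} \<times> {..<N}. borel)"
    unfolding unitary_borel_def
    by (rule measurable_vimage_algebra1) (auto simp: space_PiM)
  hence "(\<lambda>U. ?g U (i, j)) \<in> borel_measurable (unitary_borel N)"
    by (rule measurable_compose[OF _ measurable_component_singleton]) (use assms in auto)
  thus ?thesis using assms by simp
qed

lemma measurable_into_unitary_borel:
  assumes "\<And>x. x \<in> space M \<Longrightarrow> f x \<in> unitary_group N"
  assumes "\<And>i j. i < N \<Longrightarrow> j < N \<Longrightarrow> (\<lambda>x. f x $$ (i, j)) \<in> borel_measurable M"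
  shows "f \<in> measurable M (unitary_borel N)"
  unfolding unitary_borel_def
  by (rule measurable_vimage_algebra2) (use assms in \<open>auto intro!: measurable_restrict\<close>)

lemma measurable_mult_left:
  assumes V: "V \<in> unitary_group N"
  shows "(\<lambda>U. V * U) \<in> measurable (unitary_borel N) (unitary_borel N)"
proof (rule measurable_into_unitary_borel)
  fix i j assume ij: "i < N" "j < N"
  have "(\<lambda>U. \<Sum>k<N. V $$ (i, k) * U $$ (k, j)) \<in> borel_measurable (unitary_borel N)"
    using ij by measurable
  also have "?this \<longleftrightarrow> (\<lambda>U. (V * U) $$ (i, j)) \<in> borel_measurable (unitary_borel N)"
    using ij unitary_groupD[OF V]
    by (intro measurable_cong) (auto dest: unitary_groupD simp: scalar_prod_def atLeast0LessThan)
  finally show "(\<lambda>U. (V * U) $$ (i, j)) \<in> borel_measurable (unitary_borel N)" .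
qed (use V in \<open>auto intro: unitary_group_mult\<close>)

locale haar = prob_space M for M :: "complex mat measure" +
  fixes N :: nat
  assumes sets_M [measurable_cong]: "sets M = sets (unitary_borel N)"
    and left_invariant: "V \<in> unitary_group N \<Longrightarrow> A \<in> sets M \<Longrightarrow> emeasure M ((\<lambda>U. V * U) ` A) = emeasure M A"
begin

lemma space_M [simp]: "space M = unitary_group N"
  using sets_eq_imp_space_eq[OF sets_M] by simp

lemma measurable_M_cong: "borel_measurable M = borel_measurable (unitary_borel N)"
  by (rule measurable_cong_sets[OF sets_M refl])

lemma measurable_M_mult_left:
  assumes V: "V \<in> unitary_group N"
  shows "(\<lambda>U. V * U) \<in> measurable M M"
  using measurable_mult_left[OF V] unfolding measurable_cong_sets[OF sets_M sets_M] .

text \<open>\<open>left_invariant\<close> speaks of images, the push-forward of preimages. They are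
  reconciled by the fact that left multiplication by V is a bijection of the group, inverted by the
  adjoint of V.\<close>

lemma distr_mult_left:
  assumes V: "V \<in> unitary_group N"
  shows "distr M M (\<lambda>U. V * U) = M"
proof (rule measure_eqI)
  note m = measurable_M_mult_left[OF V]
  show "sets (distr M M ((*) V)) = sets M" by simp
  fix A assume "A \<in> sets (distr M M ((*) V))"
  hence A: "A \<in> sets M" by simp
  define B where "B = (\<lambda>U. V * U) -` A \<inter> space M"
  have B: "B \<in> sets M" unfolding B_def by (rule measurable_sets[OF m A])
  have "(\<lambda>U. V * U) ` B = A"
  proof
    show "A \<subseteq> (\<lambda>U. V * U) ` B"
    proof
      fix U assume UA: "U \<in> A"
      with A have U: "U \<in> unitary_group N" using sets.sets_into_space by fastforce
      note v = unitary_groupD[OF V] note u = unitary_groupD[OF U]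
      have "V * (mat_adjoint V * U) = V * mat_adjoint V * U"
        using v u by (intro assoc_mult_mat[of _ N N _ N _ N, symmetric]) (auto intro: carrier_matI)
      also have "\<dots> = U" using v u by simp
      finally have "V * (mat_adjoint V * U) = U" .
      moreover have "mat_adjoint V * U \<in> unitary_group N"
        by (intro unitary_group_mult unitary_group_adjoint U V)
      ultimately show "U \<in> (\<lambda>U. V * U) ` B" unfolding B_def using UA
        by (intro image_eqI[of _ _ "mat_adjoint V * U"]) auto
    qed
  qed (auto simp: B_def)
  with left_invariant[OF V B] have "emeasure M B = emeasure M A" by metis
  thus "emeasure (distr M M ((*) V)) A = emeasure M A"
    unfolding emeasure_distr[OF m A] B_def .
qed

lemma integral_mult_left:
  fixes F :: "complex mat \<Rightarrow> complex"
  assumes V: "V \<in> unitary_group N" and F: "F \<in> borel_measurable M"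
  shows "(LINT U|M. F (V * U)) = (LINT U|M. F U)"
proof -
  note m = measurable_M_mult_left[OF V]
  have "(LINT U|M. F U) = (LINT U|distr M M (\<lambda>U. V * U). F U)"
    by (simp add: distr_mult_left[OF V])
  also have "\<dots> = (LINT U|M. F (V * U))"
    by (rule integral_distr[OF m]) (use F in simp)
  finally show ?thesis ..
qed

end

text \<open>The test functions of the moment calculus. Measurability refers to
  \<open>unitary_borel\<close> and not to a measure, the bound only to the group. Closure under
  sums, products and conjugation settles integrability by syntax.\<close>

definition bounded_rv :: "nat \<Rightarrow> (complex mat \<Rightarrow> complex) \<Rightarrow> bool" where
  "bounded_rv N F \<longleftrightarrow> F \<in> borel_measurable (unitary_borel N) \<and> bounded (F ` unitary_group N)"

lemma bounded_rvI:
  "F \<in> borel_measurable (unitary_borel N) \<Longrightarrow> (\<And>U. U \<in> unitary_group N \<Longrightarrow> norm (F U) \<le> C) \<Longrightarrow> bounded_rv N F"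
  unfolding bounded_rv_def by (auto intro!: boundedI)

lemma bounded_rvE:
  assumes "bounded_rv N F"
  obtains C where "\<And>U. U \<in> unitary_group N \<Longrightarrow> norm (F U) \<le> C"
  using assms unfolding bounded_rv_def bounded_iff by blast

lemma bounded_rv_measurable: "bounded_rv N F \<Longrightarrow> F \<in> borel_measurable (unitary_borel N)"
  by (simp add: bounded_rv_def)

lemma bounded_rv_const [intro]: "bounded_rv N (\<lambda>_. c)"
  by (rule bounded_rvI[where C = "norm c"]) auto

lemma bounded_rv_entry [intro]: "i < N \<Longrightarrow> j < N \<Longrightarrow> bounded_rv N (\<lambda>U. U $$ (i, j))"
  by (rule bounded_rvI[where C = 1]) (auto intro: unitary_group_entry_le)

lemma bounded_rv_add [intro]:
  assumes "bounded_rv N F" "bounded_rv N G"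
  shows "bounded_rv N (\<lambda>U. F U + G U)"
proof -
  obtain a b where "\<And>U. U \<in> unitary_group N \<Longrightarrow> norm (F U) \<le> a" "\<And>U. U \<in> unitary_group N \<Longrightarrow> norm (G U) \<le> b"
    using assms by (elim bounded_rvE) blast
  thus ?thesis using assms[THEN bounded_rv_measurable]
    by (intro bounded_rvI[where C = "a + b"] norm_triangle_mono) auto
qed

lemma bounded_rv_mult [intro]:
  assumes "bounded_rv N F" "bounded_rv N G"
  shows "bounded_rv N (\<lambda>U. F U * G U)"
proof -
  obtain a b where ab: "\<And>U. U \<in> unitary_group N \<Longrightarrow> norm (F U) \<le> a" "\<And>U. U \<in> unitary_group N \<Longrightarrow> norm (G U) \<le> b"
    using assms by (elim bounded_rvE) blast
  show ?thesis
  proof (rule bounded_rvI)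
    fix U assume U: "U \<in> unitary_group N"
    show "norm (F U * G U) \<le> a * b"
      unfolding norm_mult using ab[OF U] order_trans[OF norm_ge_zero ab(1)[OF U]] by (intro mult_mono) auto
  qed (use assms[THEN bounded_rv_measurable] in measurable)
qed

lemma bounded_rv_cnj [intro]: "bounded_rv N F \<Longrightarrow> bounded_rv N (\<lambda>U. cnj (F U))"
  by (frule bounded_rv_measurable, erule bounded_rvE, rule bounded_rvI)
     (auto intro!: measurable_compose[of _ _ borel cnj] borel_measurable_continuous_onI continuous_intros)

lemma bounded_rv_uminus [intro]: "bounded_rv N F \<Longrightarrow> bounded_rv N (\<lambda>U. - F U)"
  by (frule bounded_rv_measurable, erule bounded_rvE, rule bounded_rvI) auto

lemma bounded_rv_sum [intro]: "(\<And>i. i \<in> A \<Longrightarrow> bounded_rv N (F i)) \<Longrightarrow> bounded_rv N (\<lambda>U. \<Sum>i\<in>A. F i U)"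
  by (induction A rule: infinite_finite_induct) auto

lemma (in haar) integrable_bounded_rv [intro]: "bounded_rv N F \<Longrightarrow> integrable M F"
  by (frule bounded_rv_measurable, erule bounded_rvE, rule integrable_const_bound, rule AE_I2)
     (auto simp: measurable_M_cong)

text \<open>For a unit vector v this is exp(\<i> t P) with P the orthogonal projection onto v,
  written out by entries. The velocities \<i> P of these one-parameter groups span the Lie algebra
  of the unitary group over the reals.\<close>

definition phase_refl :: "nat \<Rightarrow> (nat \<Rightarrow> complex) \<Rightarrow> real \<Rightarrow> complex mat" where
  "phase_refl N v t = mat N N (\<lambda>(i, j). of_bool (i = j) + (cis t - 1) * v i * cnj (v j))"

definition unit_family :: "nat \<Rightarrow> (nat \<Rightarrow> complex) \<Rightarrow> bool" where
  "unit_family N v \<longleftrightarrow> (\<Sum>i<N. v i * cnj (v i)) = 1"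

lemma phase_refl_carrier [simp]: "phase_refl N v t \<in> carrier_mat N N"
  "dim_row (phase_refl N v t) = N" "dim_col (phase_refl N v t) = N"
  by (auto simp: phase_refl_def)

text \<open>The projection onto a unit vector is idempotent, so on its range only the phases
  \<open>cis s\<close> and \<open>cis t\<close> multiply.\<close>

lemma phase_refl_mult:
  assumes "unit_family N v"
  shows "phase_refl N v s * phase_refl N v t = phase_refl N v (s + t)"
proof (rule eq_matI, goal_cases)
  case (1 i j)
  hence ij: "i < N" "j < N" by (auto simp: phase_refl_def)
  have "(phase_refl N v s * phase_refl N v t) $$ (i, j) = (\<Sum>k<N. of_bool (i = k) * of_bool (k = j)
     + of_bool (i = k) * ((cis t - 1) * v k * cnj (v j)) + of_bool (k = j) * ((cis s - 1) * v i * cnj (v k))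
     + (cis s - 1) * (cis t - 1) * v i * cnj (v j) * (v k * cnj (v k)))"
    using ij by (simp add: scalar_prod_def phase_refl_def atLeast0LessThan algebra_simps)
  also have "\<dots> = of_bool (i = j) + (cis t - 1) * v i * cnj (v j) + (cis s - 1) * v i * cnj (v j)
     + (cis s - 1) * (cis t - 1) * v i * cnj (v j)"
    using ij assms unfolding sum.distrib sum_distrib_left[symmetric] unit_family_def
    by (simp add: of_bool_def if_distrib[where f = "\<lambda>x. x * _"] if_distrib[where f = "\<lambda>x. _ * x"] cong: if_cong)
  also have "\<dots> = of_bool (i = j) + (cis (s + t) - 1) * v i * cnj (v j)"
    by (simp add: cis_mult[symmetric] algebra_simps)
  finally show ?case using ij by (simp add: phase_refl_def)
qed auto

lemma phase_refl_0: "phase_refl N v 0 = 1\<^sub>m N"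
  by (rule eq_matI) (auto simp: phase_refl_def)

lemma phase_refl_unitary:
  assumes "unit_family N v"
  shows "phase_refl N v t \<in> unitary_group N"
proof -
  have "mat_adjoint (phase_refl N v t) = phase_refl N v (- t)"
    by (rule eq_matI) (auto simp: phase_refl_def cis_cnj)
  thus ?thesis using phase_refl_mult[OF assms, of "- t" t]
    by (simp add: unitary_group_def phase_refl_0)
qed

lemma phase_refl_mult_entry:
  assumes "U \<in> carrier_mat N N" "i < N" "j < N"
  shows "(phase_refl N v t * U) $$ (i, j) = U $$ (i, j) + (cis t - 1) * (\<Sum>q<N. v i * cnj (v q) * U $$ (q, j))"
proof -
  have "(phase_refl N v t * U) $$ (i, j) = (\<Sum>q<N. of_bool (i = q) * U $$ (q, j) + (cis t - 1) * (v i * cnj (v q) * U $$ (q, j)))"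
    using assms by (simp add: scalar_prod_def phase_refl_def atLeast0LessThan algebra_simps)
  also have "\<dots> = U $$ (i, j) + (cis t - 1) * (\<Sum>q<N. v i * cnj (v q) * U $$ (q, j))"
    using assms unfolding sum.distrib sum_distrib_left[symmetric]
    by (simp add: of_bool_def if_distrib[where f = "\<lambda>x. x * _"] cong: if_cong)
  finally show ?thesis .
qed

text \<open>\<open>G p q\<close> is the derivative of \<open>F\<close> along the matrix unit \<open>E\<^sub>p\<^sub>q\<close> of the complexified Lie algebra. Only the
  skew-Hermitian directions \<open>\<i> v v\<^sup>*\<close> are tangent to one-parameter subgroups, hence the sum.\<close>
definition has_lie_deriv :: "nat \<Rightarrow> (complex mat \<Rightarrow> complex) \<Rightarrow> (nat \<Rightarrow> nat \<Rightarrow> complex mat \<Rightarrow> complex) \<Rightarrow> bool" where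
  "has_lie_deriv N F G \<longleftrightarrow> bounded_rv N F \<and> (\<forall>p<N. \<forall>q<N. bounded_rv N (G p q)) \<and>
     (\<forall>v. unit_family N v \<longrightarrow> (\<forall>U\<in>unitary_group N.
       ((\<lambda>t. F (phase_refl N v t * U)) has_vector_derivative
         \<i> * (\<Sum>p<N. \<Sum>q<N. v p * cnj (v q) * G p q U)) (at 0)))"

lemma has_lie_derivD:
  assumes "has_lie_deriv N F G"
  shows "bounded_rv N F" "p < N \<Longrightarrow> q < N \<Longrightarrow> bounded_rv N (G p q)"
    "unit_family N v \<Longrightarrow> U \<in> unitary_group N \<Longrightarrow> ((\<lambda>t. F (phase_refl N v t * U)) has_vector_derivative
         \<i> * (\<Sum>p<N. \<Sum>q<N. v p * cnj (v q) * G p q U)) (at 0)"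
  using assms unfolding has_lie_deriv_def by auto

text \<open>Agreement on the group is enough because the curves \<open>phase_refl N v t * U\<close>
  stay inside it.\<close>

lemma has_lie_deriv_cong:
  assumes "has_lie_deriv N F G"
    and "\<And>U. U \<in> unitary_group N \<Longrightarrow> F U = F' U"
    and "\<And>p q U. p < N \<Longrightarrow> q < N \<Longrightarrow> U \<in> unitary_group N \<Longrightarrow> G p q U = G' p q U"
  shows "has_lie_deriv N F' G'"
proof -
  have cong: "bounded_rv N f \<longleftrightarrow> bounded_rv N g" if "\<And>U. U \<in> unitary_group N \<Longrightarrow> f U = g U" for f g
  proof -
    have "f ` unitary_group N = g ` unitary_group N" using that by (rule image_cong[OF refl])
    moreover have "f \<in> borel_measurable (unitary_borel N) \<longleftrightarrow> g \<in> borel_measurable (unitary_borel N)"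
      using that by (intro measurable_cong) auto
    ultimately show ?thesis by (simp add: bounded_rv_def)
  qed
  have *: "bounded_rv N F' \<longleftrightarrow> bounded_rv N F" by (rule cong) (simp add: assms)
  have **: "bounded_rv N (G' p q) \<longleftrightarrow> bounded_rv N (G p q)" if "p < N" "q < N" for p q
    by (rule cong) (use that in \<open>simp add: assms\<close>)
  have 1: "F' (phase_refl N v t * U) = F (phase_refl N v t * U)"
    if "unit_family N v" "U \<in> unitary_group N" for v t U
    using that assms(2) unitary_group_mult[OF phase_refl_unitary] by metis
  show ?thesis
    using assms(1) unfolding has_lie_deriv_def * by (simp add: ** 1 assms(3))
qed

lemma has_vector_derivative_cis: "(cis has_vector_derivative \<i> * cis t) (at t)"
proof -
  have "((\<lambda>z. exp (\<i> * z)) has_field_derivative \<i> * cis t) (at (complex_of_real t))"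
    by (auto intro!: derivative_eq_intros simp: cis_conv_exp)
  thus ?thesis
    using has_vector_derivative_real_field[of "\<lambda>z. exp (\<i> * z)"] by (simp add: cis_conv_exp[abs_def])
qed

text \<open>Row p of the product of the matrix unit E_pq and U is row q of U, and all its other rows
  vanish. The factor \<i> is the derivative of \<open>cis t - 1\<close> at 0.\<close>

lemma has_lie_deriv_entry:
  assumes "i < N" "j < N"
  shows "has_lie_deriv N (\<lambda>U. U $$ (i, j)) (\<lambda>p q U. of_bool (i = p) * U $$ (q, j))"
  unfolding has_lie_deriv_def
proof (intro conjI allI impI ballI)
  fix v U assume v: "unit_family N v" and U: "U \<in> unitary_group N"
  have single: "(\<Sum>p<N. \<Sum>q<N. v p * cnj (v q) * (of_bool (i = p) * U $$ (q, j))) = (\<Sum>q<N. v i * cnj (v q) * U $$ (q, j))"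
    using assms by (subst sum.swap)
      (simp add: of_bool_def if_distrib[where f = "\<lambda>x. x * _"] if_distrib[where f = "\<lambda>x. _ * x"] cong: if_cong)
  have "((\<lambda>t. U $$ (i, j) + (cis t - 1) * (\<Sum>q<N. v i * cnj (v q) * U $$ (q, j))) has_vector_derivative
     (\<i> * (\<Sum>q<N. v i * cnj (v q) * U $$ (q, j)))) (at 0)"
    by (auto intro!: derivative_eq_intros has_vector_derivative_cis)
  hence "((\<lambda>t. U $$ (i, j) + (cis t - 1) * (\<Sum>q<N. v i * cnj (v q) * U $$ (q, j))) has_vector_derivative
     (\<i> * (\<Sum>p<N. \<Sum>q<N. v p * cnj (v q) * (of_bool (i = p) * U $$ (q, j))))) (at 0)"
    unfolding single .
  thus "((\<lambda>t. (phase_refl N v t * U) $$ (i, j)) has_vector_derivative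
     \<i> * (\<Sum>p<N. \<Sum>q<N. v p * cnj (v q) * (of_bool (i = p) * U $$ (q, j)))) (at 0)"
    unfolding phase_refl_mult_entry[OF unitary_groupD(1)[OF U] assms] .
qed (use assms in auto)

lemma has_lie_deriv_const: "has_lie_deriv N (\<lambda>_. c) (\<lambda>_ _ _. 0)"
  unfolding has_lie_deriv_def by auto

lemma has_lie_deriv_add:
  assumes "has_lie_deriv N F G" "has_lie_deriv N F' G'"
  shows "has_lie_deriv N (\<lambda>U. F U + F' U) (\<lambda>p q U. G p q U + G' p q U)"
  using assms unfolding has_lie_deriv_def
  by (auto intro!: derivative_eq_intros simp: algebra_simps sum.distrib)

lemma has_lie_deriv_mult:
  assumes "has_lie_deriv N F G" "has_lie_deriv N F' G'"
  shows "has_lie_deriv N (\<lambda>U. F U * F' U) (\<lambda>p q U. G p q U * F' U + F U * G' p q U)"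
  unfolding has_lie_deriv_def
proof (intro conjI allI impI ballI)
  fix v U assume v: "unit_family N v" and U: "U \<in> unitary_group N"
  note d = has_lie_derivD(3)[OF assms(1) v U] has_lie_derivD(3)[OF assms(2) v U]
  have [simp]: "phase_refl N v 0 * U = U" using unitary_groupD[OF U] by (simp add: phase_refl_0)
  show "((\<lambda>t. F (phase_refl N v t * U) * F' (phase_refl N v t * U)) has_vector_derivative
     \<i> * (\<Sum>p<N. \<Sum>q<N. v p * cnj (v q) * (G p q U * F' U + F U * G' p q U))) (at 0)"
    by (rule has_vector_derivative_eq_rhs[OF has_vector_derivative_mult[OF d]])
       (simp add: algebra_simps sum.distrib sum_distrib_left)
qed (use assms in \<open>auto intro!: bounded_rv_add bounded_rv_mult bounded_rv_cnj bounded_rv_uminus intro: has_lie_derivD\<close>)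

text \<open>Conjugation turns \<i> into -\<i> and exchanges v with its conjugate; renaming the
  indices gives the sign and the transposed direction.\<close>

lemma has_lie_deriv_cnj:
  assumes "has_lie_deriv N F G"
  shows "has_lie_deriv N (\<lambda>U. cnj (F U)) (\<lambda>p q U. - cnj (G q p U))"
  unfolding has_lie_deriv_def
proof (intro conjI allI impI ballI)
  fix v U assume v: "unit_family N v" and U: "U \<in> unitary_group N"
  have "(\<Sum>p<N. \<Sum>q<N. v q * cnj (v p) * cnj (G p q U)) = (\<Sum>p<N. \<Sum>q<N. v p * cnj (v q) * cnj (G q p U))"
    by (rule sum.swap)
  thus "((\<lambda>t. cnj (F (phase_refl N v t * U))) has_vector_derivative
      \<i> * (\<Sum>p<N. \<Sum>q<N. v p * cnj (v q) * - cnj (G q p U))) (at 0)"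
    by (intro has_vector_derivative_eq_rhs[OF has_vector_derivative_cnj[OF has_lie_derivD(3)[OF assms v U]]])
       (simp add: sum_negf mult.commute)
qed (use assms in \<open>auto intro!: bounded_rv_add bounded_rv_mult bounded_rv_cnj bounded_rv_uminus intro: has_lie_derivD\<close>)

lemma has_lie_deriv_sum:
  assumes "\<And>i. i \<in> A \<Longrightarrow> has_lie_deriv N (F i) (G i)"
  shows "has_lie_deriv N (\<lambda>U. \<Sum>i\<in>A. F i U) (\<lambda>p q U. \<Sum>i\<in>A. G i p q U)"
  using assms by (induction A rule: infinite_finite_induct)
    (auto intro: has_lie_deriv_add has_lie_deriv_const)

lemma has_lie_deriv_cmult:
  assumes "has_lie_deriv N F G"
  shows "has_lie_deriv N (\<lambda>U. c * F U) (\<lambda>p q U. c * G p q U)"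
  using has_lie_deriv_mult[OF has_lie_deriv_const[of N c] assms] by simp

text \<open>Polarization: the vectors \<open>e\<^sub>p\<close>, \<open>(e\<^sub>p + e\<^sub>q) / \<surd>2\<close> and \<open>(e\<^sub>p + \<i> e\<^sub>q) / \<surd>2\<close> suffice.\<close>
lemma hermitian_form_eq_0:
  assumes "\<And>v. unit_family N v \<Longrightarrow> (\<Sum>p<N. \<Sum>q<N. v p * cnj (v q) * g p q) = 0"
    and "p < N" "q < N"
  shows "g p q = (0::complex)"
proof -
  have diag: "g p p = 0" if "p < N" for p
  proof -
    have "unit_family N (\<lambda>i. of_bool (i = p))"
      using that by (simp add: unit_family_def of_bool_def if_distrib[where f = "\<lambda>x. x * _"] cong: if_cong)
    from assms(1)[OF this] show ?thesis using that
      by (simp add: of_bool_def if_distrib[where f = "\<lambda>x. x * _"] if_distrib[where f = "\<lambda>x. _ * x"]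
          if_distrib[where f = cnj] cong: if_cong)
  qed
  show ?thesis
  proof (cases "p = q")
    case False
    have *: "a * g p q * cnj c + cnj a * c * g q p = 0" if "a * cnj a = 1/2" "c * cnj c = 1/2" for a c
    proof -
      define v where "v i = (if i = p then a else if i = q then c else 0)" for i
      have v: "(\<Sum>i<N. h i * v i) = h p * a + h q * c" "(\<Sum>i<N. h i * cnj (v i)) = h p * cnj a + h q * cnj c" for h
      proof -
        have "(\<Sum>i<N. h i * v i) = (\<Sum>i\<in>{p, q}. h i * v i)"
          by (rule sum.mono_neutral_right) (use assms in \<open>auto simp: v_def\<close>)
        thus "(\<Sum>i<N. h i * v i) = h p * a + h q * c" using False by (simp add: v_def)
        have "(\<Sum>i<N. h i * cnj (v i)) = (\<Sum>i\<in>{p, q}. h i * cnj (v i))"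
          by (rule sum.mono_neutral_right) (use assms in \<open>auto simp: v_def\<close>)
        thus "(\<Sum>i<N. h i * cnj (v i)) = h p * cnj a + h q * cnj c" using False by (simp add: v_def)
      qed
      have "unit_family N v" unfolding unit_family_def v(2) using False by (simp add: v_def that)
      from assms(1)[OF this] have "0 = (\<Sum>p<N. (\<Sum>q<N. g p q * cnj (v q)) * v p)"
        by (simp add: sum_distrib_right sum_distrib_left algebra_simps)
      also have "\<dots> = (g p p * cnj a + g p q * cnj c) * a + (g q p * cnj a + g q q * cnj c) * c"
        by (simp add: v)
      finally show ?thesis using diag assms by (simp add: algebra_simps)
    qed
    let ?r = "complex_of_real (1 / sqrt 2)"
    have r: "?r * ?r = 1 / 2" by (simp add: of_real_mult[symmetric] del: of_real_mult)
    have 1: "?r * ?r * (g p q + g q p) = 0"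
      using *[of ?r ?r] r by (simp add: algebra_simps)
    have 2: "?r * ?r * (g p q - g q p) = 0"
      using *[of "\<i> * ?r" "?r"] r by (simp add: algebra_simps)
    show ?thesis using 1 2 unfolding r by simp
  qed (use diag assms in auto)
qed

text \<open>By invariance the expectation of \<open>F (phase_refl N v t * U)\<close> does not depend
  on t, so its derivative at t = 0 vanishes; polarization then separates the directions p and q. The
  work lies in exchanging derivative and integral.\<close>

lemma (in haar) expectation_lie_deriv_eq_0:
  assumes FG: "has_lie_deriv N F G" and pq: "p < N" "q < N"
  shows "(LINT U|M. G p q U) = 0"
proof (rule hermitian_form_eq_0[where g = "\<lambda>p q. LINT U|M. G p q U", OF _ pq])
  fix v assume v: "unit_family N v"
  define D where "D U = \<i> * (\<Sum>p<N. \<Sum>q<N. v p * cnj (v q) * G p q U)" for U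
  have D: "bounded_rv N D"
    unfolding D_def using has_lie_derivD(2)[OF FG]
    by (intro bounded_rv_mult bounded_rv_sum bounded_rv_const) auto
  then obtain C where C: "\<And>U. U \<in> unitary_group N \<Longrightarrow> norm (D U) \<le> C" using bounded_rvE by blast
  define \<phi> where "\<phi> t U = F (phase_refl N v t * U)" for t U
  have R: "phase_refl N v t * U \<in> unitary_group N" if "U \<in> unitary_group N" for t U
    by (intro unitary_group_mult phase_refl_unitary v that)
  \<comment> \<open>The derivative is given only at t = 0; the group law carries it to every
    t.\<close>
  have deriv: "((\<lambda>t. \<phi> t U) has_vector_derivative D (phase_refl N v t * U)) (at t)"
    if U: "U \<in> unitary_group N" for U t
  proof -
    have "((\<lambda>s. F (phase_refl N v s * (phase_refl N v t * U))) has_vector_derivative D (phase_refl N v t * U)) (at 0)"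
      unfolding D_def by (rule has_lie_derivD(3)[OF FG v R[OF U]])
    also have "(\<lambda>s. F (phase_refl N v s * (phase_refl N v t * U))) = (\<lambda>s. \<phi> (s + t) U)"
      using assoc_mult_mat[of "phase_refl N v _" N N "phase_refl N v t" N U N] unitary_groupD[OF U]
      by (simp add: \<phi>_def phase_refl_mult[OF v, symmetric])
    finally have *: "((\<lambda>s. \<phi> (s + t) U) has_vector_derivative D (phase_refl N v t * U)) (at (t - t))"
      by simp
    have "((\<lambda>s. s - t) has_vector_derivative 1) (at t)"
      by (auto intro!: derivative_eq_intros)
    from vector_diff_chain_at[OF this *] show ?thesis by (simp add: o_def)
  qed
  \<comment> \<open>A bound on the derivative along the whole curve dominates all difference
    quotients by the same constant C.\<close>
  have lip: "norm (\<phi> t U - \<phi> 0 U) \<le> C * \<bar>t\<bar>" if U: "U \<in> unitary_group N" for t U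
    using differentiable_bound[of UNIV "\<lambda>t. \<phi> t U" "\<lambda>t h. h *\<^sub>R D (phase_refl N v t * U)" C t 0]
      deriv[OF U] C[OF R[OF U]]
    by (auto simp: has_vector_derivative_def onorm_scaleR_left onorm_id)
  have int_\<phi>: "(LINT U|M. \<phi> t U) = (LINT U|M. F U)" "integrable M (\<phi> t)" for t
  proof -
    have Fm: "F \<in> borel_measurable M"
      using has_lie_derivD(1)[OF FG, THEN bounded_rv_measurable] by (simp add: measurable_M_cong)
    show "(LINT U|M. \<phi> t U) = (LINT U|M. F U)"
      unfolding \<phi>_def by (rule integral_mult_left[OF phase_refl_unitary[OF v] Fm])
    have "bounded_rv N (\<phi> t)"
    proof -
      obtain B where B: "\<And>U. U \<in> unitary_group N \<Longrightarrow> norm (F U) \<le> B"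
        using has_lie_derivD(1)[OF FG] bounded_rvE by blast
      show ?thesis
      proof (rule bounded_rvI)
        show "\<phi> t \<in> borel_measurable (unitary_borel N)"
          using measurable_compose[OF measurable_M_mult_left[OF phase_refl_unitary[OF v]] Fm]
          by (simp add: \<phi>_def[abs_def] measurable_M_cong)
      qed (auto simp: \<phi>_def intro: B R)
    qed
    thus "integrable M (\<phi> t)" by auto
  qed
  \<comment> \<open>Difference quotients with step 1/(n+1), as dominated convergence is applied to a
    sequence.\<close>
  define s where "s n U = of_nat (Suc n) * (\<phi> (1 / real (Suc n)) U - \<phi> 0 U)" for n U
  have lim: "(\<lambda>n. s n U) \<longlonglongrightarrow> D U" if U: "U \<in> unitary_group N" for U
  proof -
    have "((\<lambda>t. \<phi> t U) has_vector_derivative D U) (at 0)"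
      using deriv[OF U, of 0] unitary_groupD[OF U] by (simp add: phase_refl_0)
    hence "((\<lambda>h. norm ((\<phi> h U - \<phi> 0 U - h *\<^sub>R D U) /\<^sub>R \<bar>h\<bar>)) \<longlongrightarrow> 0) (at 0)"
      unfolding has_vector_derivative_def has_derivative_at_within by (intro tendsto_norm_zero) simp
    also have "?this \<longleftrightarrow> ((\<lambda>h. norm ((\<phi> h U - \<phi> 0 U) /\<^sub>R h - D U)) \<longlongrightarrow> 0) (at 0)"
    proof (rule filterlim_cong[OF refl refl])
      have "norm ((\<phi> h U - \<phi> 0 U - h *\<^sub>R D U) /\<^sub>R \<bar>h\<bar>) = norm ((\<phi> h U - \<phi> 0 U) /\<^sub>R h - D U)" if "h \<noteq> 0" for h
      proof -
        have "(\<phi> h U - \<phi> 0 U) /\<^sub>R h - D U = (\<phi> h U - \<phi> 0 U - h *\<^sub>R D U) /\<^sub>R h"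
          using that by (simp add: scaleR_right_diff_distrib)
        thus ?thesis by simp
      qed
      thus "\<forall>\<^sub>F h in at 0. norm ((\<phi> h U - \<phi> 0 U - h *\<^sub>R D U) /\<^sub>R \<bar>h\<bar>) = norm ((\<phi> h U - \<phi> 0 U) /\<^sub>R h - D U)"
        by (simp add: eventually_at_filter)
    qed
    finally have "((\<lambda>h. (\<phi> h U - \<phi> 0 U) /\<^sub>R h) \<longlongrightarrow> D U) (at 0)"
      using LIM_zero_iff tendsto_norm_zero_iff by blast
    moreover have "filterlim (\<lambda>n. 1 / real (Suc n)) (at 0) sequentially"
      unfolding filterlim_at using LIMSEQ_Suc[OF lim_1_over_n] by auto
    ultimately have "(\<lambda>n. (\<phi> (1 / real (Suc n)) U - \<phi> 0 U) /\<^sub>R (1 / real (Suc n))) \<longlonglongrightarrow> D U"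
      by (rule filterlim_compose)
    thus ?thesis by (simp add: s_def[abs_def] scaleR_conv_of_real)
  qed
  have "(\<lambda>n. LINT U|M. s n U) \<longlonglongrightarrow> (LINT U|M. D U)"
  proof (rule integral_dominated_convergence[where w = "\<lambda>_. C"])
    show "D \<in> borel_measurable M" "\<And>n. s n \<in> borel_measurable M"
      using D[THEN bounded_rv_measurable] int_\<phi>(2)[THEN borel_measurable_integrable]
      unfolding s_def[abs_def] by (auto simp: measurable_M_cong)
    show "AE U in M. norm (s n U) \<le> C" for n
    proof (rule AE_I2)
      fix U assume "U \<in> space M"
      hence "norm (\<phi> (1 / real (Suc n)) U - \<phi> 0 U) \<le> C * \<bar>1 / real (Suc n)\<bar>" by (intro lip) simp
      hence "real (Suc n) * norm (\<phi> (1 / real (Suc n)) U - \<phi> 0 U) \<le> real (Suc n) * (C * \<bar>1 / real (Suc n)\<bar>)"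
        by (intro mult_left_mono) auto
      thus "norm (s n U) \<le> C" unfolding s_def norm_mult norm_of_nat by simp
    qed
  qed (use lim in auto)
  moreover have "(LINT U|M. s n U) = 0" for n
    unfolding s_def using int_\<phi> by simp
  ultimately have "(LINT U|M. D U) = 0" by (simp add: LIMSEQ_const_iff)
  also have "(LINT U|M. D U) = \<i> * (\<Sum>p<N. \<Sum>q<N. v p * cnj (v q) * (LINT U|M. G p q U))"
    unfolding D_def using has_lie_derivD(2)[OF FG]
    by (subst integral_mult_right_zero, subst Bochner_Integration.integral_sum)
       (auto intro!: Bochner_Integration.integrable_sum integrable_mult_right sum.cong trans[OF Bochner_Integration.integral_sum])
  finally show "(\<Sum>p<N. \<Sum>q<N. v p * cnj (v q) * (LINT U|M. G p q U)) = 0" by simp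
qed

section \<open>Power traces\<close>

definition ptrace :: "nat \<Rightarrow> complex mat \<Rightarrow> complex" where
  "ptrace m U = (\<Sum>i<dim_row U. (U ^\<^sub>m m) $$ (i, i))"

lemma ptrace_0: "U \<in> unitary_group N \<Longrightarrow> ptrace 0 U = of_nat N"
  by (simp add: ptrace_def unitary_groupD)

lemma pow_mat_mult_index:
  assumes U: "U \<in> carrier_mat N N" and ij: "i < N" "j < N"
  shows "(\<Sum>k<N. (U ^\<^sub>m a) $$ (i, k) * (U ^\<^sub>m b) $$ (k, j)) = (U ^\<^sub>m (a + b)) $$ (i, j)"
  using ij
proof (induction b arbitrary: j)
  case 0
  thus ?case using U by (simp add: if_distrib[where f = "\<lambda>x. _ * x"] cong: if_cong)
next
  case (Suc b)
  have ab: "U ^\<^sub>m a \<in> carrier_mat N N" "U ^\<^sub>m b \<in> carrier_mat N N" "U ^\<^sub>m (a + b) \<in> carrier_mat N N"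
    using U by auto
  have "(\<Sum>k<N. (U ^\<^sub>m a) $$ (i, k) * (U ^\<^sub>m Suc b) $$ (k, j))
      = (\<Sum>k<N. \<Sum>l<N. (U ^\<^sub>m a) $$ (i, k) * ((U ^\<^sub>m b) $$ (k, l) * U $$ (l, j)))"
    using U ab Suc.prems by (simp add: scalar_prod_def atLeast0LessThan sum_distrib_left)
  also have "\<dots> = (\<Sum>l<N. (\<Sum>k<N. (U ^\<^sub>m a) $$ (i, k) * (U ^\<^sub>m b) $$ (k, l)) * U $$ (l, j))"
    by (subst sum.swap) (simp add: sum_distrib_right mult.assoc)
  also have "\<dots> = (\<Sum>l<N. (U ^\<^sub>m (a + b)) $$ (i, l) * U $$ (l, j))"
    using Suc by (intro sum.cong refl) auto
  also have "\<dots> = (U ^\<^sub>m (a + Suc b)) $$ (i, j)"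
    using U ab Suc.prems by (simp add: scalar_prod_def atLeast0LessThan)
  finally show ?case .
qed

lemma unitary_group_pow: "U \<in> unitary_group N \<Longrightarrow> U ^\<^sub>m m \<in> unitary_group N"
proof (induction m)
  case 0
  have "mat_adjoint (1\<^sub>m N) = (1\<^sub>m N :: complex mat)" by (rule eq_matI) auto
  thus ?case using unitary_groupD[OF 0] by (simp add: unitary_group_def)
qed (auto intro: unitary_group_mult)

text \<open>This is the trace of \<open>U ^\<^sub>m m\<close> times the adjoint of
  \<open>U ^\<^sub>m k\<close>; unitarity cancels m factors and leaves k - m adjoints.\<close>

lemma sum_pow_mult_cnj_pow:
  assumes U: "U \<in> unitary_group N" and "m \<le> k"
  shows "(\<Sum>p<N. \<Sum>q<N. (U ^\<^sub>m m) $$ (p, q) * cnj ((U ^\<^sub>m k) $$ (p, q))) = cnj (ptrace (k - m) U)"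
proof -
  define r where "r = k - m"
  have k: "k = r + m" using assms by (simp add: r_def)
  note u = unitary_groupD[OF U] and um = unitary_groupD[OF unitary_group_pow[OF U, of m]]
  have orth: "(\<Sum>q<N. (U ^\<^sub>m m) $$ (p, q) * cnj ((U ^\<^sub>m m) $$ (s, q))) = of_bool (p = s)" if "p < N" "s < N" for p s
  proof -
    have "(\<Sum>q<N. (U ^\<^sub>m m) $$ (p, q) * cnj ((U ^\<^sub>m m) $$ (s, q))) = (U ^\<^sub>m m * mat_adjoint (U ^\<^sub>m m)) $$ (p, s)"
      using um(1-3) that by (simp add: scalar_prod_def atLeast0LessThan)
    thus ?thesis unfolding um(5) using that by simp
  qed
  have "(\<Sum>p<N. \<Sum>q<N. (U ^\<^sub>m m) $$ (p, q) * cnj ((U ^\<^sub>m k) $$ (p, q)))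
      = (\<Sum>p<N. \<Sum>q<N. \<Sum>s<N. cnj ((U ^\<^sub>m r) $$ (p, s)) * ((U ^\<^sub>m m) $$ (p, q) * cnj ((U ^\<^sub>m m) $$ (s, q))))"
    unfolding k by (intro sum.cong refl)
      (simp add: pow_mat_mult_index[OF u(1), symmetric] sum_distrib_left mult_ac)
  also have "\<dots> = (\<Sum>p<N. \<Sum>s<N. cnj ((U ^\<^sub>m r) $$ (p, s)) * of_bool (p = s))"
  proof (rule sum.cong[OF refl])
    fix p assume "p \<in> {..<N}"
    thus "(\<Sum>q<N. \<Sum>s<N. cnj ((U ^\<^sub>m r) $$ (p, s)) * ((U ^\<^sub>m m) $$ (p, q) * cnj ((U ^\<^sub>m m) $$ (s, q))))
        = (\<Sum>s<N. cnj ((U ^\<^sub>m r) $$ (p, s)) * of_bool (p = s))"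
      by (subst sum.swap) (simp add: sum_distrib_left[symmetric] orth)
  qed
  also have "\<dots> = cnj (ptrace r U)"
    using u by (simp add: ptrace_def of_bool_def if_distrib[where f = "\<lambda>x. _ * x"] cong: if_cong)
  finally show ?thesis by (simp add: r_def)
qed

text \<open>Leibniz rule: each of the m factors U in turn is replaced by E_pq U. The second exponent
  is m - l and not m - l - 1 because that factor U survives to the right of E_pq.\<close>

lemma has_lie_deriv_pow_entry:
  assumes "i < N" "j < N"
  shows "has_lie_deriv N (\<lambda>U. (U ^\<^sub>m m) $$ (i, j))
           (\<lambda>p q U. \<Sum>l<m. (U ^\<^sub>m l) $$ (i, p) * (U ^\<^sub>m (m - l)) $$ (q, j))"
  using assms
proof (induction m arbitrary: j)
  case 0
  show ?case
    by (rule has_lie_deriv_cong[OF has_lie_deriv_const[of N "of_bool (i = j)"]])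
       (use 0 in \<open>auto dest: unitary_groupD\<close>)
next
  case (Suc m)
  have "has_lie_deriv N (\<lambda>U. \<Sum>k<N. (U ^\<^sub>m m) $$ (i, k) * U $$ (k, j))
      (\<lambda>p q U. \<Sum>k<N. (\<Sum>l<m. (U ^\<^sub>m l) $$ (i, p) * (U ^\<^sub>m (m - l)) $$ (q, k)) * U $$ (k, j)
        + (U ^\<^sub>m m) $$ (i, k) * (of_bool (k = p) * U $$ (q, j)))"
    using Suc by (intro has_lie_deriv_sum has_lie_deriv_mult has_lie_deriv_entry Suc.IH) auto
  thus ?case
  proof (rule has_lie_deriv_cong)
    fix U assume U: "U \<in> unitary_group N"
    note u = unitary_groupD[OF U]
    show "(\<Sum>k<N. (U ^\<^sub>m m) $$ (i, k) * U $$ (k, j)) = (U ^\<^sub>m Suc m) $$ (i, j)"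
      using u Suc.prems by (simp add: scalar_prod_def atLeast0LessThan)
    fix p q assume pq: "p < N" "q < N"
    have "(\<Sum>k<N. (\<Sum>l<m. (U ^\<^sub>m l) $$ (i, p) * (U ^\<^sub>m (m - l)) $$ (q, k)) * U $$ (k, j)
        + (U ^\<^sub>m m) $$ (i, k) * (of_bool (k = p) * U $$ (q, j)))
       = (\<Sum>k<N. \<Sum>l<m. (U ^\<^sub>m l) $$ (i, p) * ((U ^\<^sub>m (m - l)) $$ (q, k) * (U ^\<^sub>m 1) $$ (k, j)))
         + (U ^\<^sub>m m) $$ (i, p) * U $$ (q, j)"
      using pq u Suc.prems by (simp add: sum.distrib sum_distrib_right mult.assoc of_bool_def
          if_distrib[where f = "\<lambda>x. _ * x"] if_distrib[where f = "\<lambda>x. x * _"] cong: if_cong)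
    also have "(\<Sum>k<N. \<Sum>l<m. (U ^\<^sub>m l) $$ (i, p) * ((U ^\<^sub>m (m - l)) $$ (q, k) * (U ^\<^sub>m 1) $$ (k, j)))
       = (\<Sum>l<m. (U ^\<^sub>m l) $$ (i, p) * (U ^\<^sub>m (m - l + 1)) $$ (q, j))"
      by (subst sum.swap) (simp only: sum_distrib_left[symmetric] pow_mat_mult_index[OF u(1) pq(2) Suc.prems(2)])
    also have "(\<Sum>l<m. (U ^\<^sub>m l) $$ (i, p) * (U ^\<^sub>m (m - l + 1)) $$ (q, j)) + (U ^\<^sub>m m) $$ (i, p) * U $$ (q, j)
       = (\<Sum>l<Suc m. (U ^\<^sub>m l) $$ (i, p) * (U ^\<^sub>m (Suc m - l)) $$ (q, j))"
      using u by (simp add: Suc_diff_le del: pow_mat.simps(2)) simp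
    finally show "(\<Sum>k<N. (\<Sum>l<m. (U ^\<^sub>m l) $$ (i, p) * (U ^\<^sub>m (m - l)) $$ (q, k)) * U $$ (k, j)
        + (U ^\<^sub>m m) $$ (i, k) * (of_bool (k = p) * U $$ (q, j)))
       = (\<Sum>l<Suc m. (U ^\<^sub>m l) $$ (i, p) * (U ^\<^sub>m (Suc m - l)) $$ (q, j))" .
  qed
qed

text \<open>By cyclicity of the trace all m Leibniz terms are equal, and E_pq picks out the entry
  with transposed indices.\<close>

lemma has_lie_deriv_ptrace:
  "has_lie_deriv N (ptrace m) (\<lambda>p q U. of_nat m * (U ^\<^sub>m m) $$ (q, p))"
proof -
  have "has_lie_deriv N (\<lambda>U. \<Sum>i<N. (U ^\<^sub>m m) $$ (i, i))
     (\<lambda>p q U. \<Sum>i<N. \<Sum>l<m. (U ^\<^sub>m l) $$ (i, p) * (U ^\<^sub>m (m - l)) $$ (q, i))"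
    by (intro has_lie_deriv_sum has_lie_deriv_pow_entry) auto
  thus ?thesis
  proof (rule has_lie_deriv_cong)
    fix U assume U: "U \<in> unitary_group N"
    note u = unitary_groupD[OF U]
    show "(\<Sum>i<N. (U ^\<^sub>m m) $$ (i, i)) = ptrace m U" using u by (simp add: ptrace_def)
    fix p q assume pq: "p < N" "q < N"
    have "(\<Sum>i<N. \<Sum>l<m. (U ^\<^sub>m l) $$ (i, p) * (U ^\<^sub>m (m - l)) $$ (q, i))
        = (\<Sum>l<m. \<Sum>i<N. (U ^\<^sub>m (m - l)) $$ (q, i) * (U ^\<^sub>m l) $$ (i, p))"
      by (subst sum.swap) (simp add: mult.commute)
    also have "\<dots> = of_nat m * (U ^\<^sub>m m) $$ (q, p)"
      using pq by (simp add: pow_mat_mult_index[OF u(1)])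
    finally show "(\<Sum>i<N. \<Sum>l<m. (U ^\<^sub>m l) $$ (i, p) * (U ^\<^sub>m (m - l)) $$ (q, i)) = of_nat m * (U ^\<^sub>m m) $$ (q, p)" .
  qed
qed

definition hsym :: "nat \<Rightarrow> complex mat \<Rightarrow> complex" where
  "hsym n U = newton 1 (\<lambda>i. ptrace i U) n"

definition esym :: "nat \<Rightarrow> complex mat \<Rightarrow> complex" where
  "esym n U = newton (-1) (\<lambda>i. ptrace i U) n"

text \<open>The chain rule: x_n has the partial derivative c^(i-1) x_(n-i) / i with respect to p_i,
  and the factor i in the derivative of p_i cancels the denominator. The induction differentiates
  Newton's recursion itself.\<close>

lemma has_lie_deriv_newton:
  "has_lie_deriv N (\<lambda>U. newton c (\<lambda>i. ptrace i U) n)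
     (\<lambda>p q U. \<Sum>i=1..n. (U ^\<^sub>m i) $$ (q, p) * (c ^ (i - 1) * newton c (\<lambda>i. ptrace i U) (n - i)))"
proof (induction n rule: less_induct)
  case (less n)
  show ?case
  proof (cases "n = 0")
    case True
    show ?thesis unfolding True by (simp add: has_lie_deriv_const)
  next
    case False
    let ?x = "\<lambda>U. newton c (\<lambda>i. ptrace i U)"
    let ?F = "\<lambda>U. \<Sum>i=1..n. c ^ (i - 1) * (ptrace i U * ?x U (n - i))"
    let ?S = "\<lambda>p q U. \<Sum>i=1..n. c ^ (i - 1) * ((of_nat i * (U ^\<^sub>m i) $$ (q, p)) * ?x U (n - i)
       + ptrace i U * (\<Sum>j=1..n - i. (U ^\<^sub>m j) $$ (q, p) * (c ^ (j - 1) * ?x U (n - i - j))))"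
    let ?u = "\<lambda>U i p q. c ^ (i - 1) * (U ^\<^sub>m i) $$ (q, p)"
    have "has_lie_deriv N (\<lambda>U. (1 / of_nat n) * ?F U)
       (\<lambda>p q U. (1 / of_nat n) * ?S p q U)"
      by (intro has_lie_deriv_cmult has_lie_deriv_sum has_lie_deriv_mult has_lie_deriv_ptrace less) auto
    thus ?thesis
    proof (rule has_lie_deriv_cong)
      fix U assume U: "U \<in> unitary_group N"
      have "of_nat n * ?x U n = ?F U"
        by (simp add: newton_rec mult.assoc)
      thus "(1 / of_nat n) * ?F U = ?x U n"
        using False by (simp add: field_simps)
      fix p q assume "p < N" "q < N"
      \<comment> \<open>Exchanging the sums recovers the recursion at n - j. Its weight n - j
        completes the weight j from the directly differentiated trace to n.\<close>
      have "(\<Sum>i=1..n. c ^ (i - 1) * (ptrace i U * (\<Sum>j=1..n - i. (U ^\<^sub>m j) $$ (q, p) * (c ^ (j - 1) * ?x U (n - i - j)))))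
         = (\<Sum>i=1..n. \<Sum>j | j \<in> {1..n} \<and> j \<le> n - i. ?u U j p q * (c ^ (i - 1) * ptrace i U * ?x U (n - j - i)))"
        unfolding sum_distrib_left
        by (intro sum.cong) (auto simp: mult_ac add.commute)
      also have "\<dots> = (\<Sum>j=1..n. \<Sum>i | i \<in> {1..n} \<and> j \<le> n - i. ?u U j p q * (c ^ (i - 1) * ptrace i U * ?x U (n - j - i)))"
        by (rule sum.swap_restrict) auto
      also have "\<dots> = (\<Sum>j=1..n. \<Sum>i=1..n - j. ?u U j p q * (c ^ (i - 1) * ptrace i U * ?x U (n - j - i)))"
        by (intro sum.cong) auto
      also have "\<dots> = (\<Sum>j=1..n. ?u U j p q * (of_nat (n - j) * ?x U (n - j)))"
        unfolding newton_rec by (simp add: sum_distrib_left)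
      finally have "?S p q U
         = (\<Sum>j=1..n. ?u U j p q * (of_nat j * ?x U (n - j))) + (\<Sum>j=1..n. ?u U j p q * (of_nat (n - j) * ?x U (n - j)))"
        by (simp add: distrib_left sum.distrib mult_ac)
      also have "\<dots> = (\<Sum>j=1..n. of_nat n * (?u U j p q * ?x U (n - j)))"
        unfolding sum.distrib[symmetric]
        by (intro sum.cong refl) (auto simp: of_nat_diff algebra_simps)
      finally show "(1 / of_nat n) * ?S p q U
         = (\<Sum>i=1..n. (U ^\<^sub>m i) $$ (q, p) * (c ^ (i - 1) * ?x U (n - i)))"
        using False by (simp add: sum_distrib_left[symmetric] mult_ac)
    qed
  qed
qed

lemma bounded_rv_ptrace [intro]: "bounded_rv N (ptrace m)"
  using has_lie_derivD(1)[OF has_lie_deriv_ptrace] .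

lemma bounded_rv_hsym [intro]: "bounded_rv N (hsym n)"
  using has_lie_derivD(1)[OF has_lie_deriv_newton] by (simp add: hsym_def[abs_def])

lemma bounded_rv_esym [intro]: "bounded_rv N (esym n)"
  using has_lie_derivD(1)[OF has_lie_deriv_newton] by (simp add: esym_def[abs_def])

section \<open>Eigenvalues of unitary matrices\<close>

lemma pow_mat_upper_triangular:
  fixes B :: "complex mat"
  assumes B: "B \<in> carrier_mat N N" and ut: "upper_triangular B"
  shows "i < N \<Longrightarrow> j < N \<Longrightarrow> j \<le> i \<Longrightarrow> (B ^\<^sub>m m) $$ (i, j) = (if i = j then (B $$ (i, i)) ^ m else 0)"
proof (induction m arbitrary: i j)
  case (Suc m)
  have "(B ^\<^sub>m Suc m) $$ (i, j) = (\<Sum>k<N. (B ^\<^sub>m m) $$ (i, k) * B $$ (k, j))"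
    using B Suc.prems pow_carrier_mat[OF B, of m] by (simp add: scalar_prod_def atLeast0LessThan)
  also have "\<dots> = (\<Sum>k<N. if k = i then (B ^\<^sub>m m) $$ (i, i) * B $$ (i, j) else 0)"
  proof (intro sum.cong refl)
    fix k assume k: "k \<in> {..<N}"
    consider "k < i" | "k = i" | "k > i" by linarith
    thus "(B ^\<^sub>m m) $$ (i, k) * B $$ (k, j) = (if k = i then (B ^\<^sub>m m) $$ (i, i) * B $$ (i, j) else 0)"
    proof cases
      case 3
      hence "B $$ (k, j) = 0" using upper_triangularD[OF ut, of j k] Suc.prems k B by auto
      thus ?thesis using 3 by simp
    qed (use Suc k in auto)
  qed
  also have "\<dots> = (B ^\<^sub>m m) $$ (i, i) * B $$ (i, j)" using Suc.prems by simp
  also have "\<dots> = (if i = j then (B $$ (i, i)) ^ Suc m else 0)"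
    using Suc upper_triangularD[OF ut, of j i] B by auto
  finally show ?case .
qed (use B in auto)

lemma mult_mat_index:
  assumes "A \<in> carrier_mat n n" "B \<in> carrier_mat n n" "i < n" "j < n"
  shows "(A * B) $$ (i, j) = (\<Sum>k<n. A $$ (i, k) * B $$ (k, j))"
  using assms by (auto simp: scalar_prod_def atLeast0LessThan intro!: sum.cong)

text \<open>Schur triangularization: traces of powers are invariant under similarity, and the
  diagonal of a power of a triangular matrix consists of powers of the diagonal entries, here the
  roots.\<close>

lemma ptrace_eq_sum_proots:
  assumes A: "A \<in> carrier_mat N N"
  shows "ptrace m A = (\<Sum>z\<in>#proots (char_poly A). z ^ m)"
proof -
  obtain es where es: "char_poly A = (\<Prod>e\<leftarrow>es. [:- e, 1:])" "length es = N"
    using char_poly_factorized[OF A] by blast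
  obtain B P Q where "schur_decomposition A es = (B, P, Q)" by (metis prod_cases3)
  from schur_decomposition[OF A es(1) this]
  have sim: "similar_mat_wit A B P Q" and ut: "upper_triangular B" and diag: "diag_mat B = es" by auto
  note w = similar_mat_witD2[OF A sim]
  have Bm: "B ^\<^sub>m m \<in> carrier_mat N N" using w by auto
  have QP: "(\<Sum>i<N. Q $$ (l, i) * P $$ (i, k)) = of_bool (l = k)" if "l < N" "k < N" for l k
  proof -
    have "(\<Sum>i<N. Q $$ (l, i) * P $$ (i, k)) = (Q * P) $$ (l, k)"
      using w(6,7) that by (simp add: scalar_prod_def atLeast0LessThan)
    thus ?thesis unfolding w(2) using that by simp
  qed
  have "ptrace m A = (\<Sum>i<N. (P * B ^\<^sub>m m * Q) $$ (i, i))"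
    using A by (simp add: ptrace_def similar_mat_wit_pow_id[OF sim])
  also have "\<dots> = (\<Sum>i<N. \<Sum>l<N. \<Sum>k<N. (B ^\<^sub>m m) $$ (k, l) * (Q $$ (l, i) * P $$ (i, k)))"
  proof (rule sum.cong[OF refl])
    fix i assume i: "i \<in> {..<N}"
    have PB: "P * B ^\<^sub>m m \<in> carrier_mat N N" using w(6) Bm by auto
    have "(P * B ^\<^sub>m m * Q) $$ (i, i) = (\<Sum>l<N. (P * B ^\<^sub>m m) $$ (i, l) * Q $$ (l, i))"
      by (rule mult_mat_index[OF PB w(7)]) (use i in auto)
    also have "\<dots> = (\<Sum>l<N. (\<Sum>k<N. P $$ (i, k) * (B ^\<^sub>m m) $$ (k, l)) * Q $$ (l, i))"
      using i by (intro sum.cong refl) (simp add: mult_mat_index[OF w(6) Bm])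
    finally show "(P * B ^\<^sub>m m * Q) $$ (i, i) = (\<Sum>l<N. \<Sum>k<N. (B ^\<^sub>m m) $$ (k, l) * (Q $$ (l, i) * P $$ (i, k)))"
      by (simp add: sum_distrib_left sum_distrib_right mult_ac)
  qed
  also have "\<dots> = (\<Sum>l<N. \<Sum>i<N. \<Sum>k<N. (B ^\<^sub>m m) $$ (k, l) * (Q $$ (l, i) * P $$ (i, k)))"
    by (rule sum.swap)
  also have "\<dots> = (\<Sum>l<N. \<Sum>k<N. \<Sum>i<N. (B ^\<^sub>m m) $$ (k, l) * (Q $$ (l, i) * P $$ (i, k)))"
    by (rule sum.cong[OF refl], rule sum.swap)
  also have "\<dots> = (\<Sum>l<N. \<Sum>k<N. (B ^\<^sub>m m) $$ (k, l) * of_bool (l = k))"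
    by (simp add: sum_distrib_left[symmetric] QP)
  also have "\<dots> = (\<Sum>l<N. (B ^\<^sub>m m) $$ (l, l))"
    by (simp add: of_bool_def if_distrib[where f = "\<lambda>x. _ * x"] cong: if_cong)
  also have "\<dots> = (\<Sum>l<N. (es ! l) ^ m)"
    using w diag by (intro sum.cong refl) (auto simp: pow_mat_upper_triangular[OF w(5) ut] diag_mat_def)
  also have "\<dots> = (\<Sum>z\<leftarrow>es. z ^ m)"
    using es(2) by (simp add: sum_list_sum_nth atLeast0LessThan)
  also have "\<dots> = (\<Sum>z\<in>#mset es. z ^ m)"
    by (metis mset_map sum_mset_sum_list)
  also have "mset es = proots (char_poly A)"
  proof -
    have "proots (\<Prod>e\<leftarrow>xs. [:- e, 1:]) = mset xs" for xs :: "complex list"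
    proof (induction xs)
      case (Cons x xs)
      have "(\<Prod>e\<leftarrow>xs. [:- e, 1:]) \<noteq> (0 :: complex poly)" by (auto simp: prod_list_zero_iff)
      thus ?case by (simp add: proots_mult Cons.IH del: mult_pCons_left)
    qed simp
    thus ?thesis by (simp add: es(1))
  qed
  finally show ?thesis .
qed

lemma size_proots_char_poly:
  assumes "(A :: complex mat) \<in> carrier_mat N N"
  shows "size (proots (char_poly A)) = N"
  using degree_monic_char_poly[OF assms] by (simp add: size_proots_complex)

text \<open>Here it enters that there are only N eigenvalues; this cuts the moments off at b =
  N.\<close>

lemma esym_eq_0:
  assumes U: "U \<in> unitary_group N" and "n > N"
  shows "esym n U = 0"
  using elementary_eq_0[of "proots (char_poly U)" n] assms(2) size_proots_char_poly[OF unitary_groupD(1)[OF U]]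
  by (simp add: esym_def ptrace_eq_sum_proots[OF unitary_groupD(1)[OF U]])

text \<open>U preserves the norm of an eigenvector, while the eigenvalue scales it by its
  modulus.\<close>

lemma norm_proots_unitary:
  assumes U: "U \<in> unitary_group N" and z: "z \<in># proots (char_poly U)"
  shows "norm z = 1"
proof -
  note u = unitary_groupD[OF U]
  have "char_poly U \<noteq> 0" using degree_monic_char_poly[OF u(1)] by auto
  hence "eigenvalue U z" using z eigenvalue_root_char_poly[OF u(1)] by auto
  then obtain v where v: "v \<in> carrier_vec N" "v \<noteq> 0\<^sub>v N" "U *\<^sub>v v = z \<cdot>\<^sub>v v"
    unfolding eigenvalue_def eigenvector_def using u by auto
  define S where "S w = (\<Sum>i<N. (norm (w $ i))\<^sup>2)" for w :: "complex vec"
  have S: "complex_of_real (S w) = (\<Sum>i<N. w $ i * cnj (w $ i))" for w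
    by (simp add: S_def complex_norm_square[symmetric] of_real_power[symmetric] del: of_real_power)
  have orth: "(\<Sum>i<N. U $$ (i, j) * cnj (U $$ (i, k))) = of_bool (j = k)" if "j < N" "k < N" for j k
  proof -
    have "(\<Sum>i<N. U $$ (i, j) * cnj (U $$ (i, k))) = (mat_adjoint U * U) $$ (k, j)"
      using u(1-3) that by (simp add: scalar_prod_def atLeast0LessThan mult.commute)
    thus ?thesis unfolding u(4) using that by auto
  qed
  have "complex_of_real (S (U *\<^sub>v v)) = (\<Sum>i<N. (\<Sum>j<N. U $$ (i, j) * v $ j) * cnj (\<Sum>k<N. U $$ (i, k) * v $ k))"
    unfolding S using u(1-3) v(1) by (intro sum.cong refl) (simp add: scalar_prod_def atLeast0LessThan)
  also have "\<dots> = (\<Sum>i<N. \<Sum>j<N. \<Sum>k<N. v $ j * cnj (v $ k) * (U $$ (i, j) * cnj (U $$ (i, k))))"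
    by (simp add: sum_product mult_ac)
  also have "\<dots> = (\<Sum>j<N. \<Sum>i<N. \<Sum>k<N. v $ j * cnj (v $ k) * (U $$ (i, j) * cnj (U $$ (i, k))))"
    by (rule sum.swap)
  also have "\<dots> = (\<Sum>j<N. \<Sum>k<N. \<Sum>i<N. v $ j * cnj (v $ k) * (U $$ (i, j) * cnj (U $$ (i, k))))"
    by (rule sum.cong[OF refl], rule sum.swap)
  also have "\<dots> = complex_of_real (S v)"
    by (simp add: sum_distrib_left[symmetric] orth S of_bool_def if_distrib[where f = "\<lambda>x. _ * x"] cong: if_cong)
  finally have "S (U *\<^sub>v v) = S v" using of_real_eq_iff by blast
  moreover have "S (z \<cdot>\<^sub>v v) = (norm z)\<^sup>2 * S v"
    unfolding S_def sum_distrib_left using v(1) by (intro sum.cong refl) (auto simp: norm_mult power_mult_distrib)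
  moreover have "S v \<noteq> 0"
  proof
    assume "S v = 0"
    hence "\<forall>i<N. v $ i = 0" unfolding S_def by (subst (asm) sum_nonneg_eq_0_iff) auto
    hence "v = 0\<^sub>v N" using v(1) by (intro eq_vecI) auto
    with v(2) show False by simp
  qed
  ultimately have "(norm z)\<^sup>2 = 1" using v(3) by simp
  thus ?thesis by (simp add: power2_eq_1_iff) (use norm_ge_zero[of z] in linarith)
qed

section \<open>Second moments of power traces\<close>

lemmas bounded_rv_intros = bounded_rv_mult bounded_rv_sum bounded_rv_add bounded_rv_cnj bounded_rv_hsym
  bounded_rv_esym bounded_rv_ptrace bounded_rv_const

context haar
begin

text \<open>The Schwinger--Dyson equation: the divergence of the matrix field
  \<open>U \<mapsto> U\<^sup>m h\<^sub>a(U) e\<^sub>b(U) cnj (tr U\<^sup>k)\<close> has expectation zero.\<close>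

lemma schwinger_dyson:
  assumes mk: "m \<le> k"
  shows "(LINT U|M. (hsym a U * esym b U * (\<Sum>l<m. ptrace l U * ptrace (m - l) U)
            + (\<Sum>i=1..a. ptrace (m + i) U * hsym (a - i) U * esym b U)
            + (\<Sum>i=1..b. (-1) ^ (i - 1) * ptrace (m + i) U * hsym a U * esym (b - i) U)) * cnj (ptrace k U))
       = of_nat k * (LINT U|M. hsym a U * esym b U * cnj (ptrace (k - m) U))"
proof -
  let ?x = "\<lambda>U. cnj (ptrace k U)"
  define Dh where "Dh p q U = (\<Sum>i=1..a. (U ^\<^sub>m i) $$ (q, p) * hsym (a - i) U)" for p q :: nat and U :: "complex mat"
  define De where "De p q U = (\<Sum>i=1..b. (U ^\<^sub>m i) $$ (q, p) * ((-1) ^ (i - 1) * esym (b - i) U))" for p q :: nat and U :: "complex mat"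
  have Dh: "has_lie_deriv N (hsym a) Dh"
    using has_lie_deriv_newton[of N 1 a] unfolding hsym_def[abs_def] Dh_def[abs_def] by simp
  have De: "has_lie_deriv N (esym b) De"
    using has_lie_deriv_newton[of N "-1" b] unfolding esym_def[abs_def] De_def[abs_def] by simp
  \<comment> \<open>\<open>G i j\<close> differentiates the (i, j) entry of the matrix field by the
    Leibniz rule; the conjugated trace contributes the minus sign and the transposed entry in the
    last summand.\<close>
  define G where "G i j p q U = (\<Sum>l<m. (U ^\<^sub>m l) $$ (i, p) * (U ^\<^sub>m (m - l)) $$ (q, j)) * (hsym a U * (esym b U * ?x U))
      + (U ^\<^sub>m m) $$ (i, j) * (Dh p q U * (esym b U * ?x U) + hsym a U * (De p q U * ?x U
        + esym b U * - cnj (of_nat k * (U ^\<^sub>m k) $$ (p, q))))" for i j p q :: nat and U :: "complex mat"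
  have G: "has_lie_deriv N (\<lambda>U. (U ^\<^sub>m m) $$ (i, j) * (hsym a U * (esym b U * ?x U))) (G i j)"
    if "i < N" "j < N" for i j
    unfolding G_def[abs_def]
    by (intro has_lie_deriv_mult has_lie_deriv_pow_entry that Dh De has_lie_deriv_cnj has_lie_deriv_ptrace
        has_lie_deriv_cnj[of _ _ "\<lambda>q p U. of_nat k * (U ^\<^sub>m k) $$ (p, q)"])
  let ?X = "\<lambda>U. hsym a U * esym b U * (\<Sum>l<m. ptrace l U * ptrace (m - l) U)
            + (\<Sum>i=1..a. ptrace (m + i) U * hsym (a - i) U * esym b U)
            + (\<Sum>i=1..b. (-1) ^ (i - 1) * ptrace (m + i) U * hsym a U * esym (b - i) U)"
  \<comment> \<open>The divergence: the entry (p, q) of the field is differentiated along E_pq, and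
    each such term has expectation zero.\<close>
  have "0 = (\<Sum>p<N. \<Sum>q<N. LINT U|M. G p q p q U)"
    using expectation_lie_deriv_eq_0[OF G] by simp
  also have "\<dots> = (LINT U|M. (\<Sum>p<N. \<Sum>q<N. G p q p q U))"
  proof -
    have int: "integrable M (G p q p q)" if "p < N" "q < N" for p q
      using has_lie_derivD(2)[OF G] that by auto
    have "(LINT U|M. (\<Sum>p<N. \<Sum>q<N. G p q p q U)) = (\<Sum>p<N. LINT U|M. (\<Sum>q<N. G p q p q U))"
      by (rule Bochner_Integration.integral_sum) (auto intro!: int)
    also have "\<dots> = (\<Sum>p<N. \<Sum>q<N. LINT U|M. G p q p q U)"
      by (intro sum.cong[OF refl] Bochner_Integration.integral_sum int) auto
    finally show ?thesis ..
  qed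
  \<comment> \<open>The terms come from differentiating, in turn, \<open>U ^\<^sub>m m\<close>, h_a,
    e_b and the conjugated trace; the condition m <= k is used for the last one.\<close>
  also have "\<dots> = (LINT U|M. ?X U * ?x U - of_nat k * (hsym a U * esym b U * cnj (ptrace (k - m) U)))"
  proof (rule Bochner_Integration.integral_cong[OF refl])
    fix U assume "U \<in> space M"
    hence U: "U \<in> unitary_group N" by simp
    note u = unitary_groupD[OF U]
    have tr: "(\<Sum>p<N. (U ^\<^sub>m l) $$ (p, p)) = ptrace l U" for l using u by (simp add: ptrace_def)
    have tr2: "(\<Sum>p<N. \<Sum>q<N. (U ^\<^sub>m m) $$ (p, q) * (U ^\<^sub>m i) $$ (q, p)) = ptrace (m + i) U" for i
      by (simp add: pow_mat_mult_index[OF u(1)] tr)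
    have 1: "(\<Sum>p<N. \<Sum>q<N. \<Sum>l<m. (U ^\<^sub>m l) $$ (p, p) * (U ^\<^sub>m (m - l)) $$ (q, q)) = (\<Sum>l<m. ptrace l U * ptrace (m - l) U)"
    proof -
      have "(\<Sum>p<N. \<Sum>q<N. \<Sum>l<m. (U ^\<^sub>m l) $$ (p, p) * (U ^\<^sub>m (m - l)) $$ (q, q))
          = (\<Sum>p<N. \<Sum>l<m. \<Sum>q<N. (U ^\<^sub>m l) $$ (p, p) * (U ^\<^sub>m (m - l)) $$ (q, q))"
        by (rule sum.cong[OF refl], rule sum.swap)
      also have "\<dots> = (\<Sum>l<m. \<Sum>p<N. \<Sum>q<N. (U ^\<^sub>m l) $$ (p, p) * (U ^\<^sub>m (m - l)) $$ (q, q))"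
        by (rule sum.swap)
      finally show ?thesis by (simp add: sum_product[symmetric] tr)
    qed
    have D: "(\<Sum>p<N. \<Sum>q<N. (U ^\<^sub>m m) $$ (p, q) * (\<Sum>i=1..n. (U ^\<^sub>m i) $$ (q, p) * g i)) = (\<Sum>i=1..n. ptrace (m + i) U * g i)" for n g
    proof -
      have "(\<Sum>p<N. \<Sum>q<N. (U ^\<^sub>m m) $$ (p, q) * (\<Sum>i=1..n. (U ^\<^sub>m i) $$ (q, p) * g i))
          = (\<Sum>p<N. \<Sum>i=1..n. \<Sum>q<N. (U ^\<^sub>m m) $$ (p, q) * (U ^\<^sub>m i) $$ (q, p) * g i)"
        unfolding sum_distrib_left mult.assoc by (rule sum.cong[OF refl], rule sum.swap)
      also have "\<dots> = (\<Sum>i=1..n. \<Sum>p<N. \<Sum>q<N. (U ^\<^sub>m m) $$ (p, q) * (U ^\<^sub>m i) $$ (q, p) * g i)"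
        by (rule sum.swap)
      finally show ?thesis by (simp only: sum_distrib_right[symmetric] tr2)
    qed
    have C: "(\<Sum>p<N. \<Sum>q<N. (U ^\<^sub>m m) $$ (p, q) * cnj (of_nat k * (U ^\<^sub>m k) $$ (p, q))) = of_nat k * cnj (ptrace (k - m) U)"
      unfolding sum_pow_mult_cnj_pow[OF U mk, symmetric] by (simp add: sum_distrib_left mult_ac)
    have "(\<Sum>p<N. \<Sum>q<N. G p q p q U)
       = (\<Sum>p<N. \<Sum>q<N. \<Sum>l<m. (U ^\<^sub>m l) $$ (p, p) * (U ^\<^sub>m (m - l)) $$ (q, q)) * (hsym a U * esym b U * ?x U)
       + (\<Sum>p<N. \<Sum>q<N. (U ^\<^sub>m m) $$ (p, q) * Dh p q U) * (esym b U * ?x U)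
       + (\<Sum>p<N. \<Sum>q<N. (U ^\<^sub>m m) $$ (p, q) * De p q U) * (hsym a U * ?x U)
       - (\<Sum>p<N. \<Sum>q<N. (U ^\<^sub>m m) $$ (p, q) * cnj (of_nat k * (U ^\<^sub>m k) $$ (p, q))) * (hsym a U * esym b U)"
    proof -
      have "S * (h * (e * x)) + u * (D * (e * x) + h * (E * x + e * - c))
         = S * (h * e * x) + u * D * (e * x) + u * E * (h * x) - u * c * (h * e)" for S h e x u D E c :: complex
        by (simp add: algebra_simps)
      hence "G p q p q U = (\<Sum>l<m. (U ^\<^sub>m l) $$ (p, p) * (U ^\<^sub>m (m - l)) $$ (q, q)) * (hsym a U * esym b U * ?x U)
         + (U ^\<^sub>m m) $$ (p, q) * Dh p q U * (esym b U * ?x U) + (U ^\<^sub>m m) $$ (p, q) * De p q U * (hsym a U * ?x U)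
         - (U ^\<^sub>m m) $$ (p, q) * cnj (of_nat k * (U ^\<^sub>m k) $$ (p, q)) * (hsym a U * esym b U)" for p q
        unfolding G_def .
      thus ?thesis by (simp only: sum_distrib_right sum.distrib sum_subtractf)
    qed
    also have "\<dots> = ?X U * ?x U - of_nat k * (hsym a U * esym b U * cnj (ptrace (k - m) U))"
      unfolding 1 C Dh_def De_def D
      by (simp add: algebra_simps sum_distrib_left)
    finally show "(\<Sum>p<N. \<Sum>q<N. G p q p q U) = ?X U * ?x U - of_nat k * (hsym a U * esym b U * cnj (ptrace (k - m) U))" .
  qed
  also have "\<dots> = (LINT U|M. ?X U * ?x U) - (LINT U|M. of_nat k * (hsym a U * esym b U * cnj (ptrace (k - m) U)))"
    by (rule Bochner_Integration.integral_diff) (intro integrable_bounded_rv bounded_rv_intros)+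
  finally show ?thesis by simp
qed

text \<open>The index a + b of the trace is forced: with any other degree, invariance under scalar
  phases makes the expectation vanish.\<close>

definition mixed_moment :: "nat \<Rightarrow> nat \<Rightarrow> complex" where
  "mixed_moment a b = (LINT U|M. hsym a U * esym b U * cnj (ptrace (a + b) U))"

lemma mixed_moment_0_0: "mixed_moment 0 0 = of_nat N"
proof -
  have "mixed_moment 0 0 = (LINT U|M. of_nat N)"
    unfolding mixed_moment_def
    by (rule Bochner_Integration.integral_cong) (auto simp: hsym_def esym_def ptrace_0)
  thus ?thesis using prob_space by simp
qed

lemma mixed_moment_eq_0: "b > N \<Longrightarrow> mixed_moment a b = 0"
  unfolding mixed_moment_def
  by (rule trans[OF Bochner_Integration.integral_cong[where g = "\<lambda>_. 0"]]) (auto simp: esym_eq_0)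

text \<open>The equations \<open>schwinger_dyson\<close> with a = 0 and b - m for b are summed with
  signs (-1)^m. By \<open>newton_divergence\<close> their left-hand sides collapse to a multiple of
  e_b, and so the recursion closes.\<close>

lemma mixed_moment_esym_rec:
  assumes "b > 0"
  shows "(of_nat N - of_nat b + 1) * mixed_moment 0 b = (\<Sum>m=1..b. (-1) ^ (m - 1) * mixed_moment 0 (b - m))"
proof -
  let ?X = "\<lambda>m U. esym (b - m) U * (\<Sum>l<m. ptrace l U * ptrace (m - l) U)
            + (\<Sum>i=1..b - m. (-1) ^ (i - 1) * ptrace (m + i) U * esym (b - m - i) U)"
  have "of_nat b * (\<Sum>m\<le>b. (-1) ^ m * mixed_moment 0 (b - m))
      = (\<Sum>m\<le>b. (-1) ^ m * (LINT U|M. ?X m U * cnj (ptrace b U)))"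
  proof (subst sum_distrib_left, rule sum.cong[OF refl])
    fix m assume "m \<in> {..b}"
    hence "m \<le> b" by simp
    from schwinger_dyson[OF this, of 0 "b - m"]
    show "of_nat b * ((-1) ^ m * mixed_moment 0 (b - m)) = (-1) ^ m * (LINT U|M. ?X m U * cnj (ptrace b U))"
      by (simp add: mixed_moment_def hsym_def)
  qed
  also have "\<dots> = (LINT U|M. (\<Sum>m\<le>b. (-1) ^ m * (?X m U * cnj (ptrace b U))))"
    by (subst Bochner_Integration.integral_sum)
       (intro integrable_bounded_rv bounded_rv_intros | simp)+
  also have "\<dots> = (LINT U|M. (of_nat b ^ 2 - of_nat N * of_nat b) * (esym b U * cnj (ptrace b U)))"
  proof (rule Bochner_Integration.integral_cong[OF refl])
    fix U assume U: "U \<in> space M"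
    have "(\<Sum>m\<le>b. (-1) ^ m * (?X m U * cnj (ptrace b U))) = (\<Sum>m\<le>b. (-1) ^ m * ?X m U) * cnj (ptrace b U)"
      by (simp add: sum_distrib_right mult.assoc)
    also have "(\<Sum>m\<le>b. (-1) ^ m * ?X m U) = (of_nat b ^ 2 - of_nat N * of_nat b) * esym b U"
      using newton_divergence[of "-1" "\<lambda>i. ptrace i U" b] U by (simp add: esym_def ptrace_0)
    finally show "(\<Sum>m\<le>b. (-1) ^ m * (?X m U * cnj (ptrace b U))) = (of_nat b ^ 2 - of_nat N * of_nat b) * (esym b U * cnj (ptrace b U))"
      by (simp add: mult.assoc)
  qed
  also have "\<dots> = (of_nat b ^ 2 - of_nat N * of_nat b) * mixed_moment 0 b"
    by (simp add: mixed_moment_def hsym_def)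
  finally have "of_nat b * (\<Sum>m\<le>b. (-1) ^ m * mixed_moment 0 (b - m)) = (of_nat b ^ 2 - of_nat N * of_nat b) * mixed_moment 0 b" .
  hence "of_nat b * ((of_nat b - of_nat N) * mixed_moment 0 b) = of_nat b * (\<Sum>m\<le>b. (-1) ^ m * mixed_moment 0 (b - m))"
    by (simp add: power2_eq_square algebra_simps)
  hence "(of_nat b - of_nat N) * mixed_moment 0 b = (\<Sum>m\<le>b. (-1) ^ m * mixed_moment 0 (b - m))"
    using assms by simp
  \<comment> \<open>The term m = 0 is the unknown itself; moving it across shifts the factor b - N
    by one.\<close>
  also have "\<dots> = mixed_moment 0 b + (\<Sum>m=1..b. (-1) ^ m * mixed_moment 0 (b - m))"
    by (simp add: atLeast0AtMost[symmetric] sum.atLeast_Suc_atMost)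
  also have "(\<Sum>m=1..b. (-1) ^ m * mixed_moment 0 (b - m)) = - (\<Sum>m=1..b. (-1) ^ (m - 1) * mixed_moment 0 (b - m))"
    unfolding sum_negf[symmetric] by (intro sum.cong refl) (auto simp: power_eq_if)
  finally show ?thesis by (simp add: algebra_simps)
qed

text \<open>In the recursion each m < b gives -(-1)^(b-1), while m = b gives N (-1)^(b-1), because
  \<open>mixed_moment 0 0\<close> is N and not 1. At b = N + 1 the coefficient N - b + 1 vanishes,
  so beyond N the recursion is replaced by \<open>mixed_moment_eq_0\<close>.\<close>

lemma mixed_moment_esym:
  assumes "1 \<le> b" "b \<le> N"
  shows "mixed_moment 0 b = (-1) ^ (b - 1)"
  using assms
proof (induction b rule: less_induct)
  case (less b)
  obtain c where c: "b = Suc c" using less.prems by (cases b) auto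
  have "(of_nat N - of_nat b + 1) * mixed_moment 0 b = (\<Sum>m=1..b. (-1) ^ (m - 1) * mixed_moment 0 (b - m))"
    using less.prems by (intro mixed_moment_esym_rec) auto
  also have "\<dots> = (\<Sum>m=1..c. (-1) ^ (m - 1) * mixed_moment 0 (b - m)) + (-1) ^ c * of_nat N"
    using c by (simp add: mixed_moment_0_0)
  also have "(\<Sum>m=1..c. (-1) ^ (m - 1) * mixed_moment 0 (b - m)) = (\<Sum>m=1..c. - ((-1) ^ c))"
  proof (rule sum.cong[OF refl])
    fix m assume m: "m \<in> {1..c}"
    then obtain i where i: "m = Suc i" by (cases m) auto
    then obtain j where j: "c = Suc i + j" using m le_Suc_ex[of m c] by auto
    have "mixed_moment 0 (b - m) = (-1) ^ (b - m - 1)" using m c less by auto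
    thus "(-1) ^ (m - 1) * mixed_moment 0 (b - m) = - ((-1) ^ c)"
      by (simp add: c i j power_add)
  qed
  also have "\<dots> + (-1) ^ c * of_nat N = (of_nat N - of_nat b + 1) * (-1) ^ (b - 1)"
    by (simp add: c algebra_simps)
  finally have eq: "(of_nat N - of_nat b + 1) * mixed_moment 0 b = (of_nat N - of_nat b + 1) * (-1) ^ (b - 1)" .
  have "of_nat N - of_nat b + 1 = (of_nat (N - b + 1) :: complex)" using less.prems by (simp add: of_nat_diff)
  hence "of_nat N - of_nat b + 1 \<noteq> (0::complex)" by (metis Suc_eq_plus1 of_nat_neq_0)
  with eq show ?case by simp
qed

text \<open>Sum of the equations for h_(a-m) e_b over m <= a. Differentiating h closes up by
  \<open>newton_divergence\<close>, differentiating e_b by \<open>newton_cross\<close>.\<close>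

lemma mixed_moment_rec:
  assumes "a > 0"
  shows "of_nat a * (of_nat a + of_nat N) * mixed_moment a b
       = of_nat (a + b) * (\<Sum>i=1..a. mixed_moment (a - i) b - (-1) ^ i * mixed_moment (a - i) (b + i))"
proof -
  let ?k = "a + b"
  let ?X = "\<lambda>m U. hsym (a - m) U * esym b U * (\<Sum>l<m. ptrace l U * ptrace (m - l) U)
            + (\<Sum>i=1..a - m. ptrace (m + i) U * hsym (a - m - i) U * esym b U)
            + (\<Sum>i=1..b. (-1) ^ (i - 1) * ptrace (m + i) U * hsym (a - m) U * esym (b - i) U)"
  have "of_nat ?k * (\<Sum>m\<le>a. mixed_moment (a - m) b) = (\<Sum>m\<le>a. (LINT U|M. ?X m U * cnj (ptrace ?k U)))"
  proof (subst sum_distrib_left, rule sum.cong[OF refl])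
    fix m assume "m \<in> {..a}"
    hence m: "m \<le> ?k" and *: "a - m + b = ?k - m" by auto
    from schwinger_dyson[OF m, of "a - m" b]
    show "of_nat ?k * mixed_moment (a - m) b = (LINT U|M. ?X m U * cnj (ptrace ?k U))"
      unfolding mixed_moment_def * by (rule sym)
  qed
  also have "\<dots> = (LINT U|M. (\<Sum>m\<le>a. ?X m U * cnj (ptrace ?k U)))"
    by (subst Bochner_Integration.integral_sum)
       (intro integrable_bounded_rv bounded_rv_intros | simp)+
  also have "\<dots> = (LINT U|M. of_nat a * (of_nat a + of_nat N) * (hsym a U * esym b U * cnj (ptrace ?k U))
      + of_nat ?k * (\<Sum>i\<le>a. (-1) ^ i * (hsym (a - i) U * esym (b + i) U * cnj (ptrace ?k U))))"
  proof (rule Bochner_Integration.integral_cong[OF refl])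
    fix U assume U: "U \<in> space M"
    have "(\<Sum>m\<le>a. ?X m U) = esym b U * (\<Sum>m\<le>a. hsym (a - m) U * (\<Sum>l<m. ptrace l U * ptrace (m - l) U)
             + (\<Sum>i=1..a - m. ptrace (m + i) U * hsym (a - m - i) U))
         + (\<Sum>m\<le>a. \<Sum>i=1..b. (-1) ^ (i - 1) * ptrace (m + i) U * hsym (a - m) U * esym (b - i) U)"
      by (simp add: sum.distrib sum_distrib_left distrib_left mult_ac)
    also have "(\<Sum>m\<le>a. hsym (a - m) U * (\<Sum>l<m. ptrace l U * ptrace (m - l) U)
             + (\<Sum>i=1..a - m. ptrace (m + i) U * hsym (a - m - i) U)) = of_nat a * (of_nat a + of_nat N) * hsym a U"
      using newton_divergence[of 1 "\<lambda>i. ptrace i U" a] U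
      by (simp add: hsym_def ptrace_0 power2_eq_square algebra_simps)
    also have "(\<Sum>m\<le>a. \<Sum>i=1..b. (-1) ^ (i - 1) * ptrace (m + i) U * hsym (a - m) U * esym (b - i) U)
        = of_nat ?k * (\<Sum>i\<le>a. (-1) ^ i * hsym (a - i) U * esym (b + i) U)"
      unfolding hsym_def esym_def by (rule newton_cross)
    finally show "(\<Sum>m\<le>a. ?X m U * cnj (ptrace ?k U)) = of_nat a * (of_nat a + of_nat N) * (hsym a U * esym b U * cnj (ptrace ?k U))
      + of_nat ?k * (\<Sum>i\<le>a. (-1) ^ i * (hsym (a - i) U * esym (b + i) U * cnj (ptrace ?k U)))"
      unfolding sum_distrib_right[symmetric] by (simp add: algebra_simps sum_distrib_left)
  qed
  also have "\<dots> = of_nat a * (of_nat a + of_nat N) * mixed_moment a b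
      + of_nat ?k * (\<Sum>i\<le>a. (-1) ^ i * (LINT U|M. hsym (a - i) U * esym (b + i) U * cnj (ptrace ?k U)))"
    unfolding mixed_moment_def
    by (subst Bochner_Integration.integral_add, (intro integrable_bounded_rv bounded_rv_intros)+)
       (subst Bochner_Integration.integral_mult_right_zero, subst Bochner_Integration.integral_sum,
        (intro integrable_bounded_rv bounded_rv_intros)+, simp)
  also have "(\<Sum>i\<le>a. (-1) ^ i * (LINT U|M. hsym (a - i) U * esym (b + i) U * cnj (ptrace ?k U)))
      = (\<Sum>i\<le>a. (-1) ^ i * mixed_moment (a - i) (b + i))"
    by (intro sum.cong refl) (auto simp: mixed_moment_def add.commute)
  finally have "of_nat a * (of_nat a + of_nat N) * mixed_moment a b
     = of_nat ?k * ((\<Sum>m\<le>a. mixed_moment (a - m) b) - (\<Sum>i\<le>a. (-1) ^ i * mixed_moment (a - i) (b + i)))"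
    by (simp add: algebra_simps)
  \<comment> \<open>The two terms of index 0 cancel, so only moments with a smaller first index
    remain.\<close>
  also have "(\<Sum>m\<le>a. mixed_moment (a - m) b) - (\<Sum>i\<le>a. (-1) ^ i * mixed_moment (a - i) (b + i))
     = (\<Sum>i=1..a. mixed_moment (a - i) b - (-1) ^ i * mixed_moment (a - i) (b + i))"
    by (simp add: atLeast0AtMost[symmetric] sum.atLeast_Suc_atMost sum_subtractf)
  finally show ?thesis .
qed

text \<open>In the picture of hooks the two contributions cancel, except for b = 0, where there is a
  single hook, and b = N, where the second hook has N + 1 rows and vanishes.\<close>

lemma mixed_moment_pos:
  assumes "a > 0" "N > 0"
  shows "mixed_moment a b = (if b = 0 then 1 else if b = N then (-1) ^ (N - 1) else 0)"
  using assms(1)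
proof (induction a arbitrary: b rule: less_induct)
  case (less a)
  have nz: "of_nat a * (of_nat a + of_nat N) \<noteq> (0::complex)"
    using less.prems by (metis mult_eq_0_iff of_nat_0_eq_iff of_nat_add add_eq_0_iff_both_eq_0 less_numeral_extra(3))
  define w where "w b = (if b = 0 then 1 else if b = N then (-1) ^ (N - 1) else (0::complex))" for b
  have IH: "mixed_moment (a - i) c = (if i = a then mixed_moment 0 c else w c)" if "1 \<le> i" "i \<le> a" for i c
    using less.IH[of "a - i" c] that unfolding w_def by auto
  have "of_nat a * (of_nat a + of_nat N) * mixed_moment a b
      = of_nat (a + b) * (\<Sum>i=1..a. mixed_moment (a - i) b - (-1) ^ i * mixed_moment (a - i) (b + i))"
    by (rule mixed_moment_rec) (use less.prems in auto)
  also have "(\<Sum>i=1..a. mixed_moment (a - i) b - (-1) ^ i * mixed_moment (a - i) (b + i))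
      = (\<Sum>i=1..a. (if i = a then mixed_moment 0 b - (-1) ^ a * mixed_moment 0 (a + b) else w b - (-1) ^ i * w (b + i)))"
    by (intro sum.cong refl) (auto simp: IH add.commute)
  also have "\<dots> = (\<Sum>i\<in>{1..<a}. w b - (-1) ^ i * w (b + i)) + (mixed_moment 0 b - (-1) ^ a * mixed_moment 0 (a + b))"
  proof -
    have "{1..a} = insert a {1..<a}" using less.prems by auto
    thus ?thesis by simp
  qed
  also have "(\<Sum>i\<in>{1..<a}. w b - (-1) ^ i * w (b + i))
      = of_nat (a - 1) * w b - (if b < N \<and> N - b < a then (-1) ^ (N - b) * (-1) ^ (N - 1) else 0)"
  proof -
    \<comment> \<open>As i > 0, the value \<open>w (b + i)\<close> is non-zero only at i = N -
      b.\<close>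
    have "(\<Sum>i\<in>{1..<a}. (-1) ^ i * w (b + i)) = (\<Sum>i\<in>{1..<a}. if i = N - b \<and> b < N then (-1) ^ (N - b) * (-1) ^ (N - 1) else 0)"
      by (intro sum.cong refl) (auto simp: w_def)
    also have "\<dots> = (if b < N \<and> N - b < a then (-1) ^ (N - b) * (-1) ^ (N - 1) else 0)"
      by (cases "b < N") (auto simp: sum.delta)
    finally show ?thesis by (simp add: sum_subtractf)
  qed
  finally have eq: "of_nat a * (of_nat a + of_nat N) * mixed_moment a b = of_nat (a + b) *
     (of_nat (a - 1) * w b - (if b < N \<and> N - b < a then (-1) ^ (N - b) * (-1) ^ (N - 1) else 0)
       + (mixed_moment 0 b - (-1) ^ a * mixed_moment 0 (a + b)))" .
  have sgn: "(-1) ^ (N - b) * (-1) ^ (N - 1) = (if b = 0 then -1 else (-1::complex) ^ (b - 1))" if "b \<le> N"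
    using that assms(2) by (auto simp: uminus_power_if)
  have sgn2: "(-1) ^ a * (-1) ^ (a + b - 1) = (if b = 0 then -1 else (-1::complex) ^ (b - 1))"
    using less.prems by (auto simp: uminus_power_if)
  have "of_nat a * (of_nat a + of_nat N) * mixed_moment a b = of_nat a * (of_nat a + of_nat N) * w b"
  \<comment> \<open>For a + b > N the moment \<open>mixed_moment 0 (a + b)\<close> vanishes; if b <
    N, the term i = N - b then takes over its role.\<close>
  proof (cases "a + b \<le> N")
    case True
    hence m: "mixed_moment 0 (a + b) = (-1) ^ (a + b - 1)" using less.prems by (intro mixed_moment_esym) auto
    have "b < N" "\<not> N - b < a" using True less.prems by auto
    thus ?thesis
      unfolding eq m sgn2 using less.prems mixed_moment_esym[of b]
      by (cases "b = 0") (auto simp: w_def mixed_moment_0_0 of_nat_diff algebra_simps)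
  next
    case False
    hence m: "mixed_moment 0 (a + b) = 0" by (intro mixed_moment_eq_0) auto
    consider "b = 0" | "b > 0" "b < N" | "b = N" | "b > N" using assms(2) by linarith
    thus ?thesis
    proof cases
      case 1
      thus ?thesis unfolding eq m using False sgn less.prems assms(2)
        by (auto simp: w_def mixed_moment_0_0 of_nat_diff algebra_simps)
    next
      case 2
      hence "N - b < a" using False by auto
      thus ?thesis unfolding eq m using 2 sgn mixed_moment_esym[of b] by (auto simp: w_def)
    next
      case 3
      thus ?thesis unfolding eq m using mixed_moment_esym[of b] assms(2) less.prems
        by (auto simp: w_def of_nat_diff algebra_simps)
    next
      case 4
      thus ?thesis unfolding eq m using mixed_moment_eq_0[of b] assms(2) by (auto simp: w_def)
    qed
  qed
  hence "mixed_moment a b = w b" using nz by simp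
  thus ?case by (simp add: w_def)
qed

text \<open>In the expansion of \<open>tr U\<^sup>k\<close> by Newton's identities only the term with index \<open>min k N\<close> has a
  non-zero moment.\<close>
theorem expectation_ptrace_mult_cnj:
  assumes "k > 0" "N > 0"
  shows "(LINT U|M. ptrace k U * cnj (ptrace k U)) = of_nat (min k N)"
proof -
  have "(LINT U|M. ptrace k U * cnj (ptrace k U))
      = (LINT U|M. (\<Sum>j=1..k. (-1) ^ (j - 1) * of_nat j * (hsym (k - j) U * esym j U * cnj (ptrace k U))))"
  proof (rule Bochner_Integration.integral_cong[OF refl])
    fix U
    have "ptrace k U = (\<Sum>j=1..k. (-1) ^ (j - 1) * of_nat j * esym j U * hsym (k - j) U)"
      unfolding hsym_def esym_def by (rule newton_power_sum[OF assms(1)])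
    hence "ptrace k U * cnj (ptrace k U)
        = (\<Sum>j=1..k. (-1) ^ (j - 1) * of_nat j * esym j U * hsym (k - j) U) * cnj (ptrace k U)" by simp
    also have "\<dots> = (\<Sum>j=1..k. (-1) ^ (j - 1) * of_nat j * (hsym (k - j) U * esym j U * cnj (ptrace k U)))"
      unfolding sum_distrib_right by (simp add: mult_ac)
    finally show "ptrace k U * cnj (ptrace k U)
        = (\<Sum>j=1..k. (-1) ^ (j - 1) * of_nat j * (hsym (k - j) U * esym j U * cnj (ptrace k U)))" .
  qed
  also have "\<dots> = (\<Sum>j=1..k. (-1) ^ (j - 1) * of_nat j * mixed_moment (k - j) j)"
    by (subst Bochner_Integration.integral_sum)
       (intro integrable_bounded_rv bounded_rv_intros sum.cong refl | simp add: mixed_moment_def)+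
  also have "\<dots> = (\<Sum>j=1..k. if j = min k N then of_nat j else 0)"
  proof (intro sum.cong refl)
    fix j assume j: "j \<in> {1..k}"
    have sq: "(-1::complex) ^ n * of_nat i * (-1) ^ n = of_nat i" for n i
      by (simp add: mult_ac)
    show "(-1) ^ (j - 1) * of_nat j * mixed_moment (k - j) j = (if j = min k N then of_nat j else 0)"
    proof (cases "j = k")
      case True
      thus ?thesis using j mixed_moment_esym[of k] mixed_moment_eq_0[of k] sq[of "k - 1" k]
        by (cases "k \<le> N") auto
    next
      case False
      thus ?thesis using j mixed_moment_pos[of "k - j" j] assms(2) sq[of "N - 1" N] by auto
    qed
  qed
  also have "\<dots> = of_nat (min k N)" using assms by (simp add: sum.delta)
  finally show ?thesis .
qed

text \<open>The entry \<open>(U ^\<^sub>m k) $$ (p, p)\<close> is, up to the factor k, itself a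
  derivative of the trace.\<close>

lemma expectation_ptrace:
  assumes "k > 0" "N > 0"
  shows "(LINT U|M. ptrace k U) = 0"
proof -
  have "(LINT U|M. of_nat k * (U ^\<^sub>m k) $$ (p, p)) = 0" if "p < N" for p
    using expectation_lie_deriv_eq_0[OF has_lie_deriv_ptrace that that] by simp
  hence *: "(LINT U|M. (U ^\<^sub>m k) $$ (p, p)) = 0" if "p < N" for p using that assms by auto
  have "(LINT U|M. ptrace k U) = (LINT U|M. (\<Sum>p<N. (U ^\<^sub>m k) $$ (p, p)))"
    by (rule Bochner_Integration.integral_cong) (auto simp: ptrace_def unitary_groupD)
  also have "\<dots> = 0"
    using has_lie_derivD(1)[OF has_lie_deriv_pow_entry] *
    by (subst Bochner_Integration.integral_sum) auto
  finally show ?thesis .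
qed

text \<open>Both mixed second moments follow from invariance under scalar phases, that is, from the sum
  of the diagonal derivatives.\<close>
lemma lie_deriv_trace_expectation:
  assumes "has_lie_deriv N F G"
  shows "(LINT U|M. (\<Sum>p<N. G p p U)) = 0"
  using has_lie_derivD(2)[OF assms] expectation_lie_deriv_eq_0[OF assms]
  by (subst Bochner_Integration.integral_sum) auto

lemma expectation_ptrace_mult_cnj_neq:
  assumes "j \<noteq> k"
  shows "(LINT U|M. ptrace j U * cnj (ptrace k U)) = 0"
proof -
  have "0 = (LINT U|M. (\<Sum>p<N. of_nat j * (U ^\<^sub>m j) $$ (p, p) * cnj (ptrace k U) + ptrace j U * - cnj (of_nat k * (U ^\<^sub>m k) $$ (p, p))))"
    using lie_deriv_trace_expectation[OF has_lie_deriv_mult[OF has_lie_deriv_ptrace[of N j] has_lie_deriv_cnj[OF has_lie_deriv_ptrace[of N k]]]]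
    by simp
  also have "\<dots> = (LINT U|M. (of_nat j - of_nat k) * (ptrace j U * cnj (ptrace k U)))"
    by (rule Bochner_Integration.integral_cong)
       (auto simp: ptrace_def unitary_groupD sum.distrib sum_subtractf sum_distrib_left[symmetric] sum_distrib_right[symmetric] algebra_simps)
  also have "\<dots> = (of_nat j - of_nat k) * (LINT U|M. ptrace j U * cnj (ptrace k U))" by simp
  finally show ?thesis using assms by simp
qed

lemma expectation_ptrace_mult:
  assumes "j + k > 0"
  shows "(LINT U|M. ptrace j U * ptrace k U) = 0"
proof -
  have "0 = (LINT U|M. (\<Sum>p<N. of_nat j * (U ^\<^sub>m j) $$ (p, p) * ptrace k U + ptrace j U * (of_nat k * (U ^\<^sub>m k) $$ (p, p))))"
    using lie_deriv_trace_expectation[OF has_lie_deriv_mult[OF has_lie_deriv_ptrace[of N j] has_lie_deriv_ptrace[of N k]]]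
    by simp
  also have "\<dots> = (LINT U|M. (of_nat (j + k)) * (ptrace j U * ptrace k U))"
    by (rule Bochner_Integration.integral_cong)
       (auto simp: ptrace_def unitary_groupD sum.distrib sum_subtractf sum_distrib_left[symmetric] sum_distrib_right[symmetric] algebra_simps)
  also have "\<dots> = of_nat (j + k) * (LINT U|M. ptrace j U * ptrace k U)" by simp
  finally have "of_nat (j + k) = (0::complex) \<or> (LINT U|M. ptrace j U * ptrace k U) = 0"
    unfolding mult_eq_0_iff[symmetric] by simp
  thus ?thesis using assms by (auto simp: of_nat_eq_0_iff simp del: of_nat_add)
qed

end

section \<open>Borel functions on the unit circle\<close>

text \<open>Real trigonometric polynomials up to equality on the unit circle. Nonnegative powers
  suffice because z^(-k) is the conjugate of z^k there and only real parts are taken.\<close>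

inductive trig_function :: "(complex \<Rightarrow> real) \<Rightarrow> bool" where
  monomial: "(\<And>z. norm z = 1 \<Longrightarrow> g z = Re (a * z ^ k)) \<Longrightarrow> trig_function g"
| add: "trig_function g \<Longrightarrow> trig_function h \<Longrightarrow> (\<And>z. norm z = 1 \<Longrightarrow> f z = g z + h z) \<Longrightarrow> trig_function f"

text \<open>Re x Re y is Re (x y / 2) + Re (x cnj y / 2). In the second part the smaller power
  cancels on the circle; if l > k, a conjugation, invisible to \<open>Re\<close>, makes the exponent
  nonnegative again.\<close>

lemma trig_function_mult_monomial:
  assumes "trig_function g"
  shows "trig_function (\<lambda>z. g z * Re (b * z ^ l))"
  using assms
proof induction
  case (monomial g a k)
  have prod: "Re x * Re y = Re (x * y / 2) + Re (x * cnj y / 2)" for x y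
    by (simp add: field_simps)
  have unit: "z * cnj z = 1" if "norm z = 1" for z
    using that by (simp add: complex_norm_square[symmetric])
  have 1: "trig_function (\<lambda>z. Re ((a * z ^ k) * (b * z ^ l) / 2))"
    by (rule trig_function.monomial[where a = "a * b / 2" and k = "k + l"]) (simp add: power_add mult_ac)
  have 2: "trig_function (\<lambda>z. Re ((a * z ^ k) * cnj (b * z ^ l) / 2))"
  proof (cases "l \<le> k")
    case True
    then obtain m where m: "k = m + l" using le_Suc_ex add.commute by metis
    show ?thesis
    proof (rule trig_function.monomial[where a = "a * cnj b / 2" and k = m])
      fix z :: complex assume "norm z = 1"
      hence "z ^ l * cnj z ^ l = 1" using unit by (simp add: power_mult_distrib[symmetric])
      moreover have "a * z ^ k * cnj (b * z ^ l) / 2 = a * cnj b / 2 * z ^ m * (z ^ l * cnj z ^ l)"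
        by (simp add: m power_add)
      ultimately have "a * z ^ k * cnj (b * z ^ l) / 2 = a * cnj b / 2 * z ^ m" by (simp only: mult_1_right)
      thus "Re (a * z ^ k * cnj (b * z ^ l) / 2) = Re (a * cnj b / 2 * z ^ m)" by (rule arg_cong)
    qed
  next
    case False
    then obtain m where m: "l = m + k" using le_Suc_ex add.commute nat_le_linear by metis
    show ?thesis
    proof (rule trig_function.monomial[where a = "cnj a * b / 2" and k = m])
      fix z :: complex assume "norm z = 1"
      hence "z ^ k * cnj z ^ k = 1" using unit by (simp add: power_mult_distrib[symmetric])
      moreover have "a * z ^ k * cnj (b * z ^ l) / 2 = cnj (cnj a * b / 2 * z ^ m) * (z ^ k * cnj z ^ k)"
        by (simp add: m power_add)
      ultimately have "a * z ^ k * cnj (b * z ^ l) / 2 = cnj (cnj a * b / 2 * z ^ m)" by (simp only: mult_1_right)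
      hence "Re (a * z ^ k * cnj (b * z ^ l) / 2) = Re (cnj (cnj a * b / 2 * z ^ m))" by (rule arg_cong)
      thus "Re (a * z ^ k * cnj (b * z ^ l) / 2) = Re (cnj a * b / 2 * z ^ m)" by (simp only: cnj.sel)
    qed
  qed
  show ?case
    by (rule trig_function.add[OF 1 2]) (simp add: monomial prod del: times_complex.sel)
next
  case (add g h f)
  show ?case
    by (rule trig_function.add[OF add.IH]) (simp add: add.hyps distrib_right)
qed

lemma trig_function_mult:
  assumes "trig_function h" "trig_function g"
  shows "trig_function (\<lambda>z. g z * h z)"
  using assms
proof induction
  case (monomial h a k)
  show ?case
    by (rule trig_function.add[OF trig_function_mult_monomial[OF monomial(2), of a k] trig_function.monomial[of "\<lambda>_. 0" 0 0]])
       (use monomial in auto)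
next
  case (add g' h f)
  show ?case
    by (rule trig_function.add[OF add.IH]) (use add in \<open>auto simp: distrib_left\<close>)
qed

text \<open>Products are covered by \<open>trig_function_mult\<close>, so it remains to see that a
  real-linear functional f is Re (a z) with a = f 1 - \<i> f \<i>.\<close>

lemma trig_function_polynomial: "real_polynomial_function g \<Longrightarrow> trig_function g"
proof (induction rule: real_polynomial_function.induct)
  case (linear f)
  interpret bounded_linear f by fact
  show ?case
  proof (rule trig_function.monomial[where a = "Complex (f 1) (- f \<i>)" and k = 1])
    fix z :: complex
    have "f z = f (Re z *\<^sub>R 1 + Im z *\<^sub>R \<i>)"
      by (metis complex_eq mult.commute scaleR_conv_of_real mult.right_neutral)
    thus "f z = Re (Complex (f 1) (- f \<i>) * z ^ 1)" by (simp add: add scaleR)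
  qed
next
  case (const c)
  show ?case by (rule trig_function.monomial[where a = "of_real c" and k = 0]) simp
qed (auto intro: trig_function_mult trig_function.add)

text \<open>The bound is asked for only on the circle, as monomials are unbounded in the plane;
  measurability is that of the whole plane.\<close>

definition bounded_borel :: "(complex \<Rightarrow> real) \<Rightarrow> bool" where
  "bounded_borel g \<longleftrightarrow> g \<in> borel_measurable borel \<and> bounded (g ` sphere 0 1)"

lemma bounded_borelI: "g \<in> borel_measurable borel \<Longrightarrow> (\<And>z. norm z = 1 \<Longrightarrow> \<bar>g z\<bar> \<le> C) \<Longrightarrow> bounded_borel g"
  unfolding bounded_borel_def by (auto intro!: boundedI)

lemma bounded_borelE:
  assumes "bounded_borel g"
  obtains C where "g \<in> borel_measurable borel" "\<And>z. norm z = 1 \<Longrightarrow> \<bar>g z\<bar> \<le> C"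
proof -
  obtain C where "\<forall>x\<in>g ` sphere 0 1. norm x \<le> C" using assms unfolding bounded_borel_def bounded_iff by blast
  thus ?thesis using assms by (intro that[of C]) (auto simp: bounded_borel_def)
qed

lemma bounded_borel_measurable: "bounded_borel g \<Longrightarrow> g \<in> borel_measurable borel"
  by (simp add: bounded_borel_def)

lemma bounded_borel_continuous: "continuous_on UNIV g \<Longrightarrow> bounded_borel g"
  unfolding bounded_borel_def
  by (intro conjI borel_measurable_continuous_onI compact_imp_bounded compact_continuous_image)
     (auto intro: continuous_on_subset)

lemma bounded_borel_monomial: "bounded_borel (\<lambda>z. Re (a * z ^ k))"
  by (intro bounded_borel_continuous continuous_intros)

lemma bounded_borel_indicator: "A \<in> sets borel \<Longrightarrow> bounded_borel (indicator A)"
  by (rule bounded_borelI[of _ 1]) (auto simp: indicator_def)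

lemma bounded_borel_add: "bounded_borel g \<Longrightarrow> bounded_borel h \<Longrightarrow> bounded_borel (\<lambda>z. g z + h z)"
  by (auto simp: bounded_borel_def intro: bounded_plus_comp)

lemma bounded_borel_mult:
  assumes "bounded_borel g" "bounded_borel h"
  shows "bounded_borel (\<lambda>z. g z * h z)"
proof -
  obtain C where C: "g \<in> borel_measurable borel" "\<And>z. norm z = 1 \<Longrightarrow> \<bar>g z\<bar> \<le> C"
    using assms(1) by (rule bounded_borelE) blast
  obtain D where D: "h \<in> borel_measurable borel" "\<And>z. norm z = 1 \<Longrightarrow> \<bar>h z\<bar> \<le> D"
    using assms(2) by (rule bounded_borelE) blast
  show ?thesis
  proof (rule bounded_borelI)
    fix z :: complex assume z: "norm z = 1"
    show "\<bar>g z * h z\<bar> \<le> C * D"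
      unfolding abs_mult by (intro mult_mono C D z order_trans[OF abs_ge_zero C(2)[OF z]]) auto
  qed (use C(1) D(1) in auto)
qed

lemma bounded_borel_scale: "bounded_borel g \<Longrightarrow> bounded_borel (\<lambda>z. c * g z)"
  by (rule bounded_borel_mult[OF bounded_borel_continuous[OF continuous_on_const]])

text \<open>Stone--Weierstrass leads from trigonometric polynomials to continuous functions, monotone limits to
  indicators of closed sets, and Dynkin's lemma to indicators of Borel sets.\<close>
lemma circle_borel_induct [consumes 1, case_names monomial add scale lim]:
  assumes g: "bounded_borel g"
    and monomial: "\<And>a k. P (\<lambda>z. Re (a * z ^ k))"
    and add: "\<And>g h. P g \<Longrightarrow> P h \<Longrightarrow> bounded_borel g \<Longrightarrow> bounded_borel h \<Longrightarrow> P (\<lambda>z. g z + h z)"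
    and scale: "\<And>c g. P g \<Longrightarrow> P (\<lambda>z. c * g z)"
    and lim: "\<And>G g C. (\<And>n. P (G n)) \<Longrightarrow> (\<And>n. bounded_borel (G n)) \<Longrightarrow> bounded_borel g \<Longrightarrow>
       (\<And>n z. norm z = 1 \<Longrightarrow> \<bar>G n z\<bar> \<le> C) \<Longrightarrow> (\<And>z. norm z = 1 \<Longrightarrow> (\<lambda>n. G n z) \<longlonglongrightarrow> g z) \<Longrightarrow> P g"
  shows "P g"
proof -
  let ?Q = "\<lambda>h. P h \<and> bounded_borel h"
  have zero: "?Q (\<lambda>_. 0)"
    using monomial[of 0 0] by (auto intro: bounded_borel_continuous)
  have Qadd: "?Q (\<lambda>z. h z + h' z)" if "?Q h" "?Q h'" for h h'
    using that add bounded_borel_add by blast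
  have Qscale: "?Q (\<lambda>z. c * h z)" if "?Q h" for c h
    using that scale bounded_borel_scale by blast
  \<comment> \<open>A trigonometric function is only known to equal a combination of monomials on
    the circle, so P is obtained for that combination and not for the function itself.\<close>
  have trig: "\<exists>h'. ?Q h' \<and> (\<forall>z. norm z = 1 \<longrightarrow> h' z = h z)" if "trig_function h" for h
    using that
  proof induction
    case (monomial h a k)
    thus ?case using assms(2) bounded_borel_monomial by (intro exI[of _ "\<lambda>z. Re (a * z ^ k)"]) auto
  next
    case (add g h f)
    then obtain g' h' where *: "?Q g'" "\<forall>z. norm z = 1 \<longrightarrow> g' z = g z" "?Q h'" "\<forall>z. norm z = 1 \<longrightarrow> h' z = h z"
      by blast
    thus ?case using Qadd[OF *(1,3)] add.hyps by (intro exI[of _ "\<lambda>z. g' z + h' z"]) auto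
  qed
  have cont: "?Q h" if h: "continuous_on UNIV h" for h
  proof -
    have hb: "bounded_borel h" by (rule bounded_borel_continuous[OF h])
    then obtain D where D: "\<And>z. norm z = 1 \<Longrightarrow> \<bar>h z\<bar> \<le> D" by (rule bounded_borelE) blast
    have "\<exists>q. ?Q q \<and> (\<forall>z. norm z = 1 \<longrightarrow> \<bar>h z - q z\<bar> < 1 / real (Suc n))" for n
    proof -
      obtain q where q: "real_polynomial_function q" "\<And>z. z \<in> sphere 0 1 \<Longrightarrow> \<bar>h z - q z\<bar> < 1 / real (Suc n)"
        by (rule Stone_Weierstrass_real_polynomial_function[of "sphere 0 1" h "1 / real (Suc n)"])
           (auto intro: continuous_on_subset[OF h])
      from trig[OF trig_function_polynomial[OF q(1)]] obtain q' where
        "?Q q'" "\<forall>z. norm z = 1 \<longrightarrow> q' z = q z" by blast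
      thus ?thesis using q(2) by (intro exI[of _ q']) auto
    qed
    then obtain q where q: "\<And>n. ?Q (q n)" "\<And>n z. norm z = 1 \<Longrightarrow> \<bar>h z - q n z\<bar> < 1 / real (Suc n)" by metis
    have "P h"
    \<comment> \<open>The limit rule compares values on the circle only. The approximation errors
      there are at most 1, whence D + 1.\<close>
    proof (rule lim[of q h "D + 1"])
      fix z :: complex assume z: "norm z = 1"
      show "\<bar>q n z\<bar> \<le> D + 1" for n
      proof -
        have "1 / real (Suc n) \<le> 1" by simp
        with q(2)[OF z, of n] D[OF z] show ?thesis by linarith
      qed
      have "(\<lambda>n. h z - q n z) \<longlonglongrightarrow> 0"
        by (rule Lim_null_comparison[OF always_eventually LIMSEQ_Suc[OF lim_1_over_n]])
           (use q(2)[OF z] in \<open>auto intro: less_imp_le\<close>)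
      thus "(\<lambda>n. q n z) \<longlonglongrightarrow> h z"
        using tendsto_diff[OF tendsto_const[of "h z"], of "\<lambda>n. h z - q n z" 0] by simp
    qed (use q hb in auto)
    thus ?thesis using hb by simp
  qed
  have ind: "?Q (indicator A)" if A: "A \<in> sets borel" for A
  proof -
    have "Int_stable (Collect closed :: complex set set)" by (auto simp: Int_stable_def)
    moreover have "Collect closed \<subseteq> Pow (UNIV :: complex set)" by auto
    moreover have "A \<in> sigma_sets UNIV (Collect closed)" using A by (simp add: borel_eq_closed)
    ultimately have "P (indicator A)"
    proof (induction rule: sigma_sets_induct_disjoint)
      case (basic B)
      hence B: "closed B" by simp
      show ?case
      proof (cases "B = {}")
        case True
        thus ?thesis using zero by (simp add: indicator_def[abs_def])
      next
        case False
        have c: "?Q (\<lambda>z. max 0 (1 - real n * infdist z B))" for n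
          by (intro cont continuous_intros)
        show ?thesis
        \<comment> \<open>These continuous functions decrease to the indicator, as points outside a
          closed set have positive distance from it.\<close>
        proof (rule lim[of "\<lambda>n z. max 0 (1 - real n * infdist z B)" _ 1])
          show "bounded_borel (indicator B)" using B by (intro bounded_borel_indicator) auto
          show "\<bar>max 0 (1 - real n * infdist z B)\<bar> \<le> 1" for n z by (auto simp: infdist_nonneg)
          fix z
          show "(\<lambda>n. max 0 (1 - real n * infdist z B)) \<longlonglongrightarrow> indicator B z"
          proof (cases "z \<in> B")
            case zB: False
            have pos: "infdist z B > 0"
              using infdist_pos_not_in_closed[OF B False zB] .
            obtain m :: nat where m: "1 / infdist z B < real m" using reals_Archimedean2 by blast
            have "\<forall>\<^sub>F n in sequentially. max 0 (1 - real n * infdist z B) = 0"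
              using eventually_ge_at_top[of m]
            proof eventually_elim
              case (elim n)
              have "1 < real m * infdist z B" using m pos by (simp add: divide_less_eq)
              also have "\<dots> \<le> real n * infdist z B" using elim pos by (intro mult_right_mono) auto
              finally show ?case by simp
            qed
            thus ?thesis using zB by (simp add: tendsto_eventually)
          qed simp
        qed (use c in auto)
      qed
    next
      case empty
      thus ?case using zero by (simp add: indicator_def[abs_def])
    next
      case (compl B)
      hence "?Q (indicator B)" by (auto simp: borel_eq_closed intro: bounded_borel_indicator)
      hence "?Q (\<lambda>z. 1 + (- 1) * indicator B z)"
        by (rule Qadd[OF cont[OF continuous_on_const] Qscale])
      moreover have "(\<lambda>z. 1 + (- 1) * indicator B z) = (indicator (UNIV - B) :: complex \<Rightarrow> real)"
        by (auto simp: indicator_def)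
      ultimately show ?case by simp
    next
      case (union A)
      have A: "A i \<in> sets borel" for i using union(2) by (auto simp: borel_eq_closed)
      have disj: "disjoint_family A" by (rule union(1))
      show ?case
      proof (rule lim[of "\<lambda>n z. \<Sum>i<n. indicator (A i) z" _ 1])
        have Q: "?Q (\<lambda>z. \<Sum>i<n. indicator (A i) z)" for n
        proof (induction n)
          case (Suc n)
          have "?Q (indicator (A n))" using union(3) bounded_borel_indicator[OF A] by blast
          thus ?case using Qadd[OF Suc] by simp
        qed (use zero in simp)
        show "P (\<lambda>z. \<Sum>i<n. indicator (A i) z)" "bounded_borel (\<lambda>z. \<Sum>i<n. indicator (A i) z)" for n
          using Q[of n] by blast+
        show "bounded_borel (indicator (\<Union>i. A i))" using A by (intro bounded_borel_indicator) auto
        show "\<bar>\<Sum>i<n. indicator (A i) z\<bar> \<le> (1::real)" for n z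
        proof -
          have "(\<Sum>i<n. indicator (A i) z) = (indicator (\<Union>i<n. A i) z :: real)"
            using disj by (intro indicator_UN_disjoint[symmetric]) (auto simp: disjoint_family_on_def)
          thus ?thesis by (simp add: indicator_def)
        qed
        fix z
        have "(\<lambda>i. indicator (A i) z :: real) sums indicator (\<Union>i. A i) z"
          by (intro indicator_sums) (use disj in \<open>auto simp: disjoint_family_on_def\<close>)
        thus "(\<lambda>n. \<Sum>i<n. indicator (A i) z) \<longlonglongrightarrow> (indicator (\<Union>i. A i) z :: real)"
          by (simp add: sums_def)
      qed
    qed
    thus ?thesis using bounded_borel_indicator[OF A] by simp
  qed
  have simple: "?Q s" if s: "simple_function borel s" for s :: "complex \<Rightarrow> real"
  proof -
    have fin: "finite (range s)" using s by (auto simp: simple_function_def)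
    have m: "s -` {y} \<in> sets borel" for y
      using measurable_sets[OF borel_measurable_simple_function[OF s], of "{y}"] by simp
    have "?Q (\<lambda>z. \<Sum>y\<in>Y. y * indicator (s -` {y}) z)" if "finite Y" for Y
      using that
    proof (induction Y)
      case (insert y Y)
      show ?case unfolding sum.insert[OF insert.hyps] by (intro Qadd Qscale ind m insert.IH)
    qed (use zero in simp)
    from this[OF fin] have "?Q (\<lambda>z. \<Sum>y\<in>range s. y * indicator (s -` {y}) z)" .
    also have "(\<lambda>z. \<Sum>y\<in>range s. y * indicator (s -` {y}) z) = s"
    proof
      fix z
      have "(\<Sum>y\<in>range s. y * indicator (s -` {y}) z) = (\<Sum>y\<in>range s. if y = s z then y else 0)"
        by (intro sum.cong) (auto simp: indicator_def)
      also have "\<dots> = s z" using fin by simp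
      finally show "(\<Sum>y\<in>range s. y * indicator (s -` {y}) z) = s z" .
    qed
    finally show ?thesis .
  qed
  obtain C where C: "g \<in> borel_measurable borel" "\<And>z. norm z = 1 \<Longrightarrow> \<bar>g z\<bar> \<le> C"
    using g by (rule bounded_borelE) blast
  \<comment> \<open>The approximating simple functions are at most twice |g| in modulus, which
    explains the bound 2C below.\<close>
  obtain s where s: "\<And>i. simple_function borel (s i)" "\<And>x. x \<in> space borel \<Longrightarrow> (\<lambda>i. s i x) \<longlonglongrightarrow> g x"
    "\<And>i x. x \<in> space borel \<Longrightarrow> dist (s i x) 0 \<le> 2 * dist (g x) 0"
    using borel_measurable_implies_sequence_metric[OF C(1), of 0] by blast
  show ?thesis
  proof (rule lim[of s g "2 * C"])
    show "\<bar>s n z\<bar> \<le> 2 * C" if "norm z = 1" for n z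
      using s(3)[of z n] C(2)[OF that] by (simp add: dist_real_def)
  qed (use s simple g in auto)
qed

text \<open>Normalised arc length, taken as a measure on the plane so that the same symbols can be
  integrated and evaluated at eigenvalues.\<close>

definition circle_measure :: "complex measure" where
  "circle_measure = distr (uniform_measure lborel {-pi..pi}) borel cis"

lemma sets_circle_measure [measurable_cong, simp]: "sets circle_measure = sets borel"
  and space_circle_measure [simp]: "space circle_measure = UNIV"
  by (simp_all add: circle_measure_def)

lemma borel_measurable_circle_measure [simp]: "borel_measurable circle_measure = borel_measurable borel"
  by (rule measurable_cong_sets) simp_all

lemma measurable_cis [measurable]: "cis \<in> borel_measurable borel"
  by (intro borel_measurable_continuous_onI continuous_intros)

lemma prob_space_circle_measure: "prob_space circle_measure"
  unfolding circle_measure_def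
  by (intro prob_space.prob_space_distr prob_space_uniform_measure) auto

interpretation circle: prob_space circle_measure by (rule prob_space_circle_measure)

lemma AE_circle_measure: "AE z in circle_measure. norm z = 1"
  unfolding circle_measure_def by (subst AE_distr_iff) auto

lemma integral_circle_measure:
  fixes g :: "complex \<Rightarrow> 'a::{banach, second_countable_topology}"
  assumes [measurable]: "g \<in> borel_measurable borel"
  shows "(LINT z|circle_measure. g z) = (1 / (2 * pi)) *\<^sub>R (LBINT \<theta>:{-pi..pi}. g (cis \<theta>))"
proof -
  have "uniform_measure lborel {-pi..pi} = density lborel (\<lambda>\<theta>. ennreal (indicator {-pi..pi} \<theta> / (2 * pi)))"
    unfolding uniform_measure_def
    by (rule density_cong) (auto simp: indicator_def divide_ennreal simp flip: ennreal_1)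
  hence "(LINT z|circle_measure. g z) = (LINT \<theta>|density lborel (\<lambda>\<theta>. ennreal (indicator {-pi..pi} \<theta> / (2 * pi))). g (cis \<theta>))"
    unfolding circle_measure_def by (subst integral_distr) auto
  also have "\<dots> = (LINT \<theta>|lborel. (indicator {-pi..pi} \<theta> / (2 * pi)) *\<^sub>R g (cis \<theta>))"
    by (subst integral_density) auto
  also have "\<dots> = (LINT \<theta>|lborel. (1 / (2 * pi)) *\<^sub>R (indicator {-pi..pi} \<theta> *\<^sub>R g (cis \<theta>)))"
    by simp
  finally show ?thesis by (simp only: set_lebesgue_integral_def integral_scaleR_right)
qed

lemma circle_orthogonal:
  "(LINT z|circle_measure. z ^ k * cnj z ^ m) = of_bool (k = m)"
proof (cases "k = m")
  case True
  have "(LINT z|circle_measure. z ^ k * cnj z ^ m) = (LINT z|circle_measure. (1::complex))"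
  proof (rule integral_cong_AE)
    show "AE z in circle_measure. z ^ k * cnj z ^ m = 1"
      using AE_circle_measure
    proof eventually_elim
      case (elim z)
      hence "z * cnj z = 1" by (simp add: complex_norm_square[symmetric])
      thus ?case by (simp add: True power_mult_distrib[symmetric])
    qed
  qed (auto intro!: borel_measurable_continuous_onI continuous_intros)
  thus ?thesis using True circle.prob_space by simp
next
  case False
  define n where "n = real k - real m"
  have n: "n \<noteq> 0" using False by (simp add: n_def)
  have "cis \<theta> ^ k * cnj (cis \<theta>) ^ m = cis (n * \<theta>)" for \<theta>
  proof -
    have "cis \<theta> ^ k * cnj (cis \<theta>) ^ m = cis (real k * \<theta> + real m * - \<theta>)"
      by (simp only: cis_cnj Complex.DeMoivre cis_mult)
    also have "real k * \<theta> + real m * - \<theta> = n * \<theta>" by (simp add: n_def algebra_simps)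
    finally show ?thesis .
  qed
  hence "(LINT z|circle_measure. z ^ k * cnj z ^ m) = (1 / (2 * pi)) *\<^sub>R (LBINT \<theta>:{-pi..pi}. cis (n * \<theta>))"
    by (subst integral_circle_measure) (auto intro!: borel_measurable_continuous_onI continuous_intros)
  also have "(LBINT \<theta>:{-pi..pi}. cis (n * \<theta>)) = cis (n * pi) / (\<i> * n) - cis (n * (- pi)) / (\<i> * n)"
    unfolding set_lebesgue_integral_def
  proof (rule integral_FTC_atLeastAtMost)
    show "((\<lambda>\<theta>. cis (n * \<theta>) / (\<i> * n)) has_vector_derivative cis (n * x)) (at x within {-pi..pi})" for x
    proof -
      have "((\<lambda>z. exp (\<i> * n * z) / (\<i> * n)) has_field_derivative cis (n * x)) (at (complex_of_real x))"
        using n by (auto intro!: derivative_eq_intros simp: cis_conv_exp mult.assoc)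
      from has_vector_derivative_real_field[OF this] show ?thesis
        by (simp add: cis_conv_exp mult.assoc[symmetric] has_vector_derivative_at_within)
    qed
  qed (auto intro!: continuous_intros)
  \<comment> \<open>The endpoint values agree because n is an integer: the integral runs over full
    periods.\<close>
  also have "cis (n * pi) = cis (n * (- pi))"
  proof -
    have "cis (n * pi) = cis (n * (- pi)) * cis (2 * pi * (of_int (int k - int m)))"
      by (simp add: cis_mult n_def algebra_simps)
    also have "cis (2 * pi * (of_int (int k - int m))) = 1" by (rule cis_multiple_2pi) auto
    finally show ?thesis by simp
  qed
  finally show ?thesis using False by simp
qed

lemma circle_integrable:
  fixes g :: "complex \<Rightarrow> 'a::{banach, second_countable_topology}"
  assumes "g \<in> borel_measurable borel" "\<And>z. norm z = 1 \<Longrightarrow> norm (g z) \<le> C"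
  shows "integrable circle_measure g"
  by (rule circle.integrable_const_bound[of _ C]) (use assms AE_circle_measure in auto)

lemma circle_dominated_convergence:
  fixes g :: "complex \<Rightarrow> 'a::{banach, second_countable_topology}"
  assumes "g \<in> borel_measurable borel" "\<And>n. G n \<in> borel_measurable borel"
    "\<And>n z. norm z = 1 \<Longrightarrow> norm (G n z) \<le> C" "\<And>z. norm z = 1 \<Longrightarrow> (\<lambda>n. G n z) \<longlonglongrightarrow> g z"
  shows "(\<lambda>n. LINT z|circle_measure. G n z) \<longlonglongrightarrow> (LINT z|circle_measure. g z)"
  by (rule integral_dominated_convergence[where w = "\<lambda>_. C"])
     (use assms AE_circle_measure in \<open>auto elim: eventually_mono\<close>)

lemma bounded_borel_integrable:
  assumes "bounded_borel g"
  shows "integrable circle_measure g"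
  using assms by (rule bounded_borelE) (rule circle_integrable, auto)

lemma bounded_borel_mult_power_integrable:
  assumes "bounded_borel g"
  shows "integrable circle_measure (\<lambda>z. of_real (g z) * z ^ m)"
proof -
  obtain C where C: "g \<in> borel_measurable borel" "\<And>z. norm z = 1 \<Longrightarrow> \<bar>g z\<bar> \<le> C"
    using assms by (rule bounded_borelE) blast
  have "(\<lambda>z. z ^ m) \<in> borel_measurable (borel :: complex measure)"
    by (intro borel_measurable_continuous_onI continuous_intros)
  thus ?thesis using C by (intro circle_integrable[of _ C]) (auto simp: norm_mult norm_power)
qed

section \<open>Variance of linear statistics\<close>

definition eig_sum :: "(complex \<Rightarrow> real) \<Rightarrow> complex mat \<Rightarrow> real" where
  "eig_sum g U = (\<Sum>z\<in>#proots (char_poly U). g z)"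

lemma eig_sum_add: "eig_sum (\<lambda>z. g z + h z) U = eig_sum g U + eig_sum h U"
  by (simp add: eig_sum_def sum_mset.distrib)

lemma eig_sum_scale: "eig_sum (\<lambda>z. c * g z) U = c * eig_sum g U"
proof -
  have "(\<Sum>z\<in>#Z. c * g z) = c * (\<Sum>z\<in>#Z. g z)" for Z
    by (induction Z) (auto simp: distrib_left)
  thus ?thesis by (simp add: eig_sum_def)
qed

lemma eig_sum_monomial:
  assumes "U \<in> unitary_group N"
  shows "eig_sum (\<lambda>z. Re (a * z ^ k)) U = Re (a * ptrace k U)"
proof -
  have "(\<Sum>z\<in>#Z. Re (a * z ^ k)) = Re (a * (\<Sum>z\<in>#Z. z ^ k))" for Z
    by (induction Z) (auto simp: distrib_left simp del: times_complex.sel)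
  thus ?thesis
    by (simp add: eig_sum_def ptrace_eq_sum_proots[OF unitary_groupD(1)[OF assms]] del: times_complex.sel)
qed

lemma abs_eig_sum_le:
  assumes U: "U \<in> unitary_group N" and g: "\<And>z. norm z = 1 \<Longrightarrow> \<bar>g z\<bar> \<le> C"
  shows "\<bar>eig_sum g U\<bar> \<le> real N * C"
proof -
  have "\<bar>\<Sum>z\<in>#Z. g z\<bar> \<le> real (size Z) * C" if "\<And>z. z \<in># Z \<Longrightarrow> norm z = 1" for Z
    using that
  proof (induction Z)
    case (add z Z)
    have "\<bar>g z + (\<Sum>z\<in>#Z. g z)\<bar> \<le> C + real (size Z) * C"
      using add g[of z] by (intro order_trans[OF abs_triangle_ineq] add_mono) auto
    thus ?case by (simp add: algebra_simps)
  qed simp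
  from this[of "proots (char_poly U)"] show ?thesis
    using norm_proots_unitary[OF U] size_proots_char_poly[OF unitary_groupD(1)[OF U]]
    by (simp add: eig_sum_def)
qed

lemma tendsto_eig_sum:
  assumes U: "U \<in> unitary_group N" and G: "\<And>z. norm z = 1 \<Longrightarrow> (\<lambda>n. G n z) \<longlonglongrightarrow> g z"
  shows "(\<lambda>n. eig_sum (G n) U) \<longlonglongrightarrow> eig_sum g U"
proof -
  have "(\<lambda>n. \<Sum>z\<in>#Z. G n z) \<longlonglongrightarrow> (\<Sum>z\<in>#Z. g z)" if "\<And>z. z \<in># Z \<Longrightarrow> norm z = 1" for Z
    using that by (induction Z) (auto intro!: tendsto_add G)
  thus ?thesis unfolding eig_sum_def using norm_proots_unitary[OF U] by blast
qed

context haar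
begin

text \<open>The eigenvalues are not given as functions of the matrix, so measurability passes from
  power traces to Borel symbols through \<open>circle_borel_induct\<close>.\<close>

lemma measurable_eig_sum: "bounded_borel g \<Longrightarrow> eig_sum g \<in> borel_measurable M"
proof (induction rule: circle_borel_induct)
  case (monomial a k)
  have "(\<lambda>U. Re (a * ptrace k U)) \<in> borel_measurable M"
    using bounded_rv_measurable[OF bounded_rv_ptrace[of N k]] unfolding measurable_M_cong by measurable
  also have "?this \<longleftrightarrow> ?case"
    by (rule measurable_cong) (simp add: eig_sum_monomial del: times_complex.sel)
  finally show ?case .
next
  case (lim G g C)
  show ?case by (rule borel_measurable_LIMSEQ_real[of _ "\<lambda>n. eig_sum (G n)"]) (use lim tendsto_eig_sum in auto)
qed (simp_all add: eig_sum_add[abs_def] eig_sum_scale[abs_def])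

lemma integrable_eig_sum:
  assumes "bounded_borel g"
  shows "integrable M (eig_sum g)"
proof -
  obtain C where C: "\<And>z. norm z = 1 \<Longrightarrow> \<bar>g z\<bar> \<le> C" using assms by (rule bounded_borelE) blast
  show ?thesis
    by (rule integrable_const_bound[of _ "real N * C"])
       (use measurable_eig_sum assms abs_eig_sum_le[of _ N g C] C in auto)
qed

lemma abs_eig_sum_mult_le:
  assumes U: "U \<in> unitary_group N" and "\<And>z. norm z = 1 \<Longrightarrow> \<bar>g z\<bar> \<le> C" "\<And>z. norm z = 1 \<Longrightarrow> \<bar>h z\<bar> \<le> D"
  shows "norm (eig_sum g U * eig_sum h U) \<le> real N * C * (real N * D)"
proof -
  have 1: "\<bar>eig_sum g U\<bar> \<le> real N * C" using abs_eig_sum_le[OF U] assms by blast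
  moreover have "\<bar>eig_sum h U\<bar> \<le> real N * D" using abs_eig_sum_le[OF U] assms by blast
  ultimately show ?thesis
    unfolding real_norm_def abs_mult by (intro mult_mono order_trans[OF abs_ge_zero 1]) auto
qed

lemma integrable_eig_sum_mult:
  assumes "bounded_borel g" "bounded_borel h"
  shows "integrable M (\<lambda>U. eig_sum g U * eig_sum h U)"
proof -
  obtain C where C: "\<And>z. norm z = 1 \<Longrightarrow> \<bar>g z\<bar> \<le> C" using assms(1) by (rule bounded_borelE) blast
  obtain D where D: "\<And>z. norm z = 1 \<Longrightarrow> \<bar>h z\<bar> \<le> D" using assms(2) by (rule bounded_borelE) blast
  show ?thesis
  proof (rule integrable_const_bound[of _ "real N * C * (real N * D)"])
    show "AE U in M. norm (eig_sum g U * eig_sum h U) \<le> real N * C * (real N * D)"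
      by (rule AE_I2, rule abs_eig_sum_mult_le) (use C D in auto)
  qed (use measurable_eig_sum assms in auto)
qed

text \<open>Power traces of positive degree have mean zero, so the mean eigenvalue distribution is
  uniform on monomials and then on all bounded Borel symbols.\<close>

lemma expectation_eig_sum:
  assumes N: "N > 0" and g: "bounded_borel g"
  shows "(LINT U|M. eig_sum g U) = real N * (LINT z|circle_measure. g z)"
  using g
proof (induction rule: circle_borel_induct)
  case (monomial a k)
  have 1: "(LINT U|M. eig_sum (\<lambda>z. Re (a * z ^ k)) U) = Re (a * (LINT U|M. ptrace k U))"
  proof -
    have "(LINT U|M. eig_sum (\<lambda>z. Re (a * z ^ k)) U) = (LINT U|M. Re (a * ptrace k U))"
      by (rule Bochner_Integration.integral_cong) (simp_all add: eig_sum_monomial del: times_complex.sel)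
    also have "\<dots> = Re (LINT U|M. a * ptrace k U)"
      by (rule integral_Re) auto
    finally show ?thesis by (simp del: times_complex.sel)
  qed
  have 2: "(LINT U|M. ptrace k U) = (if k = 0 then of_nat N else 0)"
  proof (cases "k = 0")
    case True
    have "(LINT U|M. ptrace k U) = (LINT U|M. of_nat N)"
      by (rule Bochner_Integration.integral_cong) (auto simp: True ptrace_0)
    thus ?thesis using True prob_space by simp
  qed (use expectation_ptrace N in auto)
  have 3: "(LINT z|circle_measure. Re (a * z ^ k)) = Re (a * of_bool (k = 0))"
  proof -
    have "(LINT z|circle_measure. Re (a * z ^ k)) = Re (LINT z|circle_measure. a * z ^ k)"
      by (intro integral_Re integrable_mult_right circle_integrable[of _ 1])
         (auto simp: norm_power intro!: borel_measurable_continuous_onI continuous_intros)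
    thus ?thesis using circle_orthogonal[of k 0] by (simp del: times_complex.sel)
  qed
  show ?case unfolding 1 2 3 by simp
next
  case (add g h)
  thus ?case
    using integrable_eig_sum bounded_borel_integrable
    by (simp add: eig_sum_add distrib_left)
next
  case (scale c g)
  thus ?case by (simp add: eig_sum_scale)
next
  case (lim G g C)
  have "(\<lambda>n. LINT U|M. eig_sum (G n) U) \<longlonglongrightarrow> (LINT U|M. eig_sum g U)"
  proof (rule integral_dominated_convergence[where w = "\<lambda>_. real N * C"])
    show "AE U in M. norm (eig_sum (G n) U) \<le> real N * C" for n
      unfolding real_norm_def by (rule AE_I2, rule abs_eig_sum_le) (use lim in auto)
  qed (use lim measurable_eig_sum tendsto_eig_sum in auto)
  moreover have "(\<lambda>n. LINT z|circle_measure. G n z) \<longlonglongrightarrow> (LINT z|circle_measure. g z)"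
    by (rule circle_dominated_convergence[of _ _ C]) (use lim in \<open>auto simp: bounded_borel_def\<close>)
  ultimately show ?case
    unfolding lim(1) by (intro LIMSEQ_unique[OF _ tendsto_mult_left]) auto
qed

text \<open>N^2 times the product of the means plus the sum over m <> 0 of min |m| N times c_m(g)
  cnj c_m(h), rewritten: min |m| N is N minus the positive part of N - |m|, and Parseval turns the
  part with N into the integral of gh minus the product of the means. In this form every term passes
  to bounded pointwise limits.\<close>

definition pair_form :: "(complex \<Rightarrow> real) \<Rightarrow> (complex \<Rightarrow> real) \<Rightarrow> real" where
  "pair_form g h = (real N ^ 2 - real N) * (LINT z|circle_measure. g z) * (LINT z|circle_measure. h z)
     + real N * (LINT z|circle_measure. g z * h z)
     - 2 * (\<Sum>m=1..<N. real (N - m) *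
         Re ((LINT z|circle_measure. of_real (g z) * z ^ m) * cnj (LINT z|circle_measure. of_real (h z) * z ^ m)))"

lemma pair_form_commute: "pair_form g h = pair_form h g"
proof -
  have "Re (x * cnj y) = Re (y * cnj x)" for x y by (simp add: mult.commute)
  thus ?thesis unfolding pair_form_def by (simp only: mult_ac)
qed

lemma pair_form_monomial:
  assumes N: "N > 0"
  shows "(LINT U|M. eig_sum (\<lambda>z. Re (a * z ^ k)) U * eig_sum (\<lambda>z. Re (b * z ^ l)) U)
       = pair_form (\<lambda>z. Re (a * z ^ k)) (\<lambda>z. Re (b * z ^ l))"
proof -
  let ?c = "\<lambda>a k m. LINT z|circle_measure. of_real (Re (a * z ^ k)) * z ^ m"
  have prod: "Re x * Re y = Re (x * y + x * cnj y) / 2" for x y by simp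
  have cont: "(\<lambda>z. z ^ k * z ^ l) \<in> borel_measurable (borel :: complex measure)"
    "(\<lambda>z. z ^ k * cnj z ^ l) \<in> borel_measurable (borel :: complex measure)" for k l
    by (intro borel_measurable_continuous_onI continuous_intros)+
  have int: "integrable circle_measure (\<lambda>z. z ^ k * z ^ l)" "integrable circle_measure (\<lambda>z. z ^ k * cnj z ^ l)" for k l
    by (rule circle_integrable[of _ 1, OF cont(1)], simp add: norm_mult norm_power)
       (rule circle_integrable[of _ 1, OF cont(2)], simp add: norm_mult norm_power)
  have orth: "(LINT z|circle_measure. z ^ k * z ^ l) = of_bool (k + l = 0)" for k l
    using circle_orthogonal[of "k + l" 0] by (simp add: power_add)
  have mean: "(LINT z|circle_measure. Re (a * z ^ k)) = Re (a * of_bool (k = 0))" for a k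
  proof -
    have "(LINT z|circle_measure. Re (a * z ^ k)) = Re (LINT z|circle_measure. a * (z ^ k * z ^ 0))"
      using int(1)[of k 0] by (subst integral_Re) (auto simp del: times_complex.sel)
    thus ?thesis using orth[of k 0] by (simp del: times_complex.sel)
  qed
  \<comment> \<open>For m > 0 only the conjugate half of the real part survives integration against
    z^m.\<close>
  have coeff: "?c a k m = cnj a / 2 * of_bool (k = m)" if "m > 0" for a k m
  proof -
    have "?c a k m
        = (LINT z|circle_measure. a / 2 * (z ^ k * z ^ m) + cnj a / 2 * (z ^ m * cnj z ^ k))"
    proof (rule Bochner_Integration.integral_cong[OF refl])
      fix z :: complex
      have "of_real (Re w) = (w + cnj w) / 2" for w by (simp add: complex_eq_iff)
      hence "of_real (Re (a * z ^ k)) * z ^ m = (a * z ^ k + cnj a * cnj z ^ k) / 2 * z ^ m"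
        by (simp only: complex_cnj_mult complex_cnj_power)
      thus "of_real (Re (a * z ^ k)) * z ^ m = a / 2 * (z ^ k * z ^ m) + cnj a / 2 * (z ^ m * cnj z ^ k)"
        by (simp add: field_simps del: times_complex.sel)
    qed
    also have "\<dots> = cnj a / 2 * of_bool (k = m)"
      using int that by (subst Bochner_Integration.integral_add) (auto simp: orth circle_orthogonal)
    finally show ?thesis .
  qed
  have gh: "(LINT z|circle_measure. Re (a * z ^ k) * Re (b * z ^ l)) = Re (a * b * of_bool (k + l = 0) + a * cnj b * of_bool (k = l)) / 2"
  proof -
    have "(LINT z|circle_measure. Re (a * z ^ k) * Re (b * z ^ l))
        = (LINT z|circle_measure. Re (a * b * (z ^ k * z ^ l) + a * cnj b * (z ^ k * cnj z ^ l)) / 2)"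
      by (rule Bochner_Integration.integral_cong[OF refl]) (simp add: prod mult_ac del: times_complex.sel)
    also have "\<dots> = Re (LINT z|circle_measure. a * b * (z ^ k * z ^ l) + a * cnj b * (z ^ k * cnj z ^ l)) / 2"
      using int by (subst integral_Re[symmetric]) (auto simp del: times_complex.sel)
    also have "(LINT z|circle_measure. a * b * (z ^ k * z ^ l) + a * cnj b * (z ^ k * cnj z ^ l))
        = a * b * of_bool (k + l = 0) + a * cnj b * of_bool (k = l)"
      using int by (subst Bochner_Integration.integral_add) (auto simp: orth circle_orthogonal)
    finally show ?thesis .
  qed
  have p0: "(LINT U|M. ptrace 0 U * ptrace 0 U) = of_nat N ^ 2" "(LINT U|M. ptrace 0 U * cnj (ptrace 0 U)) = of_nat N ^ 2"
  proof -
    have "(LINT U|M. ptrace 0 U * ptrace 0 U) = (LINT U|M. of_nat N ^ 2)"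
      "(LINT U|M. ptrace 0 U * cnj (ptrace 0 U)) = (LINT U|M. of_nat N ^ 2)"
      by (rule Bochner_Integration.integral_cong; simp add: ptrace_0 power2_eq_square)+
    thus "(LINT U|M. ptrace 0 U * ptrace 0 U) = of_nat N ^ 2" "(LINT U|M. ptrace 0 U * cnj (ptrace 0 U)) = of_nat N ^ 2"
      using prob_space by simp_all
  qed
  have "(LINT U|M. eig_sum (\<lambda>z. Re (a * z ^ k)) U * eig_sum (\<lambda>z. Re (b * z ^ l)) U)
      = (LINT U|M. Re (a * b * (ptrace k U * ptrace l U) + a * cnj b * (ptrace k U * cnj (ptrace l U))) / 2)"
    by (rule Bochner_Integration.integral_cong[OF refl]) (simp add: eig_sum_monomial prod mult_ac del: times_complex.sel)
  also have "\<dots> = Re (LINT U|M. a * b * (ptrace k U * ptrace l U) + a * cnj b * (ptrace k U * cnj (ptrace l U))) / 2"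
  proof -
    have "integrable M (\<lambda>U. a * b * (ptrace k U * ptrace l U) + a * cnj b * (ptrace k U * cnj (ptrace l U)))"
      by (intro integrable_bounded_rv bounded_rv_intros)
    thus ?thesis by (subst integral_Re[symmetric]) (auto simp del: times_complex.sel)
  qed
  also have "(LINT U|M. a * b * (ptrace k U * ptrace l U) + a * cnj b * (ptrace k U * cnj (ptrace l U)))
     = a * b * (LINT U|M. ptrace k U * ptrace l U) + a * cnj b * (LINT U|M. ptrace k U * cnj (ptrace l U))"
    by (subst Bochner_Integration.integral_add) (intro integrable_bounded_rv bounded_rv_intros | simp)+
  finally have lhs: "(LINT U|M. eig_sum (\<lambda>z. Re (a * z ^ k)) U * eig_sum (\<lambda>z. Re (b * z ^ l)) U)
     = Re (a * b * (LINT U|M. ptrace k U * ptrace l U) + a * cnj b * (LINT U|M. ptrace k U * cnj (ptrace l U))) / 2" .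
  have sum: "(\<Sum>m=1..<N. real (N - m) * Re (?c a k m * cnj (?c b l m)))
     = (if k = l \<and> k > 0 \<and> k < N then real (N - k) * Re (a * cnj b) / 4 else 0)"
  proof -
    have "(\<Sum>m=1..<N. real (N - m) * Re (?c a k m * cnj (?c b l m)))
       = (\<Sum>m=1..<N. if m = k then (if k = l then real (N - k) * Re (a * cnj b) / 4 else 0) else 0)"
    proof (intro sum.cong refl)
      fix m assume "m \<in> {1..<N}"
      hence "m > 0" by auto
      show "real (N - m) * Re (?c a k m * cnj (?c b l m))
         = (if m = k then (if k = l then real (N - k) * Re (a * cnj b) / 4 else 0) else 0)"
        unfolding coeff[OF \<open>m > 0\<close>] by auto
    qed
    also have "\<dots> = (if k = l \<and> k > 0 \<and> k < N then real (N - k) * Re (a * cnj b) / 4 else 0)"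
      by (subst sum.delta) auto
    finally show ?thesis .
  qed
  have rhs: "pair_form (\<lambda>z. Re (a * z ^ k)) (\<lambda>z. Re (b * z ^ l)) = (real N ^ 2 - real N) * Re (a * of_bool (k = 0)) * Re (b * of_bool (l = 0))
     + real N * (Re (a * b * of_bool (k + l = 0) + a * cnj b * of_bool (k = l)) / 2)
     - 2 * (if k = l \<and> k > 0 \<and> k < N then real (N - k) * Re (a * cnj b) / 4 else 0)"
    unfolding pair_form_def mean gh sum ..
  \<comment> \<open>Constants; different degrees, where both expectations vanish; equal positive
    degrees, where min k N is split into N minus the positive part of N - k.\<close>
  consider "k = 0" "l = 0" | "k \<noteq> l" | "k = l" "k > 0" by blast
  thus ?thesis
  proof cases
    case 1
    show ?thesis unfolding lhs rhs unfolding 1 p0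
      by (simp add: power2_eq_square algebra_simps of_nat_mult[symmetric] del: of_nat_mult)
  next
    case 2
    hence "k + l > 0" by auto
    thus ?thesis unfolding lhs rhs using 2 by (simp add: expectation_ptrace_mult expectation_ptrace_mult_cnj_neq)
  next
    case 3
    show ?thesis unfolding lhs rhs using 3 N
      by (cases "l < N") (simp_all add: expectation_ptrace_mult expectation_ptrace_mult_cnj min_def of_nat_diff field_simps)
  qed
qed

text \<open>Induction in one argument with the other fixed. Used twice, with the symmetry of
  \<open>pair_form\<close> in between, it leads from pairs of monomials to pairs of Borel
  symbols.\<close>

lemma pair_form_extend:
  assumes base: "\<And>a k. (LINT U|M. eig_sum (\<lambda>z. Re (a * z ^ k)) U * eig_sum h U) = pair_form (\<lambda>z. Re (a * z ^ k)) h"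
    and g: "bounded_borel g" and h: "bounded_borel h"
  shows "(LINT U|M. eig_sum g U * eig_sum h U) = pair_form g h"
  using g
proof (induction rule: circle_borel_induct)
  case (monomial a k)
  show ?case by (rule base)
next
  case (add g g')
  have "(LINT U|M. eig_sum (\<lambda>z. g z + g' z) U * eig_sum h U) = pair_form g h + pair_form g' h"
    using add integrable_eig_sum_mult h by (simp add: eig_sum_add distrib_right)
  also have "\<dots> = pair_form (\<lambda>z. g z + g' z) h"
    using add h bounded_borel_integrable bounded_borel_mult bounded_borel_mult_power_integrable
    by (simp add: pair_form_def distrib_right distrib_left sum.distrib)
  finally show ?case .
next
  case (scale c g)
  have "c * pair_form g h = pair_form (\<lambda>z. c * g z) h"
    by (simp add: pair_form_def mult.assoc right_diff_distrib distrib_left sum_distrib_left mult.left_commute del: times_complex.sel)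
       (simp add: algebra_simps sum_distrib_left sum_negf)
  thus ?case using scale by (simp add: eig_sum_scale mult.assoc)
next
  case (lim G g C)
  obtain D where D: "h \<in> borel_measurable borel" "\<And>z. norm z = 1 \<Longrightarrow> \<bar>h z\<bar> \<le> D"
    using h by (rule bounded_borelE) blast
  have m: "g \<in> borel_measurable borel" "G n \<in> borel_measurable borel" for n
    using lim by (auto simp: bounded_borel_def)
  have pm: "(\<lambda>z. z ^ m) \<in> borel_measurable (borel :: complex measure)" for m
    by (intro borel_measurable_continuous_onI continuous_intros)
  have "(\<lambda>n. LINT U|M. eig_sum (G n) U * eig_sum h U) \<longlonglongrightarrow> (LINT U|M. eig_sum g U * eig_sum h U)"
  proof (rule integral_dominated_convergence[where w = "\<lambda>_. real N * C * (real N * D)"])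
    show "AE U in M. norm (eig_sum (G n) U * eig_sum h U) \<le> real N * C * (real N * D)" for n
      by (rule AE_I2, rule abs_eig_sum_mult_le) (use lim D in auto)
  qed (use lim h measurable_eig_sum in \<open>auto intro!: tendsto_mult tendsto_eig_sum\<close>)
  moreover have "(\<lambda>n. pair_form (G n) h) \<longlonglongrightarrow> pair_form g h"
    unfolding pair_form_def
  proof (intro tendsto_intros)
    show "(\<lambda>n. LINT z|circle_measure. G n z) \<longlonglongrightarrow> (LINT z|circle_measure. g z)"
      by (rule circle_dominated_convergence[of _ _ C]) (use lim m in auto)
    show "(\<lambda>n. LINT z|circle_measure. G n z * h z) \<longlonglongrightarrow> (LINT z|circle_measure. g z * h z)"
    proof (rule circle_dominated_convergence[of _ _ "C * D"])
      show "norm (G n z * h z) \<le> C * D" if z: "norm z = 1" for n z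
        unfolding real_norm_def abs_mult using lim(4)[OF z, of n] D(2)[OF z]
        by (intro mult_mono) auto
    qed (use lim m D in \<open>auto intro!: tendsto_intros\<close>)
    show "(\<lambda>n. LINT z|circle_measure. of_real (G n z) * z ^ m) \<longlonglongrightarrow> (LINT z|circle_measure. of_real (g z) * z ^ m)" for m
      by (rule circle_dominated_convergence[of _ _ C])
         (use lim m pm in \<open>auto simp: norm_mult norm_power intro!: tendsto_intros\<close>)
  qed
  ultimately show ?case unfolding lim(1) by (rule LIMSEQ_unique)
qed

lemma expectation_eig_sum_mult:
  assumes N: "N > 0" and g: "bounded_borel g" and h: "bounded_borel h"
  shows "(LINT U|M. eig_sum g U * eig_sum h U) = pair_form g h"
proof (rule pair_form_extend[OF _ g h])
  fix a k
  have "(LINT U|M. eig_sum h U * eig_sum (\<lambda>z. Re (a * z ^ k)) U) = pair_form h (\<lambda>z. Re (a * z ^ k))"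
    by (rule pair_form_extend[OF pair_form_monomial[OF N] h bounded_borel_monomial])
  thus "(LINT U|M. eig_sum (\<lambda>z. Re (a * z ^ k)) U * eig_sum h U) = pair_form (\<lambda>z. Re (a * z ^ k)) h"
    by (simp only: pair_form_commute mult.commute)
qed

text \<open>The squared mean cancels the N^2 term of \<open>pair_form\<close>; what is left of the
  means is the m = 0 term of the sum over |m| < N.\<close>

theorem variance_eig_sum:
  assumes N: "N > 0" and g: "bounded_borel g"
  shows "(LINT U|M. (eig_sum g U - (LINT V|M. eig_sum g V))\<^sup>2)
       = real N * (LINT z|circle_measure. (g z)\<^sup>2) - real N * (LINT z|circle_measure. g z)\<^sup>2
         - 2 * (\<Sum>m=1..<N. real (N - m) * (norm (LINT z|circle_measure. of_real (g z) * z ^ m))\<^sup>2)"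
proof -
  define e where "e = (LINT V|M. eig_sum g V)"
  have e: "e = real N * (LINT z|circle_measure. g z)"
    unfolding e_def by (rule expectation_eig_sum[OF N g])
  have "(LINT U|M. (eig_sum g U - e)\<^sup>2) = (LINT U|M. eig_sum g U * eig_sum g U - 2 * e * eig_sum g U + e\<^sup>2)"
    by (simp add: power2_eq_square algebra_simps)
  also have "\<dots> = pair_form g g - 2 * e * e + e\<^sup>2"
    using integrable_eig_sum[OF g] integrable_eig_sum_mult[OF g g] prob_space
    by (simp add: e_def[symmetric] expectation_eig_sum_mult[OF N g g])
  also have "\<dots> = pair_form g g - real N ^ 2 * (LINT z|circle_measure. g z)\<^sup>2"
    by (simp add: e power2_eq_square algebra_simps)
  also have "\<dots> = real N * (LINT z|circle_measure. (g z)\<^sup>2) - real N * (LINT z|circle_measure. g z)\<^sup>2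
         - 2 * (\<Sum>m=1..<N. real (N - m) * (norm (LINT z|circle_measure. of_real (g z) * z ^ m))\<^sup>2)"
    unfolding pair_form_def complex_norm_square[symmetric] Re_complex_of_real
    by (simp add: power2_eq_square algebra_simps complex_norm_square[symmetric])
  finally show ?thesis by (simp add: e_def)
qed

end

section \<open>Plancherel identity\<close>

definition decay :: "real \<Rightarrow> real \<Rightarrow> real" where
  "decay s x = (1 + \<bar>x\<bar>) powr (- s)"

lemma decay_nonneg [simp]: "decay s x \<ge> 0"
  by (simp add: decay_def)

lemma decay_le_1: "s > 0 \<Longrightarrow> decay s x \<le> 1"
  unfolding decay_def using powr_mono2'[of "-s" 1 "1 + \<bar>x\<bar>"] by simp

lemma measurable_decay [measurable]: "decay s \<in> borel_measurable borel"
  unfolding decay_def[abs_def] by measurable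

lemma integrable_decay:
  assumes s: "s > 1"
  shows "integrable lborel (decay s)"
proof -
  define h where "h x = (1 + \<bar>x\<bar>) powr (- s) * indicator {0..} x" for x :: real
  have "(\<integral>\<^sup>+x. ennreal ((1 + \<bar>x\<bar>) powr (- s)) * indicator {0..} x \<partial>lborel) = ennreal (0 - - ((1 + 0) powr (1 - s) / (s - 1)))"
  proof (rule nn_integral_FTC_atLeast[where F = "\<lambda>x. - ((1 + x) powr (1 - s) / (s - 1))"])
    show "((\<lambda>x. - ((1 + x) powr (1 - s) / (s - 1))) has_real_derivative (1 + \<bar>x\<bar>) powr (- s)) (at x)" if "0 \<le> x" for x
    proof -
      have "((\<lambda>x. (1 + x) powr (1 - s)) has_real_derivative (1 - s) * (1 + x) powr (1 - s - 1)) (at x)"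
        using that by (auto intro!: derivative_eq_intros)
      from DERIV_minus[OF DERIV_cdivide[OF this, of "s - 1"]]
      have "((\<lambda>x. - ((1 + x) powr (1 - s) / (s - 1))) has_real_derivative - ((1 - s) / (s - 1)) * (1 + x) powr (- s)) (at x)"
        by simp
      also have "(1 - s) / (s - 1) = - 1" using s by (simp add: field_simps)
      finally show ?thesis using that by simp
    qed
    have "((\<lambda>x. (1 + x) powr (1 - s)) \<longlongrightarrow> 0) at_top"
      using s by (intro tendsto_neg_powr filterlim_tendsto_add_at_top[OF tendsto_const filterlim_ident]) auto
    from tendsto_minus[OF tendsto_divide[OF this tendsto_const[of "s - 1"]]]
    show "((\<lambda>x. - ((1 + x) powr (1 - s) / (s - 1))) \<longlongrightarrow> 0) at_top" using s by simp
  qed auto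
  hence "(\<integral>\<^sup>+x. ennreal (h x) \<partial>lborel) = ennreal (1 / (s - 1))"
    by (simp add: h_def ennreal_mult'' ennreal_indicator)
  moreover have hm [measurable]: "h \<in> borel_measurable borel" unfolding h_def[abs_def] by measurable
  moreover have "h x \<ge> 0" for x by (simp add: h_def)
  ultimately have h: "integrable lborel h"
    using s by (intro integrableI_nn_integral_finite[of _ _ "1 / (s - 1)"]) auto
  hence h': "integrable lborel (\<lambda>x. h (- x))"
    using lborel_integrable_real_affine[of h "-1" 0] by simp
  show ?thesis
    by (rule Bochner_Integration.integrable_bound[OF Bochner_Integration.integrable_add[OF h h']])
       (auto simp: decay_def h_def indicator_def)
qed

text \<open>1 + |x + z| is at least (1 + |x|)/2 when |z| <= 1; this is the origin of the factor
  2^s.\<close>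

lemma decay_shift:
  assumes s: "s > 0" and z: "\<bar>z\<bar> \<le> 1"
  shows "decay s (x + z) \<le> 2 powr s * decay s x"
proof -
  have "(1 + \<bar>x + z\<bar>) powr (- s) \<le> ((1 + \<bar>x\<bar>) / 2) powr (- s)"
  proof (rule powr_mono2')
    have "\<bar>x\<bar> \<le> \<bar>x + z\<bar> + \<bar>z\<bar>" using abs_triangle_ineq4[of "x + z" z] by simp
    moreover have "a \<le> t + w \<Longrightarrow> w \<le> 1 \<Longrightarrow> 0 \<le> t \<Longrightarrow> (1 + a) / 2 \<le> 1 + t" for a t w :: real by simp
    ultimately show "(1 + \<bar>x\<bar>) / 2 \<le> 1 + \<bar>x + z\<bar>" using z abs_ge_zero by blast
  qed (use s in auto)
  also have "\<dots> = 2 powr s * decay s x"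
    by (simp add: decay_def powr_divide powr_minus field_simps)
  finally show ?thesis by (simp add: decay_def)
qed

locale decaying_function =
  fixes f :: "real \<Rightarrow> real" and A s :: real
  assumes borel_f [measurable]: "f \<in> borel_measurable borel"
    and s: "s > 1" and bound: "\<And>x. \<bar>f x\<bar> \<le> A * decay s x"
begin

lemma A_nonneg: "A \<ge> 0"
  using bound[of 0] by (simp add: decay_def)

lemma abs_f_le: "\<bar>f x\<bar> \<le> A"
  using mult_left_mono[OF decay_le_1[of s x] A_nonneg] bound[of x] s by simp

lemma integrable_f: "integrable lborel f"
  by (rule Bochner_Integration.integrable_bound[OF integrable_mult_right[OF integrable_decay[OF s], of A]])
     (use bound A_nonneg in \<open>auto simp: abs_mult\<close>)

text \<open>The frequency has the opposite sign to that in \<^const>\<open>fourier\<close>; for even \<open>f\<close> this makes no difference.\<close>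
definition ft :: "real \<Rightarrow> complex" where
  "ft u = (LINT x|lborel. of_real (f x) * cis (2 * pi * u * x))"

lemma norm_cis_mult: "norm (of_real a * cis b) = \<bar>a\<bar>"
  by (simp add: norm_mult)

text \<open>Its Fourier transform is |ft|^2 and its value at 0 is the integral of f^2, so the
  Plancherel identity becomes Fourier inversion of \<open>autocorr\<close> at 0.\<close>

definition autocorr :: "real \<Rightarrow> real" where
  "autocorr z = (LINT y|lborel. f y * f (y + z))"

lemma integrable_autocorr: "integrable lborel (\<lambda>y. f y * f (y + z))"
proof (rule Bochner_Integration.integrable_bound[OF integrable_mult_right[OF integrable_f, of A]])
  have "\<bar>f x\<bar> * \<bar>f (x + z)\<bar> \<le> \<bar>f x\<bar> * A" for x
    by (intro mult_left_mono abs_f_le) auto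
  thus "AE x in lborel. norm (f x * f (x + z)) \<le> norm (A * f x)"
    using A_nonneg by (auto simp: abs_mult mult.commute)
qed auto

lemma abs_autocorr_le: "\<bar>autocorr z\<bar> \<le> A * (LINT x|lborel. \<bar>f x\<bar>)"
proof -
  have "\<bar>autocorr z\<bar> \<le> (LINT y|lborel. \<bar>f y * f (y + z)\<bar>)"
    unfolding autocorr_def by (rule integral_abs_bound)
  also have "\<dots> \<le> (LINT y|lborel. A * \<bar>f y\<bar>)"
  proof (rule integral_mono)
    show "integrable lborel (\<lambda>y. \<bar>f y * f (y + z)\<bar>)" using integrable_autocorr by (rule integrable_abs)
    show "integrable lborel (\<lambda>y. A * \<bar>f y\<bar>)" by (intro integrable_mult_right integrable_abs integrable_f)
    show "\<bar>f y * f (y + z)\<bar> \<le> A * \<bar>f y\<bar>" for y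
      using mult_left_mono[OF abs_f_le[of "y + z"], of "\<bar>f y\<bar>"] by (simp add: abs_mult mult.commute)
  qed
  finally show ?thesis by simp
qed

text \<open>The translates are controlled by approximating \<open>f\<close> almost everywhere by continuous functions.\<close>
lemma tendsto_autocorr:
  assumes z0: "z \<longlonglongrightarrow> 0" and z1: "\<And>n. \<bar>z n\<bar> \<le> 1"
  shows "(\<lambda>n. autocorr (z n)) \<longlonglongrightarrow> autocorr 0"
proof -
  have "f measurable_on UNIV"
    by (rule lebesgue_measurable_imp_measurable_on) (auto intro: measurable_completion)
  then obtain S h where S: "negligible S" and h: "\<And>n. continuous_on UNIV (h n)"
    and hf: "\<And>x. x \<notin> S \<Longrightarrow> (\<lambda>n. h n x) \<longlonglongrightarrow> f x"
    unfolding measurable_on_def by auto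
  \<comment> \<open>Clamping to [-A, A] keeps continuity and, since |f| <= A, also the convergence,
    and it adds a uniform bound.\<close>
  define g where "g n x = max (- A) (min A (h n x))" for n :: nat and x
  have g: "continuous_on UNIV (g n)" for n unfolding g_def by (intro continuous_intros h)
  have gm [measurable]: "g n \<in> borel_measurable borel" for n by (intro borel_measurable_continuous_onI g)
  have gA: "\<bar>g n x\<bar> \<le> A" for n x using A_nonneg by (auto simp: g_def)
  have gf: "(\<lambda>n. g n x) \<longlonglongrightarrow> f x" if "x \<notin> S" for x
  proof -
    have "(\<lambda>n. g n x) \<longlonglongrightarrow> max (- A) (min A (f x))"
      unfolding g_def by (intro tendsto_intros hf that)
    moreover have "max (- A) (min A (f x)) = f x" using abs_f_le[of x] by auto
    ultimately show ?thesis by simp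
  qed
  define K where "K = A * 2 powr s"
  have K: "K \<ge> 0" using A_nonneg by (simp add: K_def)
  have fK: "\<bar>f (x + t)\<bar> \<le> K * decay s x" if "\<bar>t\<bar> \<le> 1" for x t
  proof -
    have "A * decay s (x + t) \<le> A * (2 powr s * decay s x)"
      using decay_shift[OF _ that, of s x] s A_nonneg by (intro mult_left_mono) auto
    thus ?thesis using bound[of "x + t"] by (simp add: K_def mult.assoc)
  qed
  \<comment> \<open>The weight \<open>K * decay s x\<close> dominates every translate of f by at
    most 1, so \<open>e n\<close> bounds the approximation error uniformly in the shift.\<close>
  define e where "e n = (LINT x|lborel. K * decay s x * \<bar>f x - g n x\<bar>)" for n
  have fg2: "\<bar>f x - g n x\<bar> \<le> 2 * A" for x n using abs_f_le[of x] gA[of n x] by linarith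
  have le2: "K * decay s x * \<bar>f x - g n x\<bar> \<le> 2 * A * K * decay s x" for x n
    using mult_left_mono[OF fg2[of x n], of "K * decay s x"] K by (simp add: mult_ac)
  have dom: "integrable lborel (\<lambda>x. 2 * A * K * decay s x)"
    by (intro integrable_mult_right integrable_decay s)
  have int_e: "integrable lborel (\<lambda>x. K * decay s x * \<bar>f x - g n x\<bar>)" for n
    by (rule Bochner_Integration.integrable_bound[OF dom]) (use le2 K A_nonneg in \<open>auto simp: abs_mult\<close>)
  have e: "e \<longlonglongrightarrow> 0"
  proof -
    have "(\<lambda>n. LINT x|lborel. K * decay s x * \<bar>f x - g n x\<bar>) \<longlonglongrightarrow> (LINT x|(lborel::real measure). (0::real))"
    proof (rule integral_dominated_convergence[OF _ _ dom])
      have "S \<in> null_sets lebesgue" using S by (simp add: negligible_iff_null_sets)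
      then obtain S' where S': "S \<subseteq> S'" "S' \<in> null_sets lborel" unfolding null_sets_completion_iff2 by blast
      have "AE x in lborel. x \<notin> S'" by (rule AE_not_in[OF S'(2)])
      thus "AE x in lborel. (\<lambda>n. K * decay s x * \<bar>f x - g n x\<bar>) \<longlonglongrightarrow> 0"
      proof eventually_elim
        case (elim x)
        hence "(\<lambda>n. g n x) \<longlonglongrightarrow> f x" using S' by (intro gf) auto
        hence "(\<lambda>n. K * decay s x * \<bar>f x - g n x\<bar>) \<longlonglongrightarrow> K * decay s x * \<bar>f x - f x\<bar>"
          by (intro tendsto_intros)
        thus ?case by simp
      qed
    qed (use le2 K in \<open>auto simp: abs_mult\<close>)
    thus ?thesis by (simp add: e_def[abs_def])
  qed
  have int_fg: "integrable lborel (\<lambda>y. f y * g k (y + t))" for k t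
  proof (rule Bochner_Integration.integrable_bound[OF integrable_mult_right[OF integrable_f, of A]])
    have "\<bar>f x\<bar> * \<bar>g k (x + t)\<bar> \<le> \<bar>f x\<bar> * A" for x by (intro mult_left_mono gA) auto
    thus "AE x in lborel. norm (f x * g k (x + t)) \<le> norm (A * f x)"
      using A_nonneg by (auto simp: abs_mult mult.commute)
  qed auto
  have approx: "\<bar>autocorr t - (LINT y|lborel. f y * g k (y + t))\<bar> \<le> e k" if t: "\<bar>t\<bar> \<le> 1" for t k
  proof -
    have "autocorr t - (LINT y|lborel. f y * g k (y + t)) = (LINT y|lborel. f y * (f (y + t) - g k (y + t)))"
      unfolding autocorr_def using integrable_autocorr int_fg
      by (subst Bochner_Integration.integral_diff[symmetric]) (auto simp: right_diff_distrib)
    \<comment> \<open>The substitution moves the shift from the difference f - g k to the factor f,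
      where the weight absorbs it.\<close>
    also have "\<dots> = (LINT x|lborel. f (x - t) * (f x - g k x))"
      by (subst lborel_integral_real_affine[of 1 _ "- t"]) (auto simp: algebra_simps)
    also have "\<bar>\<dots>\<bar> \<le> (LINT x|lborel. \<bar>f (x - t) * (f x - g k x)\<bar>)"
      by (rule integral_abs_bound)
    also have "\<dots> \<le> e k" unfolding e_def
    proof (rule integral_mono[OF _ int_e])
      show le: "\<bar>f (x - t) * (f x - g k x)\<bar> \<le> K * decay s x * \<bar>f x - g k x\<bar>" for x
        unfolding abs_mult using fK[of "- t" x] t by (intro mult_right_mono) auto
      show "integrable lborel (\<lambda>x. \<bar>f (x - t) * (f x - g k x)\<bar>)"
        by (rule Bochner_Integration.integrable_bound[OF int_e[of k]]) (use le K in \<open>auto simp: abs_mult\<close>)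
    qed
    finally show ?thesis .
  qed
  show ?thesis
  proof (rule LIMSEQ_I)
    fix r :: real assume "r > 0"
    hence r3: "r / 3 > 0" by simp
    obtain k where "norm (e k - 0) < r / 3"
      using LIMSEQ_D[OF e r3] by blast
    hence k: "e k < r / 3" by simp
    have "(\<lambda>n. LINT y|lborel. f y * g k (y + z n)) \<longlonglongrightarrow> (LINT y|lborel. f y * g k (y + 0))"
    proof (rule integral_dominated_convergence[where w = "\<lambda>x. A * \<bar>f x\<bar>"])
      show "integrable lborel (\<lambda>x. A * \<bar>f x\<bar>)" by (intro integrable_mult_right integrable_abs integrable_f)
      have "\<bar>f x\<bar> * \<bar>g k (x + z n)\<bar> \<le> \<bar>f x\<bar> * A" for x n by (intro mult_left_mono gA) auto
      thus "AE x in lborel. norm (f x * g k (x + z n)) \<le> A * \<bar>f x\<bar>" for n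
        by (auto simp: abs_mult mult.commute)
      have "(\<lambda>n. g k (x + z n)) \<longlonglongrightarrow> g k (x + 0)" for x
      proof (rule isCont_tendsto_compose[of _ "g k"])
        show "isCont (g k) (x + 0)" using g by (simp add: continuous_on_eq_continuous_at)
      qed (intro tendsto_add tendsto_const z0)
      thus "AE x in lborel. (\<lambda>n. f x * g k (x + z n)) \<longlonglongrightarrow> f x * g k (x + 0)"
        by (intro AE_I2 tendsto_mult tendsto_const)
    qed auto
    from LIMSEQ_D[OF this r3] obtain n0 where n0:
      "\<And>n. n \<ge> n0 \<Longrightarrow> \<bar>(LINT y|lborel. f y * g k (y + z n)) - (LINT y|lborel. f y * g k (y + 0))\<bar> < r / 3"
      by auto
    show "\<exists>no. \<forall>n\<ge>no. norm (autocorr (z n) - autocorr 0) < r"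
    proof (intro exI[of _ n0] allI impI)
      fix n assume "n \<ge> n0"
      from n0[OF this] approx[OF z1[of n], of k] approx[of 0 k] k
      show "norm (autocorr (z n) - autocorr 0) < r" by (simp add: abs_if split: if_splits)
    qed
  qed
qed

text \<open>Integrating the modulus over z first gives |f y| times the L^1 norm of f, which is
  integrable in y.\<close>

lemma autocorr_Fubini:
  "integrable (lborel \<Otimes>\<^sub>M lborel) (\<lambda>(y, z). of_real (f y * f (y + z)) * cis (2 * pi * u * z))"
proof (rule lborel_pair.Fubini_integrable)
  have [measurable]: "f \<in> borel_measurable lborel" by simp
  show "(\<lambda>(y, z). of_real (f y * f (y + z)) * cis (2 * pi * u * z)) \<in> borel_measurable (lborel \<Otimes>\<^sub>M lborel)"
    by measurable
  have "(LINT z|lborel. norm (case (y, z) of (y, z) \<Rightarrow> of_real (f y * f (y + z)) * cis (2 * pi * u * z))) = \<bar>f y\<bar> * (LINT z|lborel. \<bar>f z\<bar>)" for y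
    using lborel_integral_real_affine[of 1 "\<lambda>x. \<bar>f x\<bar>" y]
    by (simp add: norm_mult)
  thus "integrable lborel (\<lambda>y. LINT z|lborel. norm (case (y, z) of (y, z) \<Rightarrow> of_real (f y * f (y + z)) * cis (2 * pi * u * z)))"
    by (simp only:) (intro integrable_mult_left integrable_abs integrable_f)
  show "AE y in lborel. integrable lborel (\<lambda>z. case (y, z) of (y, z) \<Rightarrow> of_real (f y * f (y + z)) * cis (2 * pi * u * z))"
  proof (rule AE_I2)
    fix y
    have "integrable lborel (\<lambda>z. f (y + 1 * z))" by (rule lborel_integrable_real_affine[OF integrable_f]) simp
    hence "integrable lborel (\<lambda>z. f y * f (y + z))" by simp
    thus "integrable lborel (\<lambda>z. case (y, z) of (y, z) \<Rightarrow> of_real (f y * f (y + z)) * cis (2 * pi * u * z))"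
      by (rule Bochner_Integration.integrable_bound) (auto simp: norm_mult)
  qed
qed

lemma integrable_autocorr': "integrable lborel autocorr"
proof -
  have "integrable lborel (\<lambda>z. LINT y|lborel. of_real (f y * f (y + z)) * cis (2 * pi * 0 * z))"
    using lborel_pair.integrable_snd[OF autocorr_Fubini[of 0]] by simp
  hence "integrable lborel (\<lambda>z. complex_of_real (autocorr z))" by (simp add: autocorr_def del: of_real_mult)
  thus ?thesis using complex_of_real_integrable_eq by blast
qed

lemma measurable_autocorr [measurable]: "autocorr \<in> borel_measurable borel"
  using borel_measurable_integrable[OF integrable_autocorr'] by simp

text \<open>The phase of z is the phase of y + z times the conjugate phase of y, so Fubini and a
  translation in z split the double integral into \<open>ft u\<close> and its conjugate.\<close>

lemma ft_mult_cnj: "ft u * cnj (ft u) = (LINT z|lborel. of_real (autocorr z) * cis (2 * pi * u * z))"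
proof -
  have "(LINT z|lborel. of_real (autocorr z) * cis (2 * pi * u * z))
      = (LINT z|lborel. LINT y|lborel. of_real (f y * f (y + z)) * cis (2 * pi * u * z))"
    by (simp add: autocorr_def flip: integral_complex_of_real)
  also have "\<dots> = (LINT y|lborel. LINT z|lborel. of_real (f y * f (y + z)) * cis (2 * pi * u * z))"
    by (rule lborel_pair.Fubini_integral) (use autocorr_Fubini in simp)
  also have "\<dots> = (LINT y|lborel. cnj (of_real (f y) * cis (2 * pi * u * y)) * ft u)"
  proof (rule Bochner_Integration.integral_cong[OF refl])
    fix y
    have "ft u = (LINT z|lborel. of_real (f (y + 1 * z)) * cis (2 * pi * u * (y + 1 * z)))"
      unfolding ft_def by (subst lborel_integral_real_affine[of 1 _ y]) auto
    hence "cnj (of_real (f y) * cis (2 * pi * u * y)) * ft u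
       = (LINT z|lborel. cnj (of_real (f y) * cis (2 * pi * u * y)) * (of_real (f (y + z)) * cis (2 * pi * u * (y + z))))"
      by simp
    also have "\<dots> = (LINT z|lborel. of_real (f y * f (y + z)) * cis (2 * pi * u * z))"
    proof (rule Bochner_Integration.integral_cong[OF refl])
      fix z
      have "cis (- (2 * pi * u * y)) * cis (2 * pi * u * (y + z)) = cis (2 * pi * u * z)"
        by (simp add: cis_mult algebra_simps)
      thus "cnj (of_real (f y) * cis (2 * pi * u * y)) * (of_real (f (y + z)) * cis (2 * pi * u * (y + z)))
         = of_real (f y * f (y + z)) * cis (2 * pi * u * z)"
        by (simp add: cis_cnj mult_ac)
    qed
    finally show "(LINT z|lborel. of_real (f y * f (y + z)) * cis (2 * pi * u * z)) = cnj (of_real (f y) * cis (2 * pi * u * y)) * ft u" ..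
  qed
  also have "\<dots> = cnj (ft u) * ft u"
    unfolding integral_mult_left_zero Bochner_Integration.integral_cnj ft_def[symmetric] ..
  finally show ?thesis by (simp add: mult.commute)
qed

lemma measurable_ft [measurable]: "ft \<in> borel_measurable borel"
proof -
  have [measurable]: "f \<in> borel_measurable lborel" by simp
  have "(\<lambda>u. LINT x|lborel. of_real (f x) * cis (2 * pi * u * x)) \<in> borel_measurable borel"
    by measurable
  thus ?thesis by (simp add: ft_def[abs_def])
qed

text \<open>The Gaussian weight gives absolute convergence. Integrating out the frequency v = u/c
  first produces the characteristic function of the standard normal law, hence a Gaussian in z which
  concentrates at 0 as c grows.\<close>

lemma gaussian_ft:
  assumes c: "c > 0"
  shows "integrable lborel (\<lambda>u. exp (- (u / c)\<^sup>2 / 2) * (norm (ft u))\<^sup>2)" (is ?I)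
    and "(LINT u|lborel. exp (- (u / c)\<^sup>2 / 2) * (norm (ft u))\<^sup>2)
       = (LINT x|lborel. std_normal_density x * autocorr (x / (2 * pi * c)))" (is ?E)
proof -
  define D where "D = std_normal_distribution"
  interpret D: real_distribution D unfolding D_def by (rule real_dist_normal_dist)
  interpret DL: pair_sigma_finite D lborel ..
  have [measurable]: "autocorr \<in> borel_measurable lborel" by simp
  let ?k = "\<lambda>v z. complex_of_real (autocorr z) * cis (2 * pi * (c * v) * z)"
  have "integrable (D \<Otimes>\<^sub>M lborel) (\<lambda>(v, z). ?k v z)"
  proof (rule DL.Fubini_integrable)
    show "(\<lambda>(v, z). ?k v z) \<in> borel_measurable (D \<Otimes>\<^sub>M lborel)" by measurable
    show "AE v in D. integrable lborel (\<lambda>z. case (v, z) of (v, z) \<Rightarrow> ?k v z)"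
      by (rule AE_I2, rule Bochner_Integration.integrable_bound[OF integrable_autocorr']) (auto simp: norm_mult)
  qed (simp add: norm_mult)
  hence "(LINT v|D. LINT z|lborel. ?k v z) = (LINT z|lborel. LINT v|D. ?k v z)"
    by (rule DL.Fubini_integral[symmetric])
  also have "(LINT v|D. LINT z|lborel. ?k v z) = of_real (LINT v|D. (norm (ft (c * v)))\<^sup>2)"
    by (simp add: ft_mult_cnj[symmetric] complex_norm_square[symmetric] flip: of_real_power)
  also have "(LINT z|lborel. LINT v|D. ?k v z) = (LINT z|lborel. of_real (autocorr z * exp (- (2 * pi * c * z)\<^sup>2 / 2)))"
  proof (rule Bochner_Integration.integral_cong[OF refl])
    fix z
    have "(LINT v|D. ?k v z) = of_real (autocorr z) * (LINT v|D. iexp (2 * pi * c * z * v))"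
      by (simp add: cis_conv_exp mult_ac)
    also have "(LINT v|D. iexp (2 * pi * c * z * v)) = char D (2 * pi * c * z)"
      by (simp add: char_def)
    also have "\<dots> = of_real (exp (- (2 * pi * c * z)\<^sup>2 / 2))"
      unfolding D_def char_std_normal_distribution ..
    finally show "(LINT v|D. ?k v z) = of_real (autocorr z * exp (- (2 * pi * c * z)\<^sup>2 / 2))" by simp
  qed
  finally have eq: "(LINT v|D. (norm (ft (c * v)))\<^sup>2) = (LINT z|lborel. autocorr z * exp (- (2 * pi * c * z)\<^sup>2 / 2))"
    unfolding integral_complex_of_real of_real_eq_iff .
  have nD: "std_normal_density x = exp (- x\<^sup>2 / 2) / sqrt (2 * pi)" for x
    by (simp add: std_normal_density_def)
  have "(LINT u|lborel. exp (- (u / c)\<^sup>2 / 2) * (norm (ft u))\<^sup>2)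
      = c * (LINT v|lborel. exp (- v\<^sup>2 / 2) * (norm (ft (c * v)))\<^sup>2)"
    using c by (subst lborel_integral_real_affine[of c _ 0]) auto
  also have "\<dots> = c * sqrt (2 * pi) * (LINT v|lborel. std_normal_density v * (norm (ft (c * v)))\<^sup>2)"
    by (simp add: nD)
  also have "(LINT v|lborel. std_normal_density v * (norm (ft (c * v)))\<^sup>2) = (LINT v|D. (norm (ft (c * v)))\<^sup>2)"
    unfolding D_def by (subst integral_density) auto
  also have "c * sqrt (2 * pi) * \<dots> = 2 * pi * c * (LINT z|lborel. std_normal_density (2 * pi * c * z) * autocorr z)"
    unfolding eq nD by (simp add: field_simps real_sqrt_mult[symmetric])
  also have "\<dots> = (LINT x|lborel. std_normal_density x * autocorr (x / (2 * pi * c)))"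
    using c by (subst lborel_integral_real_affine[of "2 * pi * c" _ 0]) auto
  finally show ?E .
  have L: "norm (ft u) \<le> (LINT x|lborel. \<bar>f x\<bar>)" for u
    unfolding ft_def by (rule order_trans[OF integral_norm_bound]) (simp add: norm_mult)
  have "integrable lborel (\<lambda>u. exp (- (u / c)\<^sup>2 / 2))"
    using integrable_mult_right[OF lborel_integrable_real_affine[of std_normal_density "1 / c" 0], of "sqrt (2 * pi)"] c
    by (simp add: nD)
  hence int: "integrable lborel (\<lambda>u. exp (- (u / c)\<^sup>2 / 2) * (LINT x|lborel. \<bar>f x\<bar>)\<^sup>2)"
    by (rule integrable_mult_left)
  show ?I
    by (rule Bochner_Integration.integrable_bound[OF int])
       (use L in \<open>auto simp: abs_mult intro!: mult_left_mono power_mono\<close>)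
qed

text \<open>The width c of the Gaussian tends to infinity. On the left, monotone convergence also
  yields the integrability of |ft|^2, which is not known beforehand; on the right, boundedness of
  \<open>autocorr\<close> and its continuity at 0 give the limit.\<close>

theorem Plancherel:
  "integrable lborel (\<lambda>u. (norm (ft u))\<^sup>2)"
  "(LINT u|lborel. (norm (ft u))\<^sup>2) = (LINT x|lborel. (f x)\<^sup>2)"
proof -
  define c where "c n = real (Suc n)" for n
  have c: "c n > 0" for n by (simp add: c_def)
  let ?u = "\<lambda>n u. exp (- (u / c n)\<^sup>2 / 2) * (norm (ft u))\<^sup>2"
  have mono: "AE u in lborel. mono (\<lambda>n. ?u n u)"
  proof (intro AE_I2 monoI mult_right_mono)
    fix u and m n :: nat assume "m \<le> n"
    hence "(u / c n)\<^sup>2 \<le> (u / c m)\<^sup>2"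
      unfolding power_divide by (intro divide_left_mono power_mono) (auto simp: c_def)
    thus "exp (- (u / c m)\<^sup>2 / 2) \<le> exp (- (u / c n)\<^sup>2 / 2)" by simp
  qed auto
  have c_lim: "(\<lambda>n. a / c n) \<longlonglongrightarrow> 0" for a
    using tendsto_mult[OF tendsto_const[of a] LIMSEQ_Suc[OF lim_1_over_n]] by (simp add: c_def)
  have lim: "AE u in lborel. (\<lambda>n. ?u n u) \<longlonglongrightarrow> (norm (ft u))\<^sup>2"
  proof (rule AE_I2)
    fix u
    have "(\<lambda>n. ?u n u) \<longlonglongrightarrow> exp (- 0\<^sup>2 / 2) * (norm (ft u))\<^sup>2"
      by (intro tendsto_intros c_lim) auto
    thus "(\<lambda>n. ?u n u) \<longlonglongrightarrow> (norm (ft u))\<^sup>2" by simp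
  qed
  have sq: "autocorr 0 = (LINT x|lborel. (f x)\<^sup>2)" by (simp add: autocorr_def power2_eq_square)
  have "(\<lambda>n. LINT x|lborel. std_normal_density x * autocorr (x / (2 * pi * c n))) \<longlonglongrightarrow> (LINT x|lborel. std_normal_density x * autocorr 0)"
  proof (rule integral_dominated_convergence[where w = "\<lambda>x. std_normal_density x * (A * (LINT x|lborel. \<bar>f x\<bar>))"])
    show "integrable lborel (\<lambda>x. std_normal_density x * (A * (LINT x|lborel. \<bar>f x\<bar>)))"
      by (intro integrable_mult_left integrable_normal_density) auto
    show "AE x in lborel. norm (std_normal_density x * autocorr (x / (2 * pi * c n))) \<le> std_normal_density x * (A * (LINT x|lborel. \<bar>f x\<bar>))" for n
      using abs_autocorr_le by (auto simp: abs_mult intro!: mult_left_mono)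
    show "AE x in lborel. (\<lambda>n. std_normal_density x * autocorr (x / (2 * pi * c n))) \<longlonglongrightarrow> std_normal_density x * autocorr 0"
    proof (intro AE_I2 tendsto_mult tendsto_const)
      fix x :: real
      define z where "z n = x / (2 * pi * c n)" for n
      have z: "z \<longlonglongrightarrow> 0" using c_lim[of "x / (2 * pi)"] by (simp add: z_def[abs_def])
      \<comment> \<open>\<open>tendsto_autocorr\<close> asks for shifts of size at most 1 for all n;
        the truncation changes only finitely many of them.\<close>
      define z' where "z' n = max (-1) (min 1 (z n))" for n
      have "z' \<longlonglongrightarrow> max (-1) (min 1 0)" unfolding z'_def[abs_def] by (intro tendsto_intros z)
      hence "z' \<longlonglongrightarrow> 0" by simp
      hence "(\<lambda>n. autocorr (z' n)) \<longlonglongrightarrow> autocorr 0"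
        by (rule tendsto_autocorr) (auto simp: z'_def)
      moreover have "\<forall>\<^sub>F n in sequentially. autocorr (z' n) = autocorr (z n)"
      proof -
        have "\<forall>\<^sub>F n in sequentially. - 1 < z n" "\<forall>\<^sub>F n in sequentially. z n < 1"
          using order_tendstoD[OF z] by simp_all
        thus ?thesis by eventually_elim (simp add: z'_def)
      qed
      ultimately show "(\<lambda>n. autocorr (x / (2 * pi * c n))) \<longlonglongrightarrow> autocorr 0"
        unfolding z_def by (rule Lim_transform_eventually)
    qed
  qed auto
  also have "(LINT x|lborel. std_normal_density x * autocorr 0) = autocorr 0"
    by simp
  finally have ilim: "(\<lambda>n. LINT u|lborel. ?u n u) \<longlonglongrightarrow> (LINT x|lborel. (f x)\<^sup>2)"
    unfolding gaussian_ft(2)[OF c] sq .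
  show "integrable lborel (\<lambda>u. (norm (ft u))\<^sup>2)" "(LINT u|lborel. (norm (ft u))\<^sup>2) = (LINT x|lborel. (f x)\<^sup>2)"
    using integral_monotone_convergence_nonneg[OF gaussian_ft(1)[OF c] mono _ lim ilim] by auto
qed

end

section \<open>The limit\<close>

lemma summable_on_int_powr:
  fixes s :: real
  assumes "s > 1"
  shows "(\<lambda>j::int. \<bar>of_int j\<bar> powr (- s)) summable_on (UNIV - {0})"
proof -
  have nat: "(\<lambda>n. real n powr (- s)) summable_on {1..}"
  proof (rule summable_on_subset_banach)
    show "(\<lambda>n. real n powr (- s)) summable_on UNIV"
      using assms by (intro norm_summable_imp_summable_on) (simp add: summable_real_powr_iff)
  qed auto
  have 1: "(\<lambda>j::int. \<bar>of_int j\<bar> powr (- s)) summable_on (int ` {1..})"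
    using nat by (subst summable_on_reindex) (auto simp: inj_on_def o_def)
  have 2: "(\<lambda>j::int. \<bar>of_int j\<bar> powr (- s)) summable_on ((\<lambda>n. - int n) ` {1..})"
    using nat by (subst summable_on_reindex) (auto simp: inj_on_def o_def)
  have eq: "UNIV - {0} = int ` {1..} \<union> (\<lambda>n. - int n) ` {1..}"
  proof (intro equalityI subsetI)
    fix j :: int assume "j \<in> UNIV - {0}"
    thus "j \<in> int ` {1..} \<union> (\<lambda>n. - int n) ` {1..}"
      by (cases "j > 0") (auto simp: image_iff intro: bexI[of _ "nat j"] bexI[of _ "nat (- j)"])
  qed auto
  show ?thesis unfolding eq by (intro summable_on_Un_disjoint 1 2) auto
qed

text \<open>Makes the unordered sum over the integers the limit of a sequence, so that the
  periodization inherits measurability from finite sums.\<close>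

lemma tendsto_sum_symmetric:
  fixes h :: "int \<Rightarrow> real"
  assumes "h summable_on UNIV"
  shows "(\<lambda>n. \<Sum>j\<in>{- int n..int n}. h j) \<longlonglongrightarrow> infsum h UNIV"
proof -
  have "filterlim (\<lambda>n. {- int n..int n}) (finite_subsets_at_top UNIV) sequentially"
    unfolding filterlim_finite_subsets_at_top
  proof (intro allI impI)
    fix X :: "int set" assume "finite X \<and> X \<subseteq> UNIV"
    hence fin: "finite X" by simp
    define m where "m = Max (insert 0 ((\<lambda>j. nat \<bar>j\<bar>) ` X))"
    have m: "nat \<bar>j\<bar> \<le> m" if "j \<in> X" for j unfolding m_def using fin that by (intro Max_ge) auto
    show "\<forall>\<^sub>F n in sequentially. finite {- int n..int n} \<and> X \<subseteq> {- int n..int n} \<and> {- int n..int n} \<subseteq> UNIV"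
      using eventually_ge_at_top[of m]
    proof eventually_elim
      case (elim n)
      have "j \<in> {- int n..int n}" if "j \<in> X" for j
        using m[OF that] elim by auto
      thus ?case by auto
    qed
  qed
  moreover have "(sum h \<longlongrightarrow> infsum h UNIV) (finite_subsets_at_top UNIV)"
    using has_sum_infsum[OF assms] by (simp add: has_sum_def)
  ultimately show ?thesis by (rule filterlim_compose[rotated])
qed

text \<open>\<open>Arg\<close> is continuous off the closed negative half-line, where it is the
  constant pi apart from the value 0 at the origin.\<close>

lemma measurable_Arg [measurable]: "Arg \<in> borel_measurable borel"
proof -
  have "(\<lambda>z. if z \<in> \<real>\<^sub>\<le>\<^sub>0 then pi else Arg z) \<in> borel_measurable borel"
    by (intro borel_measurable_continuous_on_if continuous_on_const continuous_on_Arg) auto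
  then have "(\<lambda>z. if z = 0 then 0 else if z \<in> \<real>\<^sub>\<le>\<^sub>0 then pi else Arg z) \<in> borel_measurable borel"
    by (intro measurable_If[of "\<lambda>_. 0" borel borel _ "\<lambda>z. z = 0"]) auto
  also have "(\<lambda>z. if z = 0 then 0 else if z \<in> \<real>\<^sub>\<le>\<^sub>0 then pi else Arg z) = Arg"
  proof
    fix z :: complex
    have "Arg z = pi" if "z \<in> \<real>\<^sub>\<le>\<^sub>0" "z \<noteq> 0"
      using that by (auto simp: Arg_eq_pi_iff complex_nonpos_Reals_iff complex_is_Real_iff complex_eq_iff)
    thus "(if z = 0 then 0 else if z \<in> \<real>\<^sub>\<le>\<^sub>0 then pi else Arg z) = Arg z" by (auto simp: Arg_zero)
  qed
  finally show ?thesis .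
qed

lemma circle_integral_affine:
  fixes h :: "complex \<Rightarrow> 'a::{banach, second_countable_topology}"
  assumes N: "N > 0" and [measurable]: "h \<in> borel_measurable borel"
  shows "(LINT z|circle_measure. h z)
       = (1 / real N) *\<^sub>R (LINT x|lborel. indicator {- real N / 2..real N / 2} x *\<^sub>R h (cis (2 * pi * x / real N)))"
proof -
  have ind: "indicator {-pi..pi} (2 * pi / real N * x) = (indicator {- real N / 2..real N / 2} x :: real)" for x
  proof -
    have "-pi \<le> 2 * pi / real N * x \<longleftrightarrow> - real N / 2 \<le> x"
    proof -
      have "-pi \<le> 2 * pi / real N * x \<longleftrightarrow> pi * (- real N) \<le> pi * (2 * x)" using N by (simp add: field_simps)
      thus ?thesis by (simp only: mult_le_cancel_left_pos[OF pi_gt_zero]) auto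
    qed
    moreover have "2 * pi / real N * x \<le> pi \<longleftrightarrow> x \<le> real N / 2"
    proof -
      have "2 * pi / real N * x \<le> pi \<longleftrightarrow> pi * (2 * x) \<le> pi * real N" using N by (simp add: field_simps)
      thus ?thesis by (simp only: mult_le_cancel_left_pos[OF pi_gt_zero]) auto
    qed
    ultimately show ?thesis by (simp add: indicator_def)
  qed
  have "(LBINT \<theta>:{-pi..pi}. h (cis \<theta>)) = (2 * pi / real N) *\<^sub>R (LINT x|lborel. indicator {-pi..pi} (2 * pi / real N * x) *\<^sub>R h (cis (2 * pi / real N * x)))"
    unfolding set_lebesgue_integral_def using N
    by (subst lborel_integral_real_affine[of "2 * pi / real N" _ 0]) auto
  thus ?thesis unfolding integral_circle_measure[OF assms(2)] ind using N by simp
qed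

text \<open>The Riemann sum as the integral of a step function; its limit thus becomes a matter of
  dominated convergence.\<close>

lemma sum_eq_step_integral:
  fixes \<psi> :: "real \<Rightarrow> real"
  assumes N: "N > 0"
  shows "(\<Sum>m<N. \<psi> (real m / real N)) / real N = (LBINT u:{0..<1}. \<psi> (of_int \<lfloor>real N * u\<rfloor> / real N))"
proof -
  let ?h = "\<lambda>u. \<psi> (of_int \<lfloor>real N * u\<rfloor> / real N)"
  have ivl: "integrable lborel (indicator {a..<b} :: real \<Rightarrow> real)" for a b
    by (rule integrable_real_indicator) (cases "a \<le> b"; auto)+
  have step: "set_integrable lborel {real m / real N..<real (Suc m) / real N} ?h"
    "(LBINT u:{real m / real N..<real (Suc m) / real N}. ?h u) = \<psi> (real m / real N) / real N" for m
  proof -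
    have eq: "indicator {real m / real N..<real (Suc m) / real N} u *\<^sub>R ?h u
        = indicator {real m / real N..<real (Suc m) / real N} u *\<^sub>R \<psi> (real m / real N)" for u
    proof (cases "u \<in> {real m / real N..<real (Suc m) / real N}")
      case True
      hence "\<lfloor>real N * u\<rfloor> = int m" using N by (intro floor_unique) (auto simp: field_simps)
      thus ?thesis by simp
    qed simp
    show "set_integrable lborel {real m / real N..<real (Suc m) / real N} ?h"
      unfolding set_integrable_def eq by (intro integrable_scaleR_left ivl)
    have "(LBINT u:{real m / real N..<real (Suc m) / real N}. ?h u) = (real (Suc m) / real N - real m / real N) * \<psi> (real m / real N)"
      unfolding set_lebesgue_integral_def eq using N ivl by (subst integral_scaleR_left) (auto simp: divide_right_mono)
    thus "(LBINT u:{real m / real N..<real (Suc m) / real N}. ?h u) = \<psi> (real m / real N) / real N"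
      by (simp add: diff_divide_distrib[symmetric])
  qed
  have "set_integrable lborel {0..<real M / real N} ?h \<and>
    (LBINT u:{0..<real M / real N}. ?h u) = (\<Sum>m<M. \<psi> (real m / real N)) / real N" for M
  proof (induction M)
    case 0
    show ?case by (simp add: set_integrable_def set_lebesgue_integral_def)
  next
    case (Suc M)
    have un: "{0..<real (Suc M) / real N} = {0..<real M / real N} \<union> {real M / real N..<real (Suc M) / real N}"
      using N by (intro ivl_disj_un_two(3)[symmetric]) (auto simp: divide_right_mono)
    have "set_integrable lborel {0..<real (Suc M) / real N} ?h"
      unfolding un using Suc step(1)[of M] by (intro set_integrable_Un) auto
    moreover have "(LBINT u:{0..<real (Suc M) / real N}. ?h u) = (\<Sum>m<M. \<psi> (real m / real N)) / real N + \<psi> (real M / real N) / real N"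
      unfolding un using Suc step[of M] by (subst set_integral_Un) auto
    ultimately show ?case by (simp add: add_divide_distrib)
  qed
  from this[of N] show ?thesis using N by simp
qed

locale even_decaying_function = decaying_function +
  assumes even_f: "f (- x) = f x"
begin

lemma ft_minus: "ft (- u) = ft u"
  unfolding ft_def by (subst lborel_integral_real_affine[of "-1" _ 0]) (auto simp: even_f)

lemma cnj_ft: "cnj (ft u) = ft u"
proof -
  have "cnj (ft u) = (LINT x|lborel. cnj (of_real (f x) * cis (2 * pi * u * x)))"
    unfolding ft_def by (rule Bochner_Integration.integral_cnj[symmetric])
  also have "\<dots> = ft (- u)" by (simp add: ft_def cis_cnj)
  finally show ?thesis by (simp add: ft_minus)
qed

lemma fourier_eq_ft: "fourier f u = ft u"
proof -
  have "fourier f u = ft (- u)"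
    unfolding fourier_def ft_def by (simp add: cis_conv_exp mult_ac)
  thus ?thesis by (simp add: ft_minus)
qed

text \<open>The transform of a real even function is real, so its complex square is the square of
  its modulus.\<close>

lemma fourier_square: "(fourier f u)\<^sup>2 = of_real ((norm (ft u))\<^sup>2)"
  using cnj_ft[of u] complex_norm_square[of "ft u"] by (simp add: fourier_eq_ft power2_eq_square)

text \<open>Times \<open>real N powr (- s)\<close>, this bounds the sum of all translates j <> 0 on
  the central period; the factor 2^s comes from |x + Nj| >= N|j|/2 there.\<close>

definition tail_const :: real where
  "tail_const = A * 2 powr s * (\<Sum>\<^sub>\<infinity>j\<in>UNIV - {0}. \<bar>of_int j\<bar> powr (- s))"

definition translate_sum :: "nat \<Rightarrow> real \<Rightarrow> real" where
  "translate_sum N x = (\<Sum>\<^sub>\<infinity>j\<in>(UNIV :: int set). f (x + real N * of_int j))"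

lemma periodization_eq_translate_sum:
  assumes "N > 0"
  shows "periodization f N \<theta> = translate_sum N (real N * \<theta> / (2 * pi))"
proof -
  have "real N / (2 * pi) * (\<theta> + 2 * pi * real_of_int j) = real N * \<theta> / (2 * pi) + real N * of_int j" for j
    using pi_gt_zero by (simp add: field_simps)
  thus ?thesis by (simp add: periodization_def translate_sum_def)
qed

lemma abs_f_translate_le:
  assumes N: "N > 0" and x: "\<bar>x\<bar> \<le> real N / 2" and j: "j \<noteq> 0"
  shows "\<bar>f (x + real N * of_int j)\<bar> \<le> A * 2 powr s * real N powr (- s) * \<bar>of_int j\<bar> powr (- s)"
proof -
  have j1: "\<bar>real_of_int j\<bar> \<ge> 1" using j by linarith
  have "real N * \<bar>of_int j\<bar> \<le> \<bar>x + real N * of_int j\<bar> + \<bar>x\<bar>"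
    using abs_triangle_ineq4[of "x + real N * of_int j" x] by (simp add: abs_mult)
  \<comment> \<open>With |j| >= 1, the bound |x| <= N/2 gives away at most half of N|j|.\<close>
  moreover have "real N * 1 \<le> real N * \<bar>of_int j\<bar>" by (rule mult_left_mono[OF j1]) simp
  ultimately have ge: "real N * \<bar>of_int j\<bar> / 2 \<le> 1 + \<bar>x + real N * of_int j\<bar>" using x by linarith
  have "decay s (x + real N * of_int j) \<le> (real N * \<bar>of_int j\<bar> / 2) powr (- s)"
    unfolding decay_def using s ge N j1 by (intro powr_mono2') auto
  also have "\<dots> = 2 powr s * real N powr (- s) * \<bar>of_int j\<bar> powr (- s)"
    by (simp add: powr_divide powr_mult powr_minus field_simps)
  finally have "A * decay s (x + real N * of_int j) \<le> A * (2 powr s * real N powr (- s) * \<bar>of_int j\<bar> powr (- s))"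
    by (rule mult_left_mono[OF _ A_nonneg])
  thus ?thesis using bound[of "x + real N * of_int j"] by (simp add: mult.assoc)
qed

lemma
  assumes N: "N > 0" and x: "\<bar>x\<bar> \<le> real N / 2"
  shows summable_on_translates: "(\<lambda>j::int. f (x + real N * of_int j)) summable_on UNIV"
    and abs_translate_sum_diff_le: "\<bar>translate_sum N x - f x\<bar> \<le> tail_const * real N powr (- s)"
proof -
  let ?h = "\<lambda>j::int. f (x + real N * of_int j)"
  let ?b = "\<lambda>j::int. A * 2 powr s * real N powr (- s) * \<bar>of_int j\<bar> powr (- s)"
  have b: "?b summable_on (UNIV - {0})"
    by (intro summable_on_cmult_right summable_on_int_powr s)
  have abs: "(\<lambda>j. norm (?h j)) summable_on (UNIV - {0})"
  proof (rule summable_on_comparison_test[OF b])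
    show "norm (?h j) \<le> ?b j" if "j \<in> UNIV - {0}" for j :: int
      using abs_f_translate_le[OF N x, of j] that by simp
  qed auto
  hence sum: "?h summable_on (UNIV - {0})" by (rule abs_summable_summable)
  have ins: "UNIV = insert 0 (UNIV - {0::int})" by auto
  show "?h summable_on UNIV"
    by (subst ins, subst summable_on_insert_iff) (use sum in auto)
  have "translate_sum N x = f x + infsum ?h (UNIV - {0})"
    unfolding translate_sum_def by (subst ins, subst infsum_insert) (use sum in auto)
  hence "\<bar>translate_sum N x - f x\<bar> = norm (infsum ?h (UNIV - {0}))" by simp
  also have "\<dots> \<le> infsum (\<lambda>j. norm (?h j)) (UNIV - {0})"
    by (rule norm_infsum_bound[OF abs])
  also have "\<dots> \<le> infsum ?b (UNIV - {0})"
    by (rule infsum_mono[OF abs b]) (use abs_f_translate_le[OF N x] in auto)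
  also have "\<dots> = tail_const * real N powr (- s)"
    by (simp add: infsum_cmult_right' tail_const_def)
  finally show "\<bar>translate_sum N x - f x\<bar> \<le> tail_const * real N powr (- s)" .
qed

lemma tail_const_nonneg: "tail_const \<ge> 0"
  unfolding tail_const_def using A_nonneg by (intro mult_nonneg_nonneg infsum_nonneg) auto

section \<open>The symbol on the circle and its restriction to one period\<close>

definition circle_fun :: "nat \<Rightarrow> complex \<Rightarrow> real" where
  "circle_fun N z = periodization f N (Arg z)"

lemma abs_Arg_scaled_le: "\<bar>real N * Arg z / (2 * pi)\<bar> \<le> real N / 2"
proof -
  have "real N * \<bar>Arg z\<bar> \<le> real N * pi"
    using Arg_bounded[of z] by (intro mult_left_mono) auto
  thus ?thesis by (simp add: abs_mult field_simps)
qed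

lemma bounded_borel_circle_fun:
  assumes N: "N > 0"
  shows "bounded_borel (circle_fun N)"
proof (rule bounded_borelI)
  let ?x = "\<lambda>z. real N * Arg z / (2 * pi)"
  show "\<bar>circle_fun N z\<bar> \<le> A + tail_const * real N powr (- s)" for z
    using abs_translate_sum_diff_le[OF N abs_Arg_scaled_le[of N z]] abs_f_le[of "?x z"]
    unfolding circle_fun_def periodization_eq_translate_sum[OF N] by linarith
  show "circle_fun N \<in> borel_measurable borel"
  proof (rule borel_measurable_LIMSEQ_real)
    show "(\<lambda>n. \<Sum>j\<in>{- int n..int n}. f (?x z + real N * of_int j)) \<longlonglongrightarrow> circle_fun N z" for z
      unfolding circle_fun_def periodization_eq_translate_sum[OF N] translate_sum_def
      by (rule tendsto_sum_symmetric[OF summable_on_translates[OF N abs_Arg_scaled_le]])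
    show "(\<lambda>z. \<Sum>j\<in>{- int n..int n}. f (?x z + real N * of_int j)) \<in> borel_measurable borel" for n
      by measurable
  qed
qed

text \<open>One period of F_N in the variable of f, continued by zero. Up to the factor 1/N, the
  Fourier coefficients of F_N become values of its Fourier transform at the points m/N.\<close>

definition windowed :: "nat \<Rightarrow> real \<Rightarrow> real" where
  "windowed N x = indicator {- real N / 2..real N / 2} x * circle_fun N (cis (2 * pi * x / real N))"

lemma measurable_windowed [measurable]:
  assumes "N > 0"
  shows "windowed N \<in> borel_measurable borel"
proof -
  have [measurable]: "circle_fun N \<in> borel_measurable borel"
    using bounded_borel_circle_fun[OF assms] by (simp add: bounded_borel_def)
  show ?thesis unfolding windowed_def[abs_def] by measurable
qed

text \<open>The endpoints, a null set, are left out: at x = -N/2 the value of \<open>Arg\<close> is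
  pi and not -pi.\<close>

lemma windowed_eq:
  assumes N: "N > 0" and x: "\<bar>x\<bar> < real N / 2"
  shows "windowed N x = translate_sum N x"
proof -
  have "Arg (cis (2 * pi * x / real N)) = 2 * pi * x / real N"
  proof (rule cis_Arg_unique[THEN sym, THEN sym])
    show "sgn (cis (2 * pi * x / real N)) = cis (2 * pi * x / real N)" by (simp add: sgn_div_norm)
    have "- (real N * pi) < pi * (2 * x)" "pi * (2 * x) \<le> real N * pi"
      using x mult_strict_left_mono[of "- real N" "2 * x" pi] mult_left_mono[of "2 * x" "real N" pi] by (auto simp: mult.commute)
    thus "- pi < 2 * pi * x / real N" "2 * pi * x / real N \<le> pi" using N by (auto simp: field_simps)
  qed
  moreover have "x \<in> {- real N / 2..real N / 2}" using x by (auto simp: abs_less_iff)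
  ultimately show ?thesis using N
    by (simp add: windowed_def circle_fun_def periodization_eq_translate_sum[OF N] del: atLeastAtMost_iff)
qed

text \<open>On the window |x| < N/2 one has N >= (1 + |x|)/2, so the periodization error of order
  N^(-s) is itself at most 2^s \<open>tail_const\<close> times \<open>decay s x\<close>. This gives
  a majorant independent of N.\<close>

definition dom_const :: real where
  "dom_const = A + tail_const * 2 powr s"

lemma AE_abs_windowed_le:
  assumes N: "N > 0"
  shows "AE x in lborel. \<bar>windowed N x\<bar> \<le> dom_const * decay s x"
  using AE_lborel_singleton[of "real N / 2"] AE_lborel_singleton[of "- real N / 2"]
proof eventually_elim
  case (elim x)
  show ?case
  proof (cases "\<bar>x\<bar> < real N / 2")
    case True
    have "real N powr (- s) \<le> ((1 + \<bar>x\<bar>) / 2) powr (- s)"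
      using True N s by (intro powr_mono2') auto
    also have "\<dots> = 2 powr s * decay s x"
      by (simp add: decay_def powr_divide powr_minus field_simps)
    finally have "tail_const * real N powr (- s) \<le> tail_const * (2 powr s * decay s x)"
      by (rule mult_left_mono[OF _ tail_const_nonneg])
    moreover have "\<bar>translate_sum N x\<bar> \<le> \<bar>f x\<bar> + tail_const * real N powr (- s)"
      using abs_translate_sum_diff_le[OF N, of x] True by linarith
    ultimately show ?thesis
      unfolding windowed_eq[OF N True] dom_const_def using bound[of x] by (simp add: algebra_simps)
  next
    case False
    hence "x \<notin> {- real N / 2..real N / 2}" using elim by auto
    thus ?thesis using A_nonneg tail_const_nonneg by (simp add: windowed_def dom_const_def)
  qed
qed

lemma tendsto_windowed: "(\<lambda>n. windowed (Suc n) x) \<longlonglongrightarrow> f x"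
proof -
  have "(\<lambda>n. tail_const * real (Suc n) powr (- s)) \<longlonglongrightarrow> tail_const * 0"
    using s by (intro tendsto_mult tendsto_const tendsto_neg_powr filterlim_compose[OF filterlim_real_sequentially filterlim_Suc]) auto
  hence "(\<lambda>n. tail_const * real (Suc n) powr (- s)) \<longlonglongrightarrow> 0" by simp
  moreover have "\<forall>\<^sub>F n in sequentially. norm (windowed (Suc n) x - f x) \<le> tail_const * real (Suc n) powr (- s)"
    using eventually_gt_at_top[of "nat \<lceil>2 * \<bar>x\<bar>\<rceil>"]
  proof eventually_elim
    case (elim n)
    hence "2 * \<bar>x\<bar> < real (Suc n)" by linarith
    hence x: "\<bar>x\<bar> < real (Suc n) / 2" by simp
    show ?case using abs_translate_sum_diff_le[of "Suc n" x] x by (simp add: windowed_eq)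
  qed
  ultimately have "(\<lambda>n. windowed (Suc n) x - f x) \<longlonglongrightarrow> 0" by (rule Lim_null_comparison[rotated])
  thus ?thesis by (simp add: LIM_zero_iff)
qed

lemma integrable_dom: "integrable lborel (\<lambda>x. dom_const * decay s x)"
  by (intro integrable_mult_right integrable_decay s)

definition windowed_ft :: "nat \<Rightarrow> real \<Rightarrow> complex" where
  "windowed_ft N u = (LINT x|lborel. of_real (windowed N x) * cis (2 * pi * u * x))"

text \<open>The frequency may move with n, as the sample points of the Riemann sum do.\<close>

lemma tendsto_windowed_ft:
  assumes u: "u \<longlonglongrightarrow> v"
  shows "(\<lambda>n. windowed_ft (Suc n) (u n)) \<longlonglongrightarrow> ft v"
  unfolding windowed_ft_def ft_def
proof (rule integral_dominated_convergence[OF _ _ integrable_dom])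
  have [measurable]: "windowed (Suc n) \<in> borel_measurable borel" for n by (rule measurable_windowed) simp
  show "(\<lambda>x. of_real (windowed (Suc n) x) * cis (2 * pi * u n * x)) \<in> borel_measurable lborel" for n by measurable
  show "AE x in lborel. (\<lambda>n. of_real (windowed (Suc n) x) * cis (2 * pi * u n * x)) \<longlonglongrightarrow> of_real (f x) * cis (2 * pi * v * x)"
  proof (intro AE_I2 tendsto_mult tendsto_of_real tendsto_windowed)
    fix x
    have "isCont cis (2 * pi * v * x)"
      using continuous_on_cis[OF continuous_on_id, of UNIV] by (simp add: continuous_on_eq_continuous_at)
    moreover have "(\<lambda>n. 2 * pi * u n * x) \<longlonglongrightarrow> 2 * pi * v * x" by (intro tendsto_intros u)
    ultimately show "(\<lambda>n. cis (2 * pi * u n * x)) \<longlonglongrightarrow> cis (2 * pi * v * x)" by (rule isCont_tendsto_compose)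
  qed
  show "AE x in lborel. norm (complex_of_real (windowed (Suc n) x) * cis (2 * pi * u n * x)) \<le> dom_const * decay s x" for n
    using AE_abs_windowed_le[of "Suc n"] by (auto simp: norm_mult)
qed auto

lemma norm_windowed_ft_le:
  assumes N: "N > 0"
  shows "norm (windowed_ft N u) \<le> (LINT x|lborel. dom_const * decay s x)"
proof -
  have m [measurable]: "windowed N \<in> borel_measurable borel" by (rule measurable_windowed[OF N])
  have "norm (windowed_ft N u) \<le> (LINT x|lborel. \<bar>windowed N x\<bar>)"
    unfolding windowed_ft_def by (rule order_trans[OF integral_norm_bound]) (simp add: norm_mult)
  also have "\<dots> \<le> (LINT x|lborel. dom_const * decay s x)"
  proof (rule integral_mono_AE[OF _ integrable_dom AE_abs_windowed_le[OF N]])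
    show "integrable lborel (\<lambda>x. \<bar>windowed N x\<bar>)"
      by (rule Bochner_Integration.integrable_bound[OF integrable_dom])
         (use AE_abs_windowed_le[OF N] in \<open>auto elim!: eventually_mono\<close>)
  qed
  finally show ?thesis .
qed

lemma measurable_windowed_ft [measurable]:
  assumes "N > 0"
  shows "windowed_ft N \<in> borel_measurable borel"
proof -
  have [measurable]: "windowed N \<in> borel_measurable lborel" using measurable_windowed[OF assms] by simp
  have "(\<lambda>u. LINT x|lborel. of_real (windowed N x) * cis (2 * pi * u * x)) \<in> borel_measurable borel"
    by measurable
  thus ?thesis by (simp add: windowed_ft_def[abs_def])
qed

lemma tendsto_integral_windowed_square: "(\<lambda>n. LINT x|lborel. (windowed (Suc n) x)\<^sup>2) \<longlonglongrightarrow> (LINT x|lborel. (f x)\<^sup>2)"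
proof (rule integral_dominated_convergence[where w = "\<lambda>x. dom_const * (dom_const * decay s x)"])
  have [measurable]: "windowed (Suc n) \<in> borel_measurable borel" for n by (rule measurable_windowed) simp
  show "(\<lambda>x. (windowed (Suc n) x)\<^sup>2) \<in> borel_measurable lborel" for n by measurable
  show "integrable lborel (\<lambda>x. dom_const * (dom_const * decay s x))" by (intro integrable_mult_right integrable_dom)
  show "AE x in lborel. (\<lambda>n. (windowed (Suc n) x)\<^sup>2) \<longlonglongrightarrow> (f x)\<^sup>2"
    by (intro AE_I2 tendsto_power tendsto_windowed)
  show "AE x in lborel. norm ((windowed (Suc n) x)\<^sup>2) \<le> dom_const * (dom_const * decay s x)" for n
    using AE_abs_windowed_le[OF zero_less_Suc[of n]]
  proof eventually_elim
    case (elim x)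
    have d: "dom_const \<ge> 0" using A_nonneg tail_const_nonneg by (simp add: dom_const_def)
    have "dom_const * decay s x \<le> dom_const * 1" using decay_le_1[of s x] s d by (intro mult_left_mono) auto
    with elim have "\<bar>windowed (Suc n) x\<bar> \<le> dom_const" by simp
    hence "\<bar>windowed (Suc n) x\<bar> * \<bar>windowed (Suc n) x\<bar> \<le> dom_const * (dom_const * decay s x)"
      using elim d by (intro mult_mono) auto
    thus ?case by (simp add: power2_eq_square abs_mult)
  qed
qed auto

text \<open>The sum in \<open>variance_eig_sum\<close> starts at m = 1, the Riemann sum at m = 0.
  Compensating its extra term adds |\<open>windowed_ft N 0\<close>|^2 / N twice, and the squared
  mean subtracts it once; hence the single correction term.\<close>

lemma variance_linear_stat:
  assumes N: "N > 0" and H: "haar M N"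
  shows "(LINT U|M. (linear_stat f N U - (LINT V|M. linear_stat f N V))\<^sup>2)
    = (LINT x|lborel. (windowed N x)\<^sup>2) + (norm (windowed_ft N 0))\<^sup>2 / real N
      - 2 * ((\<Sum>m<N. (1 - real m / real N) * (norm (windowed_ft N (real m / real N)))\<^sup>2) / real N)"
proof -
  interpret haar M N by (rule H)
  have bb: "bounded_borel (circle_fun N)" by (rule bounded_borel_circle_fun[OF N])
  have m [measurable]: "circle_fun N \<in> borel_measurable borel" using bb by (simp add: bounded_borel_def)
  have pm: "(\<lambda>z. z ^ k) \<in> borel_measurable (borel :: complex measure)" for k
    by (intro borel_measurable_continuous_onI continuous_intros)
  have 1: "(LINT z|circle_measure. (circle_fun N z)\<^sup>2) = (LINT x|lborel. (windowed N x)\<^sup>2) / real N"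
  proof -
    have "indicator S x *\<^sub>R y\<^sup>2 = (indicator S x * y)\<^sup>2" for S and x y :: real by (simp add: indicator_def)
    thus ?thesis by (subst circle_integral_affine[OF N]) (auto simp: windowed_def)
  qed
  have 2: "(LINT z|circle_measure. of_real (circle_fun N z) * z ^ k) = windowed_ft N (real k / real N) / of_nat N" for k
  proof -
    have "(LINT z|circle_measure. of_real (circle_fun N z) * z ^ k)
       = (1 / real N) *\<^sub>R (LINT x|lborel. indicator {- real N / 2..real N / 2} x *\<^sub>R
            (of_real (circle_fun N (cis (2 * pi * x / real N))) * cis (2 * pi * x / real N) ^ k))"
      by (rule circle_integral_affine[OF N]) (use m pm in auto)
    also have "(LINT x|lborel. indicator {- real N / 2..real N / 2} x *\<^sub>R
            (of_real (circle_fun N (cis (2 * pi * x / real N))) * cis (2 * pi * x / real N) ^ k)) = windowed_ft N (real k / real N)"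
      unfolding windowed_ft_def windowed_def Complex.DeMoivre
      by (intro Bochner_Integration.integral_cong refl) (auto simp: scaleR_conv_of_real mult_ac)
    finally show ?thesis by (simp add: scaleR_conv_of_real)
  qed
  have 3: "(LINT z|circle_measure. circle_fun N z)\<^sup>2 = (norm (windowed_ft N 0))\<^sup>2 / real N ^ 2"
  proof -
    have "complex_of_real (LINT z|circle_measure. circle_fun N z) = windowed_ft N 0 / of_nat N"
      using 2[of 0] by simp
    hence "norm (complex_of_real (LINT z|circle_measure. circle_fun N z)) = norm (windowed_ft N 0) / real N"
      by (simp add: norm_divide)
    hence "\<bar>LINT z|circle_measure. circle_fun N z\<bar> = norm (windowed_ft N 0) / real N" by simp
    thus ?thesis by (metis power2_abs power_divide)
  qed
  have ls: "linear_stat f N = eig_sum (circle_fun N)"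
    by (simp add: linear_stat_def[abs_def] eig_sum_def[abs_def] circle_fun_def[abs_def])
  have sum: "real N * ((\<Sum>m=1..<N. real (N - m) * (norm (windowed_ft N (real m / real N) / of_nat N))\<^sup>2))
     = (\<Sum>m<N. (1 - real m / real N) * (norm (windowed_ft N (real m / real N)))\<^sup>2) - (norm (windowed_ft N 0))\<^sup>2"
  proof -
    have "{..<N} = insert 0 {1..<N}" using N by auto
    hence "(\<Sum>m<N. (1 - real m / real N) * (norm (windowed_ft N (real m / real N)))\<^sup>2) - (norm (windowed_ft N 0))\<^sup>2
       = (\<Sum>m=1..<N. (1 - real m / real N) * (norm (windowed_ft N (real m / real N)))\<^sup>2)" by simp
    also have "\<dots> = real N * (\<Sum>m=1..<N. real (N - m) * (norm (windowed_ft N (real m / real N) / of_nat N))\<^sup>2)"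
      unfolding sum_distrib_left using N
      by (intro sum.cong refl) (auto simp: norm_divide power_divide field_simps of_nat_diff power2_eq_square)
    finally show ?thesis ..
  qed
  define S where "S = (\<Sum>m=1..<N. real (N - m) * (norm (windowed_ft N (real m / real N) / of_nat N))\<^sup>2)"
  have S: "S = ((\<Sum>m<N. (1 - real m / real N) * (norm (windowed_ft N (real m / real N)))\<^sup>2) - (norm (windowed_ft N 0))\<^sup>2) / real N"
    using sum N by (simp add: S_def field_simps)
  show ?thesis
    unfolding ls variance_eig_sum[OF N bb] 1 2 3 S_def[symmetric] S using N
    by (simp add: field_simps power2_eq_square)
qed

text \<open>The sample points floor(Nu)/N converge to u together with the transforms, by
  \<open>tendsto_windowed_ft\<close>; \<open>norm_windowed_ft_le\<close> provides a constant
  majorant on the unit interval.\<close>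

lemma tendsto_riemann_sum:
  "(\<lambda>n. (\<Sum>m<Suc n. (1 - real m / real (Suc n)) * (norm (windowed_ft (Suc n) (real m / real (Suc n))))\<^sup>2) / real (Suc n))
     \<longlonglongrightarrow> (LBINT u:{0..<1}. (1 - u) * (norm (ft u))\<^sup>2)"
proof -
  let ?L = "LINT x|lborel. dom_const * decay s x"
  let ?a = "\<lambda>n u. of_int \<lfloor>real (Suc n) * u\<rfloor> / real (Suc n)"
  have a: "(\<lambda>n. ?a n u) \<longlonglongrightarrow> u" for u :: real
  proof -
    have "norm (?a n u - u) \<le> 1 / real (Suc n)" for n
    proof -
      have "?a n u - u = (of_int \<lfloor>real (Suc n) * u\<rfloor> - real (Suc n) * u) / real (Suc n)"
        by (simp add: field_simps)
      also have "norm \<dots> = \<bar>of_int \<lfloor>real (Suc n) * u\<rfloor> - real (Suc n) * u\<bar> / real (Suc n)"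
        by (simp add: abs_divide)
      also have "\<dots> \<le> 1 / real (Suc n)" by (intro divide_right_mono) linarith+
      finally show ?thesis .
    qed
    hence "(\<lambda>n. ?a n u - u) \<longlonglongrightarrow> 0"
      by (intro Lim_null_comparison[OF always_eventually LIMSEQ_Suc[OF lim_1_over_n]]) auto
    thus ?thesis by (simp only: LIM_zero_iff)
  qed
  have "(\<lambda>n. LBINT u:{0..<1}. (1 - ?a n u) * (norm (windowed_ft (Suc n) (?a n u)))\<^sup>2) \<longlonglongrightarrow> (LBINT u:{0..<1}. (1 - u) * (norm (ft u))\<^sup>2)"
    unfolding set_lebesgue_integral_def
  proof (rule integral_dominated_convergence[where w = "\<lambda>u. indicator {0..<1} u * ?L\<^sup>2"])
    have [measurable]: "windowed_ft (Suc n) \<in> borel_measurable borel" for n by (rule measurable_windowed_ft) simp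
    show "(\<lambda>u. indicator {0..<1} u *\<^sub>R ((1 - ?a n u) * (norm (windowed_ft (Suc n) (?a n u)))\<^sup>2)) \<in> borel_measurable lborel" for n
      by measurable
    show "(\<lambda>u. indicator {0..<1} u *\<^sub>R ((1 - u) * (norm (ft u))\<^sup>2)) \<in> borel_measurable lborel" by measurable
    show "integrable lborel (\<lambda>u::real. indicator {0..<1} u * ?L\<^sup>2)"
      by (intro integrable_mult_left integrable_real_indicator) auto
    show "AE u in lborel. (\<lambda>n. indicator {0..<1} u *\<^sub>R ((1 - ?a n u) * (norm (windowed_ft (Suc n) (?a n u)))\<^sup>2))
        \<longlonglongrightarrow> indicator {0..<1} u *\<^sub>R ((1 - u) * (norm (ft u))\<^sup>2)"
      by (intro AE_I2 tendsto_intros tendsto_windowed_ft a)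
    show "AE u in lborel. norm (indicator {0..<1} u *\<^sub>R ((1 - ?a n u) * (norm (windowed_ft (Suc n) (?a n u)))\<^sup>2)) \<le> indicator {0..<1} u * ?L\<^sup>2" for n
    proof (rule AE_I2)
      fix u :: real
      show "norm (indicator {0..<1} u *\<^sub>R ((1 - ?a n u) * (norm (windowed_ft (Suc n) (?a n u)))\<^sup>2)) \<le> indicator {0..<1} u * ?L\<^sup>2"
      proof (cases "u \<in> {0..<1}")
        case True
        have "0 \<le> \<lfloor>real (Suc n) * u\<rfloor>" using True by simp
        hence a0: "?a n u \<ge> 0" by simp
        have "of_int \<lfloor>real (Suc n) * u\<rfloor> \<le> real (Suc n) * u" by linarith
        also have "\<dots> \<le> real (Suc n) * 1" using True by (intro mult_left_mono) auto
        finally have a1: "?a n u \<le> 1" by simp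
        have "\<bar>1 - ?a n u\<bar> * (norm (windowed_ft (Suc n) (?a n u)))\<^sup>2 \<le> 1 * ?L\<^sup>2"
          using a0 a1 norm_windowed_ft_le[of "Suc n" "?a n u"] by (intro mult_mono power_mono) auto
        thus ?thesis using True by (simp add: abs_mult del: of_nat_Suc)
      qed simp
    qed
  qed
  thus ?thesis
    using sum_eq_step_integral[of "Suc _" "\<lambda>u. (1 - u) * (norm (windowed_ft (Suc _) u))\<^sup>2"] by simp
qed

text \<open>min |u| 1 is 1 minus the triangle max 0 (1 - |u|). Plancherel integrates the part with
  1, and evenness folds the triangle onto the unit interval.\<close>

lemma integral_min_ft:
  "(LINT u|lborel. min \<bar>u\<bar> 1 * (norm (ft u))\<^sup>2)
     = (LINT x|lborel. (f x)\<^sup>2) - 2 * (LBINT u:{0..<1}. (1 - u) * (norm (ft u))\<^sup>2)"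
proof -
  define h where "h u = max 0 (1 - \<bar>u\<bar>) * (norm (ft u))\<^sup>2" for u
  have hm [measurable]: "h \<in> borel_measurable borel" unfolding h_def[abs_def] by measurable
  have h: "integrable lborel h"
    by (rule Bochner_Integration.integrable_bound[OF Plancherel(1)])
       (auto simp: h_def abs_mult intro!: mult_left_le_one_le)
  have hp: "integrable lborel (\<lambda>u. indicator {0..} u * h u)" and hn: "integrable lborel (\<lambda>u. indicator {..<0} u * h u)"
    by (rule Bochner_Integration.integrable_bound[OF h]; auto simp: indicator_def)+
  have "(LINT u|lborel. h u) = (LINT u|lborel. indicator {0..} u * h u + indicator {..<0} u * h u)"
    by (intro Bochner_Integration.integral_cong) (auto simp: indicator_def)
  also have "\<dots> = (LINT u|lborel. indicator {0..} u * h u) + (LINT u|lborel. indicator {..<0} u * h u)"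
    by (rule Bochner_Integration.integral_add[OF hp hn])
  also have "(LINT u|lborel. indicator {..<0} u * h u) = (LINT u|lborel. indicator {..<0} (- u) * h (- u))"
    by (subst lborel_integral_real_affine[of "-1" _ 0]) auto
  also have "\<dots> = (LINT u|lborel. indicator {0..} u * h u)"
  proof (rule integral_cong_AE)
    \<comment> \<open>The reflected indicator and that of the closed half-line differ at u = 0,
      hence equality only almost everywhere.\<close>
    show "AE u in lborel. indicator {..<0} (- u) * h (- u) = indicator {0..} u * h u"
      using AE_lborel_singleton[of 0] by eventually_elim (auto simp: indicator_def h_def ft_minus)
  qed measurable
  also have "(LINT u|lborel. indicator {0..} u * h u) = (LBINT u:{0..<1}. (1 - u) * (norm (ft u))\<^sup>2)"
    unfolding set_lebesgue_integral_def
    by (intro Bochner_Integration.integral_cong refl) (auto simp: indicator_def h_def)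
  finally have hh: "(LINT u|lborel. h u) = 2 * (LBINT u:{0..<1}. (1 - u) * (norm (ft u))\<^sup>2)" by simp
  have "min \<bar>u\<bar> 1 * (norm (ft u))\<^sup>2 = (norm (ft u))\<^sup>2 - h u" for u
    by (auto simp: h_def min_def max_def algebra_simps)
  hence "(LINT u|lborel. min \<bar>u\<bar> 1 * (norm (ft u))\<^sup>2) = (LINT u|lborel. (norm (ft u))\<^sup>2) - (LINT u|lborel. h u)"
    using Plancherel(1) h by simp
  thus ?thesis unfolding Plancherel(2) hh .
qed

end

theorem theorem6p2:
  fixes f :: "real \<Rightarrow> real"
    and \<mu> :: "nat \<Rightarrow> complex mat measure"
  assumes measurable: "f \<in> borel_measurable borel"
    and even: "\<And>x. f (- x) = f x"
    and decay: "\<exists>\<epsilon>>0. \<exists>A>0. \<forall>x. \<bar>f x\<bar> < A * (1 + \<bar>x\<bar>) powr (- (1 + \<epsilon>))"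
    and haar: "\<And>N. N > 0 \<Longrightarrow> haar_prob N (\<mu> N)"
  shows "(\<lambda>N. complex_of_real
             (LINT U|\<mu> N. (linear_stat f N U - (LINT V|\<mu> N. linear_stat f N V))\<^sup>2))
         \<longlonglongrightarrow> (LINT u|lborel. complex_of_real (min \<bar>u\<bar> 1) * (fourier f u)\<^sup>2)"
proof -
  obtain \<epsilon> A where eA: "\<epsilon> > 0" "\<And>x. \<bar>f x\<bar> < A * (1 + \<bar>x\<bar>) powr (- (1 + \<epsilon>))"
    using decay by blast
  interpret even_decaying_function f A "1 + \<epsilon>"
    by unfold_locales (use measurable even eA in \<open>auto simp: decay_def intro: less_imp_le\<close>)
  have haar': "haar (\<mu> N) N" if "N > 0" for N
    using haar[OF that] by (auto simp: haar_prob_def haar_def haar_axioms_def)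
  let ?V = "\<lambda>N. LINT U|\<mu> N. (linear_stat f N U - (LINT V|\<mu> N. linear_stat f N V))\<^sup>2"
  \<comment> \<open>The correction from m = 0 has a convergent numerator and is therefore of order
    1/N.\<close>
  have "(\<lambda>n. (norm (windowed_ft (Suc n) 0))\<^sup>2 * (1 / real (Suc n))) \<longlonglongrightarrow> (norm (ft 0))\<^sup>2 * 0"
    by (intro tendsto_intros tendsto_windowed_ft LIMSEQ_Suc[OF lim_1_over_n])
  hence zero: "(\<lambda>n. (norm (windowed_ft (Suc n) 0))\<^sup>2 / real (Suc n)) \<longlonglongrightarrow> 0" by simp
  have "(\<lambda>n. ?V (Suc n)) \<longlonglongrightarrow> (LINT x|lborel. (f x)\<^sup>2) + 0 - 2 * (LBINT u:{0..<1}. (1 - u) * (norm (ft u))\<^sup>2)"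
    unfolding variance_linear_stat[OF zero_less_Suc haar'[OF zero_less_Suc]]
    by (intro tendsto_diff tendsto_add tendsto_mult tendsto_const tendsto_integral_windowed_square zero tendsto_riemann_sum)
  hence "(\<lambda>n. ?V (Suc n)) \<longlonglongrightarrow> (LINT u|lborel. min \<bar>u\<bar> 1 * (norm (ft u))\<^sup>2)"
    by (simp add: integral_min_ft)
  hence "?V \<longlonglongrightarrow> (LINT u|lborel. min \<bar>u\<bar> 1 * (norm (ft u))\<^sup>2)"
    by (rule LIMSEQ_imp_Suc)
  hence "(\<lambda>N. complex_of_real (?V N)) \<longlonglongrightarrow> complex_of_real (LINT u|lborel. min \<bar>u\<bar> 1 * (norm (ft u))\<^sup>2)"
    by (rule tendsto_of_real)
  also have "complex_of_real (LINT u|lborel. min \<bar>u\<bar> 1 * (norm (ft u))\<^sup>2)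
      = (LINT u|lborel. complex_of_real (min \<bar>u\<bar> 1) * (fourier f u)\<^sup>2)"
    unfolding fourier_square of_real_mult[symmetric] by (rule integral_complex_of_real[symmetric])
  finally show ?thesis .
qed

end
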